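(* Let $H$ be a separable infinite-dimensional complex Hilbert space. There is a separable $\mathrm{C}^*$-subalgebra $B$ of the Calkin algebra $\mathcal{Q}(H)=\mathcal{B}(H)/\mathcal{K}(H)$ such that the relative commutant $\mathcal{Q}(H)\cap B'$ has no simple, noncommutative $\mathrm{C}^*$-subalgebra that contains the unit of $\mathcal{Q}(H)$.
   Context: $\mathcal{Q}(H)\cap B'=\{x\in\mathcal{Q}(H)\mid xb=bx\text{ for all }b\in B\}$. *)

theory Defs
  imports "HOL-Analysis.Analysis"
begin

section \<open>Complex vector spaces and Hilbert spaces\<close>

text \<open>HOL-Analysis has real vector, normed and inner product spaces only. The classes below add a
  complex scalar multiplication that extends the real one, so that all the real theory (topology,
  completeness, bounded linear functions) applies to their instances.\<close>

class scaleC = scaleR +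
  fixes scaleC :: "complex \<Rightarrow> 'a \<Rightarrow> 'a"  (infixr \<open>*\<^sub>C\<close> 75)
  assumes scaleR_scaleC: "r *\<^sub>R x = complex_of_real r *\<^sub>C x"

class complex_vector = scaleC + ab_group_add +
  assumes scaleC_add_right: "a *\<^sub>C (x + y) = a *\<^sub>C x + a *\<^sub>C y"
    and scaleC_add_left: "(a + b) *\<^sub>C x = a *\<^sub>C x + b *\<^sub>C x"
    and scaleC_scaleC: "a *\<^sub>C b *\<^sub>C x = (a * b) *\<^sub>C x"
    and scaleC_one: "1 *\<^sub>C x = x"

subclass (in complex_vector) real_vector
  by standard
    (simp_all add: scaleR_scaleC scaleC_add_right scaleC_add_left scaleC_scaleC scaleC_one)

global_interpretation complex_vector: vector_space "scaleC :: complex \<Rightarrow> 'a \<Rightarrow> 'a::complex_vector"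
  defines cspan = complex_vector.span
  by standard (simp_all add: scaleC_add_right scaleC_add_left scaleC_scaleC scaleC_one)

class complex_normed_vector = complex_vector + real_normed_vector +
  assumes norm_scaleC: "norm (c *\<^sub>C x) = cmod c * norm x"

text \<open>The inner product is linear in the first and conjugate linear in the second argument. The
  last axiom contains positive definiteness and says that the norm is the one induced by the inner
  product.\<close>

class complex_inner = complex_normed_vector +
  fixes cinner :: "'a \<Rightarrow> 'a \<Rightarrow> complex"
  assumes cinner_commute: "cinner x y = cnj (cinner y x)"
    and cinner_add_left: "cinner (x + y) z = cinner x z + cinner y z"
    and cinner_scaleC_left: "cinner (c *\<^sub>C x) y = c * cinner x y"
    and cinner_self: "cinner x x = complex_of_real ((norm x)\<^sup>2)"

class chilbert_space = complex_inner + complete_space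

instance chilbert_space \<subseteq> banach ..


section \<open>C*-algebras\<close>

class complex_algebra = complex_vector + ring +
  assumes mult_scaleC_left: "c *\<^sub>C x * y = c *\<^sub>C (x * y)"
    and mult_scaleC_right: "x * c *\<^sub>C y = c *\<^sub>C (x * y)"

subclass (in complex_algebra) real_algebra
  by standard (simp_all add: scaleR_scaleC mult_scaleC_left mult_scaleC_right)

text \<open>Unital C*-algebras. The axiom \<open>0 \<noteq> 1\<close> is left out, so that
  the Calkin algebra of a finite-dimensional space, which is zero, is an instance too.\<close>

class cstar_algebra = complex_algebra + monoid_mult + complex_normed_vector + banach +
  fixes star :: "'a \<Rightarrow> 'a"
  assumes norm_mult_le: "norm (x * y) \<le> norm x * norm y"
    and star_star: "star (star x) = x"
    and star_add: "star (x + y) = star x + star y"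
    and star_scaleC: "star (c *\<^sub>C x) = cnj c *\<^sub>C star x"
    and star_mult: "star (x * y) = star y * star x"
    and norm_star_mult_self: "norm (star x * x) = (norm x)\<^sup>2"

subclass (in cstar_algebra) real_normed_algebra
  by standard (rule norm_mult_le)

definition cstar_subalgebra :: "'a::cstar_algebra set \<Rightarrow> bool" where
  "cstar_subalgebra A \<longleftrightarrow>
     closed A \<and> complex_vector.subspace A \<and>
     (\<forall>x\<in>A. \<forall>y\<in>A. x * y \<in> A) \<and> (\<forall>x\<in>A. star x \<in> A)"

definition closed_ideal_of :: "'a::cstar_algebra set \<Rightarrow> 'a set \<Rightarrow> bool" where
  "closed_ideal_of J A \<longleftrightarrow>
     J \<subseteq> A \<and> closed J \<and> complex_vector.subspace J \<and>
     (\<forall>a\<in>A. \<forall>x\<in>J. a * x \<in> J \<and> x * a \<in> J)"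

definition simple_algebra :: "'a::cstar_algebra set \<Rightarrow> bool" where
  "simple_algebra A \<longleftrightarrow> A \<noteq> {0} \<and> (\<forall>J. closed_ideal_of J A \<longrightarrow> J = {0} \<or> J = A)"

definition commutative_algebra :: "'a::cstar_algebra set \<Rightarrow> bool" where
  "commutative_algebra A \<longleftrightarrow> (\<forall>x\<in>A. \<forall>y\<in>A. x * y = y * x)"

definition relative_commutant :: "'a::cstar_algebra set \<Rightarrow> 'a set" where
  "relative_commutant B = {x. \<forall>b\<in>B. x * b = b * x}"


section \<open>Bounded operators\<close>

lemma cinner_add_right: "cinner x (y + z) = cinner x y + cinner x z" for x :: "'a::complex_inner"
  by (metis cinner_add_left cinner_commute complex_cnj_add)

lemma cinner_scaleC_right: "cinner x (c *\<^sub>C y) = cnj c * cinner x y" for x :: "'a::complex_inner"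
  by (metis cinner_commute cinner_scaleC_left complex_cnj_mult)

lemma cinner_zero_left [simp]: "cinner 0 y = 0" for y :: "'a::complex_inner"
  using cinner_add_left[of 0 0 y] by simp

lemma cinner_zero_right [simp]: "cinner y 0 = 0" for y :: "'a::complex_inner"
  using cinner_add_right[of y 0 0] by simp

lemma cinner_minus_left: "cinner (- x) y = - cinner x y" for y :: "'a::complex_inner"
  using cinner_add_left[of x "-x" y] by (simp add: add_eq_0_iff)

lemma cinner_minus_right: "cinner x (- y) = - cinner x y" for y :: "'a::complex_inner"
  using cinner_add_right[of x y "-y"] by (simp add: add_eq_0_iff)

lemma cinner_diff_left: "cinner (x - z) y = cinner x y - cinner z y" for y :: "'a::complex_inner"
  using cinner_add_left[of x "-z" y] by (simp add: cinner_minus_left)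

lemma cinner_diff_right: "cinner x (y - z) = cinner x y - cinner x z" for y :: "'a::complex_inner"
  using cinner_add_right[of x y "-z"] by (simp add: cinner_minus_right)

lemma Re_cinner_self: "Re (cinner x x) = (norm x)\<^sup>2" for x :: "'a::complex_inner"
  by (simp add: cinner_self)

lemma norm_add_square: "(norm (x + y))\<^sup>2 = (norm x)\<^sup>2 + (norm y)\<^sup>2 + 2 * Re (cinner x y)"
  for x :: "'a::complex_inner"
proof -
  have "Re (cinner y x) = Re (cinner x y)"
    using cinner_commute[of x y] by simp
  then show ?thesis
    by (simp add: Re_cinner_self[symmetric] cinner_add_left cinner_add_right)
qed

lemma norm_diff_square: "(norm (x - y))\<^sup>2 = (norm x)\<^sup>2 + (norm y)\<^sup>2 - 2 * Re (cinner x y)"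
  for x :: "'a::complex_inner"
  using norm_add_square[of x "- y"] by (simp add: cinner_minus_right)

lemma parallelogram: "(norm (x + y))\<^sup>2 + (norm (x - y))\<^sup>2 = 2 * (norm x)\<^sup>2 + 2 * (norm y)\<^sup>2"
  for x :: "'a::complex_inner"
  by (simp add: norm_add_square norm_diff_square)

lemma Cauchy_Schwarz_cinner: "cmod (cinner x y) \<le> norm x * norm y" for x :: "'a::complex_inner"
proof (cases "y = 0")
  case False
  define n where "n = (norm y)\<^sup>2"
  have n: "n > 0" using False by (simp add: n_def)
  define c where "c = cinner x y / complex_of_real n"
  have "0 \<le> (norm (x - c *\<^sub>C y))\<^sup>2" by simp
  also have "\<dots> = (norm x)\<^sup>2 + (cmod c)\<^sup>2 * n - 2 * Re (cnj c * cinner x y)"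
    by (simp add: norm_diff_square norm_scaleC cinner_scaleC_right power_mult_distrib n_def)
  also have "cnj c * cinner x y = complex_of_real ((cmod (cinner x y))\<^sup>2 / n)"
    using complex_norm_square[of "cinner x y"] by (simp add: c_def mult.commute)
  also have "(cmod c)\<^sup>2 * n = (cmod (cinner x y))\<^sup>2 / n"
    using n by (simp add: c_def norm_divide power_divide power2_eq_square)
  finally have "(cmod (cinner x y))\<^sup>2 / n \<le> (norm x)\<^sup>2" by simp
  then have "(cmod (cinner x y))\<^sup>2 \<le> (norm x * norm y)\<^sup>2"
    using n by (simp add: n_def field_simps power_mult_distrib)
  then show ?thesis by (rule power2_le_imp_le) simp
qed simp

lemma cinner_ext: "x = y" if "\<And>z. cinner z x = cinner z y" for x :: "'a::complex_inner"
proof -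
  have "cinner (x - y) (x - y) = 0"
    using that[of "x - y"] by (simp add: cinner_diff_right)
  then show ?thesis by (simp add: cinner_self)
qed

typedef (overloaded) 'a cblinop =
    "{T :: 'a::complex_normed_vector \<Rightarrow>\<^sub>L 'a. \<forall>c x. blinfun_apply T (c *\<^sub>C x) = c *\<^sub>C blinfun_apply T x}"
  morphisms blinfun_of_cblinop cblinop_of_blinfun
  by (rule exI[of _ 0]) simp

setup_lifting type_definition_cblinop

lift_definition cblinop_apply :: "'a::complex_normed_vector cblinop \<Rightarrow> 'a \<Rightarrow> 'a" is blinfun_apply .

lemma scaleR_scaleC_commute: "r *\<^sub>R c *\<^sub>C x = c *\<^sub>C r *\<^sub>R x" for x :: "'a::complex_vector"
  by (simp add: scaleR_scaleC scaleC_scaleC mult.commute)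

lemma bounded_linear_scaleC: "bounded_linear (\<lambda>x::'a::complex_normed_vector. c *\<^sub>C x)"
  by (rule bounded_linear_intro[of _ "cmod c"])
    (simp_all add: scaleC_add_right scaleR_scaleC_commute norm_scaleC mult.commute)

lemmas scaleC_simps = complex_vector.scale_right_diff_distrib complex_vector.scale_left_diff_distrib
  scaleC_add_right scaleC_add_left scaleC_scaleC scaleC_one scaleR_scaleC

lift_definition scaleC_blinfun :: "complex \<Rightarrow> ('a::complex_normed_vector \<Rightarrow>\<^sub>L 'a) \<Rightarrow> 'a \<Rightarrow>\<^sub>L 'a"
  is "\<lambda>c f x. c *\<^sub>C f x"
  by (rule bounded_linear_compose[OF bounded_linear_scaleC])

instantiation cblinop :: (complex_normed_vector) "{complex_algebra, complex_normed_vector, monoid_mult}"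
begin

lift_definition zero_cblinop :: "'a cblinop" is 0 by simp
lift_definition plus_cblinop :: "'a cblinop \<Rightarrow> 'a cblinop \<Rightarrow> 'a cblinop" is "(+)"
  by (simp add: blinfun.bilinear_simps scaleC_simps)
lift_definition minus_cblinop :: "'a cblinop \<Rightarrow> 'a cblinop \<Rightarrow> 'a cblinop" is "(-)"
  by (simp add: blinfun.bilinear_simps scaleC_simps)
lift_definition uminus_cblinop :: "'a cblinop \<Rightarrow> 'a cblinop" is uminus
  by (simp add: blinfun.bilinear_simps scaleC_simps)
lift_definition scaleR_cblinop :: "real \<Rightarrow> 'a cblinop \<Rightarrow> 'a cblinop" is "scaleR"
  by (simp add: blinfun.bilinear_simps scaleR_scaleC_commute)
lift_definition scaleC_cblinop :: "complex \<Rightarrow> 'a cblinop \<Rightarrow> 'a cblinop" is scaleC_blinfun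
  by (simp add: scaleC_blinfun.rep_eq scaleC_scaleC mult.commute)
lift_definition one_cblinop :: "'a cblinop" is id_blinfun by simp
lift_definition times_cblinop :: "'a cblinop \<Rightarrow> 'a cblinop \<Rightarrow> 'a cblinop" is "(o\<^sub>L)" by simp
lift_definition norm_cblinop :: "'a cblinop \<Rightarrow> real" is norm .

definition dist_cblinop :: "'a cblinop \<Rightarrow> 'a cblinop \<Rightarrow> real"
  where "dist_cblinop S T = norm (S - T)"

definition sgn_cblinop :: "'a cblinop \<Rightarrow> 'a cblinop"
  where "sgn_cblinop T = inverse (norm T) *\<^sub>R T"

definition uniformity_cblinop :: "('a cblinop \<times> 'a cblinop) filter"
  where "uniformity_cblinop = (INF e\<in>{0 <..}. principal {(x, y). dist x y < e})"

definition open_cblinop :: "'a cblinop set \<Rightarrow> bool"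
  where "open_cblinop U = (\<forall>x\<in>U. \<forall>\<^sub>F (x', y) in uniformity. x' = x \<longrightarrow> y \<in> U)"

lemma norm_scaleC_blinfun: "norm (scaleC_blinfun c T) = cmod c * norm T" for T :: "'a \<Rightarrow>\<^sub>L 'a"
proof (rule antisym)
  have *: "norm (scaleC_blinfun c T) \<le> cmod c * norm T" for c and T :: "'a \<Rightarrow>\<^sub>L 'a"
  proof (rule norm_blinfun_bound)
    show "norm (blinfun_apply (scaleC_blinfun c T) x) \<le> cmod c * norm T * norm x" for x
      using mult_left_mono[OF norm_blinfun[of T x], of "cmod c"]
      by (simp add: scaleC_blinfun.rep_eq norm_scaleC mult.assoc)
  qed simp
  show "norm (scaleC_blinfun c T) \<le> cmod c * norm T" by (rule *)
  show "cmod c * norm T \<le> norm (scaleC_blinfun c T)"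
  proof (cases "c = 0")
    case False
    have "scaleC_blinfun (inverse c) (scaleC_blinfun c T) = T"
      using False by (intro blinfun_eqI) (simp add: scaleC_blinfun.rep_eq scaleC_simps)
    with *[of "inverse c" "scaleC_blinfun c T"] have "norm T \<le> norm (scaleC_blinfun c T) / cmod c"
      by (simp add: norm_inverse divide_inverse mult.commute)
    with False show ?thesis by (simp add: field_simps)
  qed simp
qed

instance
proof
  fix a b :: complex and r s :: real and x y z :: "'a cblinop"
  show "x + y + z = x + (y + z)" "x + y = y + x" "0 + x = x" "- x + x = 0" "x - y = x + - y"
    by (transfer; simp)+
  show "r *\<^sub>R x = complex_of_real r *\<^sub>C x"
    by transfer (auto intro!: blinfun_eqI
        simp: scaleC_blinfun.rep_eq scaleR_scaleC blinfun.bilinear_simps)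
  show "a *\<^sub>C (x + y) = a *\<^sub>C x + a *\<^sub>C y" "(a + b) *\<^sub>C x = a *\<^sub>C x + b *\<^sub>C x"
    "a *\<^sub>C b *\<^sub>C x = (a * b) *\<^sub>C x" "1 *\<^sub>C x = x"
    by (transfer; auto intro!: blinfun_eqI
        simp: scaleC_blinfun.rep_eq scaleC_simps blinfun.bilinear_simps)+
  show "r *\<^sub>R (x + y) = r *\<^sub>R x + r *\<^sub>R y" "(r + s) *\<^sub>R x = r *\<^sub>R x + s *\<^sub>R x"
    "r *\<^sub>R s *\<^sub>R x = (r * s) *\<^sub>R x" "1 *\<^sub>R x = x"
    by (transfer; simp add: scaleR_add_right scaleR_add_left)+
  show "x * y * z = x * (y * z)" "1 * x = x" "x * 1 = x"
    "(x + y) * z = x * z + y * z" "x * (y + z) = x * y + x * z"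
    "a *\<^sub>C x * y = a *\<^sub>C (x * y)" "x * a *\<^sub>C y = a *\<^sub>C (x * y)"
    by (transfer; auto intro!: blinfun_eqI
        simp: scaleC_blinfun.rep_eq blinfun.bilinear_simps)+
  show "dist x y = norm (x - y)" by (rule dist_cblinop_def)
  show "sgn x = inverse (norm x) *\<^sub>R x" by (rule sgn_cblinop_def)
  show "uniformity = (INF e\<in>{0 <..}. principal {(x :: 'a cblinop, y). dist x y < e})"
    by (rule uniformity_cblinop_def)
  show "open U = (\<forall>x\<in>U. \<forall>\<^sub>F (x', y) in uniformity. x' = x \<longrightarrow> y \<in> U)"
    for U :: "'a cblinop set" by (rule open_cblinop_def)
  show "(norm x = 0) = (x = 0)" by transfer simp
  show "norm (x + y) \<le> norm x + norm y" by transfer (rule norm_triangle_ineq)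
  show "norm (r *\<^sub>R x) = \<bar>r\<bar> * norm x" by transfer simp
  show "norm (a *\<^sub>C x) = cmod a * norm x" by transfer (rule norm_scaleC_blinfun)
qed

end


lemma cblinop_apply_simps [simp]:
  "cblinop_apply 0 x = 0" "cblinop_apply 1 x = x"
  "cblinop_apply (S + T) x = cblinop_apply S x + cblinop_apply T x"
  "cblinop_apply (S - T) x = cblinop_apply S x - cblinop_apply T x"
  "cblinop_apply (- T) x = - cblinop_apply T x"
  "cblinop_apply (c *\<^sub>C T) x = c *\<^sub>C cblinop_apply T x"
  "cblinop_apply (r *\<^sub>R T) x = r *\<^sub>R cblinop_apply T x"
  "cblinop_apply (S * T) x = cblinop_apply S (cblinop_apply T x)"
  by (transfer; simp add: scaleC_blinfun.rep_eq blinfun.bilinear_simps)+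

lemma cblinop_apply_linear [simp]:
  "cblinop_apply T 0 = 0"
  "cblinop_apply T (x + y) = cblinop_apply T x + cblinop_apply T y"
  "cblinop_apply T (x - y) = cblinop_apply T x - cblinop_apply T y"
  "cblinop_apply T (c *\<^sub>C x) = c *\<^sub>C cblinop_apply T x"
  "cblinop_apply T (r *\<^sub>R x) = r *\<^sub>R cblinop_apply T x"
  by (transfer; simp add: blinfun.bilinear_simps)+

lemma cblinop_eqI: "S = T" if "\<And>x. cblinop_apply S x = cblinop_apply T x"
  using that by transfer (rule blinfun_eqI)

lemma norm_cblinop_apply: "norm (cblinop_apply T x) \<le> norm T * norm x"
  by transfer (rule norm_blinfun)

lemma norm_cblinop_bound:
  "0 \<le> b \<Longrightarrow> (\<And>x. norm (cblinop_apply T x) \<le> b * norm x) \<Longrightarrow> norm T \<le> b"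
  by transfer (rule norm_blinfun_bound)

lemma norm_cblinop_mult: "norm (S * T) \<le> norm S * norm T" for S :: "'a::complex_normed_vector cblinop"
  by transfer (rule norm_blinfun_compose)

lemma cblinop_construct:
  fixes f :: "'a::complex_normed_vector \<Rightarrow> 'a"
  assumes "\<And>x y. f (x + y) = f x + f y" "\<And>c x. f (c *\<^sub>C x) = c *\<^sub>C f x"
    and "\<And>x. norm (f x) \<le> norm x * K"
  shows "\<exists>T. cblinop_apply T = f"
proof -
  have bl: "bounded_linear f"
    by (rule bounded_linear_intro[of _ K]) (simp_all add: assms scaleR_scaleC)
  have T: "blinfun_of_cblinop (cblinop_of_blinfun (Blinfun f)) = Blinfun f"
    by (rule cblinop_of_blinfun_inverse) (simp add: bounded_linear_Blinfun_apply bl assms)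
  have "cblinop_apply (cblinop_of_blinfun (Blinfun f)) = f"
    by (simp add: cblinop_apply.rep_eq T bounded_linear_Blinfun_apply bl)
  then show ?thesis by blast
qed

instance cblinop :: (chilbert_space) banach
proof
  fix X :: "nat \<Rightarrow> 'a cblinop"
  assume "Cauchy X"
  then have "Cauchy (\<lambda>n. blinfun_of_cblinop (X n))"
    by (simp add: Cauchy_def dist_norm norm_cblinop.rep_eq minus_cblinop.rep_eq)
  then obtain L where L: "(\<lambda>n. blinfun_of_cblinop (X n)) \<longlonglongrightarrow> L"
    using Cauchy_convergent_iff convergent_def by blast
  have pt: "(\<lambda>n. cblinop_apply (X n) x) \<longlonglongrightarrow> blinfun_apply L x" for x
    unfolding cblinop_apply.rep_eq by (intro tendsto_intros L)
  have "blinfun_apply L (c *\<^sub>C x) = c *\<^sub>C blinfun_apply L x" for c x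
  proof (rule LIMSEQ_unique[OF pt])
    show "(\<lambda>n. cblinop_apply (X n) (c *\<^sub>C x)) \<longlonglongrightarrow> c *\<^sub>C blinfun_apply L x"
      using bounded_linear.tendsto[OF bounded_linear_scaleC pt] by simp
  qed
  then have "blinfun_of_cblinop (cblinop_of_blinfun L) = L"
    by (intro cblinop_of_blinfun_inverse) simp
  then have "X \<longlonglongrightarrow> cblinop_of_blinfun L"
    using L by (simp add: LIMSEQ_iff norm_cblinop.rep_eq minus_cblinop.rep_eq)
  then show "convergent X" by (auto simp: convergent_def)
qed

lemma riesz_representation:
  fixes f :: "'a::chilbert_space \<Rightarrow> complex"
  assumes add: "\<And>x y. f (x + y) = f x + f y" and scale: "\<And>c x. f (c *\<^sub>C x) = c * f x"
    and bounded: "\<And>x. cmod (f x) \<le> norm x * K"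
  shows "\<exists>z. \<forall>x. f x = cinner x z"
proof -
  have bl: "bounded_linear f"
    by (rule bounded_linear_intro[of _ K])
      (simp_all add: assms scaleR_scaleC scaleR_conv_of_real)
  define M where "M = onorm f"
  have le: "cmod (f x) \<le> M * norm x" for x
    unfolding M_def by (rule onorm[OF bl])
  have M0: "M \<ge> 0" unfolding M_def by (rule onorm_pos_le[OF bl])
  show ?thesis
  proof (cases "M = 0")
    case True
    with le have "f x = cinner x 0" for x by simp
    then show ?thesis by blast
  next
    case False
    with M0 have M: "M > 0" by simp
    have ex: "\<exists>x. norm x = 1 \<and> Re (f x) > b" if "b < M" "b \<ge> 0" for b
    proof (rule ccontr)
      assume neg: "\<nexists>x. norm x = 1 \<and> Re (f x) > b"
      have "cmod (f x) \<le> b * norm x" for x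
      proof (cases "f x = 0")
        case False
        have x: "x \<noteq> 0" using False scale[of 0 x] by auto
        define c where "c = cnj (f x) / complex_of_real (cmod (f x) * norm x)"
        have "norm (c *\<^sub>C x) = 1"
          using x False by (simp add: norm_scaleC c_def norm_divide norm_mult)
        moreover have "f (c *\<^sub>C x) = complex_of_real (cmod (f x) / norm x)"
          using complex_norm_square[of "f x"] False x
          by (simp add: scale c_def field_simps power2_eq_square)
        ultimately have "cmod (f x) / norm x \<le> b"
          using neg by (metis Re_complex_of_real not_less)
        then show ?thesis using x by (simp add: field_simps)
      qed (use that in simp)
      then have "M \<le> b" unfolding M_def using that by (intro onorm_bound) auto
      with that show False by simp
    qed
    have "\<exists>x. norm x = 1 \<and> Re (f x) > M * (1 - 1 / (real n + 1))" for n
      using M by (intro ex) (simp_all add: field_simps)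
    then obtain X where X: "\<And>n. norm (X n) = 1" "\<And>n. Re (f (X n)) > M * (1 - 1 / (real n + 1))"
      by metis
    have est: "(norm (X m - X n))\<^sup>2 \<le> 8 / (real N + 1)" if "m \<ge> N" "n \<ge> N" for m n N
    proof -
      have XN: "Re (f (X k)) \<ge> M * (1 - 1 / (real N + 1))" if "k \<ge> N" for k
      proof -
        have "1 / (real k + 1) \<le> 1 / (real N + 1)"
          using that by (intro divide_left_mono) auto
        then have "M * (1 - 1 / (real N + 1)) \<le> M * (1 - 1 / (real k + 1))"
          using M by (intro mult_left_mono) auto
        with X(2)[of k] show ?thesis by simp
      qed
      have "M * (2 * (1 - 1 / (real N + 1))) \<le> Re (f (X m + X n))"
        using add_mono[OF XN[OF that(1)] XN[OF that(2)]]
        unfolding add by (simp only: mult.left_commute[of M 2] mult_2 distrib_left plus_complex.sel)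
      also have "\<dots> \<le> M * norm (X m + X n)"
        using le[of "X m + X n"] complex_Re_le_cmod[of "f (X m + X n)"] by linarith
      finally have s: "2 * (1 - 1 / (real N + 1)) \<le> norm (X m + X n)"
        using M by simp
      have "0 \<le> 2 * (1 - 1 / (real N + 1))" by (simp add: field_simps)
      then have "(2 * (1 - 1 / (real N + 1)))\<^sup>2 \<le> (norm (X m + X n))\<^sup>2"
        using s by (rule power_mono[rotated])
      moreover have "(2 * (1 - 1 / (real N + 1)))\<^sup>2 \<ge> 4 - 8 / (real N + 1)"
        by (simp add: power2_eq_square algebra_simps)
      ultimately show ?thesis
        using parallelogram[of "X m" "X n"] X(1) by simp
    qed
    have "Cauchy X"
    proof (rule CauchyI)
      fix e :: real assume e: "e > 0"
      obtain N :: nat where N: "8 / e\<^sup>2 < real N" using reals_Archimedean2 by blast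
      have "norm (X m - X n) < e" if "m \<ge> N" "n \<ge> N" for m n
      proof -
        have "8 / (real N + 1) < e\<^sup>2"
          using N e by (simp add: field_simps)
            (smt (verit) zero_less_power)
        with est[OF that] have "(norm (X m - X n))\<^sup>2 < e\<^sup>2" by simp
        then show ?thesis using e by (simp add: power2_less_imp_less)
      qed
      then show "\<exists>N. \<forall>m\<ge>N. \<forall>n\<ge>N. norm (X m - X n) < e" by blast
    qed
    then obtain z where z: "X \<longlonglongrightarrow> z"
      using Cauchy_convergent_iff convergent_def by blast
    have nz: "norm z = 1"
      using tendsto_norm[OF z] X(1) by (simp add: LIMSEQ_const_iff)
    have "M \<le> Re (f z)"
    proof (rule LIMSEQ_le)
      show "(\<lambda>n. Re (f (X n))) \<longlonglongrightarrow> Re (f z)"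
        by (intro tendsto_Re bounded_linear.tendsto[OF bl] z)
      have "(\<lambda>n. M * (1 - 1 / (real n + 1))) \<longlonglongrightarrow> M * (1 - 0)"
        by (intro tendsto_intros) (use LIMSEQ_inverse_real_of_nat in \<open>simp add: inverse_eq_divide add.commute\<close>)
      then show "(\<lambda>n. M * (1 - 1 / (real n + 1))) \<longlonglongrightarrow> M" by simp
      show "\<exists>N. \<forall>n\<ge>N. M * (1 - 1 / (real n + 1)) \<le> Re (f (X n))"
        using X(2) less_imp_le by blast
    qed
    then have fz: "Re (f z) = M"
      using le[of z] nz complex_Re_le_cmod[of "f z"] by simp
    have "f y = complex_of_real M * cinner y z" for y
    proof -
      define w where "w = f y - complex_of_real M * cinner y z"
      have main: "Re (c * w) \<le> M * (cmod c)\<^sup>2 * (norm y)\<^sup>2 / 2" for c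
      proof -
        have "Re (f (z + c *\<^sub>C y)) \<le> M * norm (z + c *\<^sub>C y)"
          using le[of "z + c *\<^sub>C y"] complex_Re_le_cmod[of "f (z + c *\<^sub>C y)"] by linarith
        also have "norm (z + c *\<^sub>C y) \<le> (1 + (norm (z + c *\<^sub>C y))\<^sup>2) / 2"
          using zero_le_power2[of "norm (z + c *\<^sub>C y) - 1"]
          by (simp add: power2_eq_square algebra_simps)
        also have "(norm (z + c *\<^sub>C y))\<^sup>2 = 1 + (cmod c)\<^sup>2 * (norm y)\<^sup>2 + 2 * Re (c * cinner y z)"
          using norm_add_square[of "c *\<^sub>C y" z] nz
          by (simp add: add.commute norm_scaleC power_mult_distrib cinner_scaleC_left)
        finally have "M + Re (c * f y)
            \<le> M * ((1 + (1 + (cmod c)\<^sup>2 * (norm y)\<^sup>2 + 2 * Re (c * cinner y z))) / 2)"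
          using M by (simp add: add scale fz mult_left_mono)
        moreover have "Re (c * w) = Re (c * f y) - M * Re (c * cinner y z)"
          by (simp add: w_def algebra_simps)
        ultimately show ?thesis by (simp add: algebra_simps add_divide_distrib)
      qed
      have "w = 0"
      proof (rule ccontr)
        assume w: "w \<noteq> 0"
        define B where "B = M * (norm y)\<^sup>2 / 2"
        have B: "B \<ge> 0" using M by (simp add: B_def)
        define t where "t = 1 / (B + 1)"
        have t: "t > 0" "t * B < 1" using B by (simp_all add: t_def field_simps)
        have "complex_of_real t * cnj w * w = complex_of_real (t * (cmod w)\<^sup>2)"
          using complex_norm_square[of w] by (simp add: mult_ac)
        then have "t * (cmod w)\<^sup>2 \<le> t\<^sup>2 * (cmod w)\<^sup>2 * B"
          using main[of "complex_of_real t * cnj w"] t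
          by (simp only: Re_complex_of_real) (simp add: norm_mult power_mult_distrib B_def mult_ac)
        then have "1 \<le> t * B" using t w by (simp add: power2_eq_square field_simps)
        with t show False by simp
      qed
      then show ?thesis by (simp add: w_def)
    qed
    then have "f x = cinner x (complex_of_real M *\<^sub>C z)" for x
      by (simp add: cinner_scaleC_right)
    then show ?thesis by blast
  qed
qed

lemma adjoint_exists:
  fixes T :: "'a::chilbert_space cblinop"
  shows "\<exists>S. \<forall>x y. cinner (cblinop_apply T x) y = cinner x (cblinop_apply S y)"
proof -
  have "\<exists>z. \<forall>x. cinner (cblinop_apply T x) y = cinner x z" for y
  proof (rule riesz_representation)
    show "cmod (cinner (cblinop_apply T x) y) \<le> norm x * (norm T * norm y)" for x
      using Cauchy_Schwarz_cinner[of "cblinop_apply T x" y]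
        mult_right_mono[OF norm_cblinop_apply[of T x], of "norm y"] by (simp add: mult_ac)
  qed (simp_all add: cinner_add_left cinner_scaleC_left)
  then obtain g where g: "\<And>x y. cinner (cblinop_apply T x) y = cinner x (g y)" by metis
  have "\<exists>S. cblinop_apply S = g"
  proof (rule cblinop_construct)
    show "g (x + y) = g x + g y" for x y
      by (rule cinner_ext) (simp add: g[symmetric] cinner_add_right)
    show "g (c *\<^sub>C x) = c *\<^sub>C g x" for c x
      by (rule cinner_ext) (simp add: g[symmetric] cinner_scaleC_right)
    show "norm (g y) \<le> norm y * norm T" for y
    proof (cases "g y = 0")
      case False
      have "(norm (g y))\<^sup>2 = Re (cinner (cblinop_apply T (g y)) y)"
        by (simp add: g Re_cinner_self)
      also have "\<dots> \<le> norm (cblinop_apply T (g y)) * norm y"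
        using Cauchy_Schwarz_cinner[of "cblinop_apply T (g y)" y] complex_Re_le_cmod by (rule order_trans[rotated])
      also have "\<dots> \<le> norm T * norm (g y) * norm y"
        by (intro mult_right_mono norm_cblinop_apply) simp
      finally show ?thesis using False by (simp add: power2_eq_square mult_ac)
    qed simp
  qed
  with g show ?thesis by metis
qed

definition cadjoint :: "'a::chilbert_space cblinop \<Rightarrow> 'a cblinop" where
  "cadjoint T = (THE S. \<forall>x y. cinner (cblinop_apply T x) y = cinner x (cblinop_apply S y))"

lemma cinner_adjoint: "cinner (cblinop_apply T x) y = cinner x (cblinop_apply (cadjoint T) y)"
proof -
  have "\<exists>!S. \<forall>x y. cinner (cblinop_apply T x) y = cinner x (cblinop_apply S y)"
    using adjoint_exists[of T] by (metis cblinop_eqI cinner_ext)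
  from theI'[OF this] show ?thesis unfolding cadjoint_def by blast
qed

lemma adjoint_eqI: "cadjoint T = S"
  if "\<And>x y. cinner (cblinop_apply T x) y = cinner x (cblinop_apply S y)"
  by (metis that cinner_adjoint cblinop_eqI cinner_ext)

lemma cinner_adjoint': "cinner (cblinop_apply (cadjoint T) x) y = cinner x (cblinop_apply T y)"
  by (metis cinner_adjoint cinner_commute)

instantiation cblinop :: (chilbert_space) cstar_algebra
begin

definition star_cblinop :: "'a cblinop \<Rightarrow> 'a cblinop" where "star_cblinop = cadjoint"

instance
proof
  fix S T :: "'a cblinop" and c :: complex
  show "norm (S * T) \<le> norm S * norm T" by (rule norm_cblinop_mult)
  show "star (star T) = T"
    unfolding star_cblinop_def by (rule adjoint_eqI) (rule cinner_adjoint')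
  show "star (S + T) = star S + star T"
    "star (c *\<^sub>C T) = cnj c *\<^sub>C star T" "star (S * T) = star T * star S"
    unfolding star_cblinop_def
    by (rule adjoint_eqI; simp add: cinner_adjoint cinner_add_left cinner_add_right
          cinner_scaleC_left cinner_scaleC_right)+
  have le: "(norm T)\<^sup>2 \<le> norm (cadjoint T * T)" for T :: "'a cblinop"
  proof -
    have "norm T \<le> sqrt (norm (cadjoint T * T))"
    proof (rule norm_cblinop_bound)
      fix x
      have "(norm (cblinop_apply T x))\<^sup>2 = Re (cinner x (cblinop_apply (cadjoint T * T) x))"
        by (simp add: cinner_adjoint[symmetric] Re_cinner_self)
      also have "\<dots> \<le> norm x * norm (cblinop_apply (cadjoint T * T) x)"
        using Cauchy_Schwarz_cinner complex_Re_le_cmod by (rule order_trans[rotated])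
      also have "\<dots> \<le> norm x * (norm (cadjoint T * T) * norm x)"
        by (intro mult_left_mono norm_cblinop_apply) simp
      finally have "(norm (cblinop_apply T x))\<^sup>2 \<le> (sqrt (norm (cadjoint T * T)) * norm x)\<^sup>2"
        by (simp add: power_mult_distrib power2_eq_square mult_ac)
      then show "norm (cblinop_apply T x) \<le> sqrt (norm (cadjoint T * T)) * norm x"
        by (rule power2_le_imp_le) simp
    qed simp
    then have "(norm T)\<^sup>2 \<le> (sqrt (norm (cadjoint T * T)))\<^sup>2" by (rule power_mono) simp
    then show ?thesis by simp
  qed
  have le': "norm T \<le> norm (cadjoint T)" for T :: "'a cblinop"
  proof (cases "T = 0")
    case False
    have "norm T * norm T \<le> norm (cadjoint T) * norm T"
      using order_trans[OF le norm_cblinop_mult] by (simp add: power2_eq_square)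
    with False show ?thesis by simp
  qed simp
  have adj2: "cadjoint (cadjoint T) = T" by (rule adjoint_eqI) (simp add: cinner_adjoint')
  have "norm (cadjoint T) = norm T" using le'[of T] le'[of "cadjoint T"] adj2 by simp
  then show "norm (star T * T) = (norm T)\<^sup>2"
    unfolding star_cblinop_def
    using le[of T] norm_cblinop_mult[of "cadjoint T" T] by (simp add: power2_eq_square)
qed

end


section \<open>The Calkin algebra\<close>

definition compact_operator :: "'a::complex_normed_vector cblinop \<Rightarrow> bool" where
  "compact_operator T \<longleftrightarrow> compact (closure (cblinop_apply T ` cball 0 1))"

lemma compact_operator_iff:
  fixes T :: "'a::chilbert_space cblinop"
  shows "compact_operator T \<longleftrightarrow>
    (\<forall>e>0. \<exists>k. finite k \<and> (\<forall>x\<in>cball 0 1. \<exists>y\<in>k. norm (cblinop_apply T x - y) < e))"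
proof
  assume "compact_operator T"
  then have *: "\<forall>e>0. \<exists>k. finite k \<and> closure (cblinop_apply T ` cball 0 1) \<subseteq> (\<Union>x\<in>k. ball x e)"
    unfolding compact_operator_def compact_eq_totally_bounded by (rule conjunct2)
  show "\<forall>e>0. \<exists>k. finite k \<and> (\<forall>x\<in>cball 0 1. \<exists>y\<in>k. norm (cblinop_apply T x - y) < e)"
  proof (intro allI impI)
    fix e :: real assume "e > 0"
    from *[rule_format, OF this] obtain k
      where k: "finite k" "closure (cblinop_apply T ` cball 0 1) \<subseteq> (\<Union>x\<in>k. ball x e)"
      by (elim exE conjE) (rule that)
    have "\<exists>y\<in>k. norm (cblinop_apply T x - y) < e" if "x \<in> cball 0 1" for x
    proof -
      have "cblinop_apply T x \<in> closure (cblinop_apply T ` cball 0 1)"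
        by (rule subsetD[OF closure_subset imageI[OF that]])
      with k(2) obtain y where "y \<in> k" "cblinop_apply T x \<in> ball y e" by blast
      then show ?thesis by (intro bexI[of _ y]) (simp_all add: dist_norm norm_minus_commute)
    qed
    with k(1) show "\<exists>k. finite k \<and> (\<forall>x\<in>cball 0 1. \<exists>y\<in>k. norm (cblinop_apply T x - y) < e)"
      by (intro exI[of _ k]) simp
  qed
next
  assume R: "\<forall>e>0. \<exists>k. finite k \<and> (\<forall>x\<in>cball 0 1. \<exists>y\<in>k. norm (cblinop_apply T x - y) < e)"
  show "compact_operator T"
    unfolding compact_operator_def compact_eq_totally_bounded
  proof (intro conjI allI impI)
    show "complete (closure (cblinop_apply T ` cball 0 1))" by (simp add: complete_eq_closed)
    fix e :: real assume "e > 0"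
    then have "e / 2 > 0" by simp
    from R[THEN spec, THEN mp, OF this] obtain k
      where k: "finite k" "\<forall>x\<in>cball 0 1. \<exists>y\<in>k. norm (cblinop_apply T x - y) < e / 2"
      by (elim exE conjE) (rule that)
    have "cblinop_apply T ` cball 0 1 \<subseteq> (\<Union>y\<in>k. cball y (e / 2))"
    proof (rule image_subsetI)
      fix x :: 'a assume "x \<in> cball 0 1"
      with k(2) obtain y where "y \<in> k" "norm (cblinop_apply T x - y) < e / 2" by blast
      then show "cblinop_apply T x \<in> (\<Union>y\<in>k. cball y (e / 2))"
        by (intro UN_I[of y]) (simp_all add: dist_norm norm_minus_commute)
    qed
    then have "closure (cblinop_apply T ` cball 0 1) \<subseteq> (\<Union>y\<in>k. cball y (e / 2))"
      by (rule closure_minimal) (use k(1) in auto)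
    also have "\<dots> \<subseteq> (\<Union>y\<in>k. ball y e)" using \<open>e > 0\<close> by (intro UN_mono) auto
    finally show "\<exists>k. finite k \<and> closure (cblinop_apply T ` cball 0 1) \<subseteq> (\<Union>x\<in>k. ball x e)"
      using k(1) by (intro exI[of _ k] conjI)
  qed
qed

lemma compact_operator_net:
  fixes T :: "'a::chilbert_space cblinop"
  assumes "compact_operator T" "e > 0"
  obtains k where "finite k" "\<And>x. norm x \<le> 1 \<Longrightarrow> \<exists>y\<in>k. norm (cblinop_apply T x - y) < e"
proof -
  obtain k where k: "finite k" "\<forall>x\<in>cball 0 1. \<exists>y\<in>k. norm (cblinop_apply T x - y) < e"
    using assms(1)[unfolded compact_operator_iff, rule_format, OF assms(2)] by (elim exE conjE)
  show thesis by (rule that[OF k(1)]) (simp add: k(2)[rule_format])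
qed

lemma compact_operatorI:
  fixes T :: "'a::chilbert_space cblinop"
  assumes "\<And>e. e > 0 \<Longrightarrow> \<exists>k. finite k \<and> (\<forall>x. norm x \<le> 1 \<longrightarrow> (\<exists>y\<in>k. norm (cblinop_apply T x - y) < e))"
  shows "compact_operator T"
  unfolding compact_operator_iff Ball_def mem_cball_0 by (intro allI impI) (rule assms)

lemma compact_operator_0: "compact_operator (0 :: 'a::chilbert_space cblinop)"
  by (rule compact_operatorI) (rule exI[of _ "{0}"], simp)

lemma compact_operator_add:
  fixes S T :: "'a::chilbert_space cblinop"
  assumes "compact_operator S" "compact_operator T"
  shows "compact_operator (S + T)"
proof (rule compact_operatorI)
  fix e :: real assume e: "e > 0"
  then have e2: "e / 2 > 0" by simp
  obtain k where k: "finite k" "\<And>x. norm x \<le> 1 \<Longrightarrow> \<exists>y\<in>k. norm (cblinop_apply S x - y) < e / 2"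
    using compact_operator_net[OF assms(1) e2] by blast
  obtain l where l: "finite l" "\<And>x. norm x \<le> 1 \<Longrightarrow> \<exists>y\<in>l. norm (cblinop_apply T x - y) < e / 2"
    using compact_operator_net[OF assms(2) e2] by blast
  have "\<exists>y\<in>(\<lambda>(a, b). a + b) ` (k \<times> l). norm (cblinop_apply (S + T) x - y) < e" if x: "norm x \<le> 1" for x
  proof -
    obtain a where a: "a \<in> k" "norm (cblinop_apply S x - a) < e / 2" using k(2)[OF x] by blast
    obtain b where b: "b \<in> l" "norm (cblinop_apply T x - b) < e / 2" using l(2)[OF x] by blast
    note ab = a(1) b(1) a(2) b(2)
    have "norm (cblinop_apply (S + T) x - (a + b)) < e"
      using norm_triangle_ineq[of "cblinop_apply S x - a" "cblinop_apply T x - b"] ab(3,4)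
      by (simp add: algebra_simps)
    with ab show ?thesis by force
  qed
  with k(1) l(1) show "\<exists>k. finite k \<and> (\<forall>x. norm x \<le> 1 \<longrightarrow> (\<exists>y\<in>k. norm (cblinop_apply (S + T) x - y) < e))"
    by (meson finite_SigmaI finite_imageI)
qed

lemma compact_operator_mult_left:
  fixes S T :: "'a::chilbert_space cblinop"
  assumes "compact_operator T"
  shows "compact_operator (S * T)"
proof (rule compact_operatorI)
  fix e :: real assume e: "e > 0"
  define c where "c = norm S + 1"
  have c: "c > 0" by (simp add: c_def add_nonneg_pos)
  obtain k where k: "finite k" "\<And>x. norm x \<le> 1 \<Longrightarrow> \<exists>y\<in>k. norm (cblinop_apply T x - y) < e / c"
    using compact_operator_net[OF assms, of "e / c"] e c by auto
  have "\<exists>y\<in>cblinop_apply S ` k. norm (cblinop_apply (S * T) x - y) < e" if x: "norm x \<le> 1" for x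
  proof -
    obtain y where y: "y \<in> k" "norm (cblinop_apply T x - y) < e / c" using k x by blast
    have "norm (cblinop_apply S (cblinop_apply T x - y)) \<le> norm S * norm (cblinop_apply T x - y)"
      by (rule norm_cblinop_apply)
    also have "\<dots> \<le> c * norm (cblinop_apply T x - y)" by (intro mult_right_mono) (simp_all add: c_def)
    also have "\<dots> < e" using y(2) c by (simp add: field_simps)
    finally show ?thesis using y(1) by auto
  qed
  with k(1) show "\<exists>k. finite k \<and> (\<forall>x. norm x \<le> 1 \<longrightarrow> (\<exists>y\<in>k. norm (cblinop_apply (S * T) x - y) < e))"
    by (meson finite_imageI)
qed

lemma compact_operator_mult_right:
  fixes S T :: "'a::chilbert_space cblinop"
  assumes "compact_operator S"
  shows "compact_operator (S * T)"
proof (rule compact_operatorI)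
  fix e :: real assume e: "e > 0"
  define c where "c = norm T + 1"
  have c: "c > 0" by (simp add: c_def add_nonneg_pos)
  obtain k where k: "finite k" "\<And>x. norm x \<le> 1 \<Longrightarrow> \<exists>y\<in>k. norm (cblinop_apply S x - y) < e / c"
    using compact_operator_net[OF assms, of "e / c"] e c by auto
  have "\<exists>y\<in>(\<lambda>y. c *\<^sub>R y) ` k. norm (cblinop_apply (S * T) x - y) < e" if x: "norm x \<le> 1" for x
  proof -
    define z where "z = inverse c *\<^sub>R cblinop_apply T x"
    have "norm (cblinop_apply T x) \<le> norm T * 1"
      using norm_cblinop_apply[of T x] x mult_left_mono[OF x, of "norm T"] by simp
    then have "norm (cblinop_apply T x) \<le> c" by (simp add: c_def)
    then have "norm z \<le> 1" using c by (simp add: z_def field_simps)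
    then obtain y where y: "y \<in> k" "norm (cblinop_apply S z - y) < e / c" using k by blast
    have "cblinop_apply (S * T) x - c *\<^sub>R y = c *\<^sub>R (cblinop_apply S z - y)"
      using c by (simp add: z_def scaleR_diff_right)
    then have "norm (cblinop_apply (S * T) x - c *\<^sub>R y) < e"
      using y(2) c by (simp only: norm_scaleR) (simp add: field_simps)
    with y(1) show ?thesis by blast
  qed
  with k(1) show "\<exists>k. finite k \<and> (\<forall>x. norm x \<le> 1 \<longrightarrow> (\<exists>y\<in>k. norm (cblinop_apply (S * T) x - y) < e))"
    by (meson finite_imageI)
qed

lemma compact_operator_scaleC:
  fixes T :: "'a::chilbert_space cblinop"
  assumes "compact_operator T"
  shows "compact_operator (c *\<^sub>C T)"
  using compact_operator_mult_left[OF assms, of "c *\<^sub>C 1"] by (simp add: mult_scaleC_left)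

lemma compact_operator_minus: "compact_operator T \<Longrightarrow> compact_operator (- T)"
  for T :: "'a::chilbert_space cblinop"
  using compact_operator_mult_left[of T "- 1"] by simp

lemma compact_operator_diff:
  "compact_operator S \<Longrightarrow> compact_operator T \<Longrightarrow> compact_operator (S - T)"
  for S T :: "'a::chilbert_space cblinop"
  using compact_operator_add[of S "- T"] compact_operator_minus[of T] by simp

lemma compact_operator_star:
  fixes T :: "'a::chilbert_space cblinop"
  assumes "compact_operator T"
  shows "compact_operator (star T)"
proof (rule compact_operatorI)
  fix e :: real assume e: "e > 0"
  define d where "d = e\<^sup>2 / 8"
  have d: "d > 0" using e by (simp add: d_def)
  have "compact_operator (T * star T)" using assms by (rule compact_operator_mult_right)
  then obtain k where k: "finite k"
      "\<And>x. norm x \<le> 1 \<Longrightarrow> \<exists>y\<in>k. norm (cblinop_apply (T * star T) x - y) < d"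
    using compact_operator_net d by blast
  define P where "P x y \<longleftrightarrow> norm x \<le> 1 \<and> norm (cblinop_apply (T * star T) x - y) < d" for x y
  define g where "g y = (SOME x. P x y)" for y
  have "\<exists>z\<in>(\<lambda>y. cblinop_apply (star T) (g y)) ` k. norm (cblinop_apply (star T) x - z) < e"
    if x: "norm x \<le> 1" for x
  proof -
    obtain y where y: "y \<in> k" "P x y" using k(2)[OF x] x by (auto simp: P_def)
    then have gy: "P (g y) y" unfolding g_def by (meson someI)
    define u where "u = x - g y"
    have u: "norm u \<le> 2"
      using norm_triangle_ineq4[of x "g y"] x gy by (simp add: u_def P_def)
    have "norm (cblinop_apply (T * star T) u) \<le>
        norm (cblinop_apply (T * star T) x - y) + norm (cblinop_apply (T * star T) (g y) - y)"
      using norm_triangle_ineq4[of "cblinop_apply (T * star T) x - y" "cblinop_apply (T * star T) (g y) - y"]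
      by (simp add: u_def)
    then have Tu: "norm (cblinop_apply (T * star T) u) < 2 * d" using y(2) gy by (simp add: P_def)
    have "(norm (cblinop_apply (star T) u))\<^sup>2 = Re (cinner (cblinop_apply (T * star T) u) u)"
      by (simp add: star_cblinop_def cinner_adjoint[of T] Re_cinner_self)
    also have "\<dots> \<le> norm (cblinop_apply (T * star T) u) * norm u"
      using Cauchy_Schwarz_cinner complex_Re_le_cmod by (rule order_trans[rotated])
    also have "\<dots> \<le> 2 * d * 2" using Tu u d by (intro mult_mono) auto
    also have "\<dots> < e\<^sup>2" using e by (simp add: d_def)
    finally have "norm (cblinop_apply (star T) u) < e" using e by (simp add: power2_less_imp_less)
    with y(1) show ?thesis by (auto simp: u_def)
  qed
  with k(1) show "\<exists>k. finite k \<and> (\<forall>x. norm x \<le> 1 \<longrightarrow> (\<exists>y\<in>k. norm (cblinop_apply (star T) x - y) < e))"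
    by (meson finite_imageI)
qed

lemma compact_operator_limit:
  fixes T :: "'a::chilbert_space cblinop"
  assumes "\<And>e. e > 0 \<Longrightarrow> \<exists>S. compact_operator S \<and> norm (T - S) < e"
  shows "compact_operator T"
proof (rule compact_operatorI)
  fix e :: real assume "e > 0"
  then have e: "e / 2 > 0" by simp
  obtain S where S: "compact_operator S" "norm (T - S) < e / 2" using assms[OF e] by blast
  obtain k where k: "finite k" "\<And>x. norm x \<le> 1 \<Longrightarrow> \<exists>y\<in>k. norm (cblinop_apply S x - y) < e / 2"
    using compact_operator_net[OF S(1) e] by blast
  have "\<exists>y\<in>k. norm (cblinop_apply T x - y) < e" if x: "norm x \<le> 1" for x
  proof -
    obtain y where y: "y \<in> k" "norm (cblinop_apply S x - y) < e / 2" using k x by blast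
    have "norm (cblinop_apply (T - S) x) \<le> norm (T - S) * 1"
      using norm_cblinop_apply[of "T - S" x] mult_left_mono[OF x, of "norm (T - S)"] by simp
    with S(2) have "norm (cblinop_apply T x - cblinop_apply S x) < e / 2" by simp
    with y(2) have "norm (cblinop_apply T x - y) < e"
      using norm_triangle_ineq[of "cblinop_apply T x - cblinop_apply S x" "cblinop_apply S x - y"] by simp
    with y(1) show ?thesis by blast
  qed
  with k(1) show "\<exists>k. finite k \<and> (\<forall>x. norm x \<le> 1 \<longrightarrow> (\<exists>y\<in>k. norm (cblinop_apply T x - y) < e))"
    by blast
qed

quotient_type (overloaded) 'a calkin =
    "'a::chilbert_space cblinop" / "\<lambda>S T. compact_operator (S - T)"
  morphisms rep_calkin abs_calkin
proof (rule equivpI)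
  show "reflp (\<lambda>S T :: 'a cblinop. compact_operator (S - T))"
    by (simp add: reflp_def compact_operator_0)
  show "symp (\<lambda>S T :: 'a cblinop. compact_operator (S - T))"
    by (rule sympI, drule compact_operator_minus) simp
  show "transp (\<lambda>S T :: 'a cblinop. compact_operator (S - T))"
    by (rule transpI, drule (1) compact_operator_add) simp
qed

instantiation calkin :: (chilbert_space) "{complex_algebra, complex_normed_vector, monoid_mult}"
begin

lift_definition zero_calkin :: "'a calkin" is 0 .
lift_definition one_calkin :: "'a calkin" is 1 .
lift_definition plus_calkin :: "'a calkin \<Rightarrow> 'a calkin \<Rightarrow> 'a calkin" is "(+)"
  by (simp add: add_diff_add compact_operator_add)
lift_definition minus_calkin :: "'a calkin \<Rightarrow> 'a calkin \<Rightarrow> 'a calkin" is "(-)"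
proof -
  fix S S' T T' :: "'a cblinop"
  assume "compact_operator (S - S')" "compact_operator (T - T')"
  then have "compact_operator ((S - S') - (T - T'))" by (rule compact_operator_diff)
  then show "compact_operator (S - T - (S' - T'))" by (simp add: algebra_simps)
qed
lift_definition uminus_calkin :: "'a calkin \<Rightarrow> 'a calkin" is uminus
  by (simp only: minus_diff_minus compact_operator_minus)
lift_definition scaleC_calkin :: "complex \<Rightarrow> 'a calkin \<Rightarrow> 'a calkin" is scaleC
  by (simp only: compact_operator_scaleC complex_vector.scale_right_diff_distrib[symmetric])
lift_definition scaleR_calkin :: "real \<Rightarrow> 'a calkin \<Rightarrow> 'a calkin" is scaleR
  by (simp only: scaleR_scaleC compact_operator_scaleC
      complex_vector.scale_right_diff_distrib[symmetric])
lift_definition times_calkin :: "'a calkin \<Rightarrow> 'a calkin \<Rightarrow> 'a calkin" is "(*)"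
proof -
  fix S S' T T' :: "'a cblinop"
  assume "compact_operator (S - S')" "compact_operator (T - T')"
  then have "compact_operator ((S - S') * T + S' * (T - T'))"
    by (intro compact_operator_add compact_operator_mult_right compact_operator_mult_left)
  then show "compact_operator (S * T - S' * T')" by (simp add: algebra_simps)
qed

definition norm_calkin :: "'a calkin \<Rightarrow> real"
  where "norm_calkin q = (INF T\<in>{T. abs_calkin T = q}. norm T)"

definition dist_calkin :: "'a calkin \<Rightarrow> 'a calkin \<Rightarrow> real"
  where "dist_calkin p q = norm (p - q)"

definition sgn_calkin :: "'a calkin \<Rightarrow> 'a calkin"
  where "sgn_calkin q = inverse (norm q) *\<^sub>R q"

definition uniformity_calkin :: "('a calkin \<times> 'a calkin) filter"
  where "uniformity_calkin = (INF e\<in>{0 <..}. principal {(x, y). dist x y < e})"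

definition open_calkin :: "'a calkin set \<Rightarrow> bool"
  where "open_calkin U = (\<forall>x\<in>U. \<forall>\<^sub>F (x', y) in uniformity. x' = x \<longrightarrow> y \<in> U)"

lemma norm_calkin_le: "norm (abs_calkin T) \<le> norm T" for T :: "'a cblinop"
  unfolding norm_calkin_def by (rule cINF_lower) (auto intro!: bdd_belowI[of _ 0])

lemma norm_calkin_ge: "b \<le> norm q" if "\<And>T. abs_calkin T = q \<Longrightarrow> b \<le> norm T" for q :: "'a calkin"
  unfolding norm_calkin_def
  by (rule cINF_greatest) (use that Quotient3_abs_rep[OF Quotient3_calkin] in blast)+

lemma norm_calkin_lift:
  fixes q :: "'a calkin"
  assumes "norm q < b"
  obtains T where "abs_calkin T = q" "norm T < b"
  using norm_calkin_ge[of q b] assms by (meson not_le)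

lemma abs_calkin_simps:
  "abs_calkin S + abs_calkin T = abs_calkin (S + T)"
  "abs_calkin S - abs_calkin T = abs_calkin (S - T)"
  "abs_calkin S * abs_calkin T = abs_calkin (S * T)"
  "c *\<^sub>C abs_calkin T = abs_calkin (c *\<^sub>C T)"
  "r *\<^sub>R abs_calkin T = abs_calkin (r *\<^sub>R T)"
  for S T :: "'a cblinop"
  by (simp_all add: plus_calkin.abs_eq minus_calkin.abs_eq times_calkin.abs_eq
      scaleC_calkin.abs_eq scaleR_calkin.abs_eq)

lemma norm_scaleC_calkin_le: "norm (c *\<^sub>C q) \<le> cmod c * norm q" for q :: "'a calkin"
proof (rule field_le_epsilon)
  fix e :: real assume e: "e > 0"
  define d where "d = e / (cmod c + 1)"
  have c1: "cmod c + 1 > 0" by (simp add: add_nonneg_pos)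
  have d: "d > 0" using e c1 by (simp add: d_def)
  have "cmod c * d \<le> (cmod c + 1) * d" using d by (intro mult_right_mono) simp_all
  also have "\<dots> = e" using c1 by (simp add: d_def)
  finally have d': "cmod c * d \<le> e" .
  obtain T where T: "abs_calkin T = q" "norm T < norm q + d"
    using norm_calkin_lift[of q "norm q + d"] d by auto
  have "norm (c *\<^sub>C q) \<le> cmod c * norm T"
    using norm_calkin_le[of "c *\<^sub>C T"] by (simp add: T(1)[symmetric] abs_calkin_simps norm_scaleC)
  also have "\<dots> \<le> cmod c * (norm q + d)" using T(2) by (intro mult_left_mono) auto
  also have "\<dots> \<le> cmod c * norm q + e" using d' by (simp add: algebra_simps)
  finally show "norm (c *\<^sub>C q) \<le> cmod c * norm q + e" .
qed

lemma calkin_vector: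
  fixes q :: "'a calkin"
  shows "r *\<^sub>R q = complex_of_real r *\<^sub>C q" "a *\<^sub>C b *\<^sub>C q = (a * b) *\<^sub>C q" "1 *\<^sub>C q = q"
  by (transfer; simp add: scaleR_scaleC scaleC_scaleC scaleC_one compact_operator_0)+

lemma norm_scaleC_calkin: "norm (c *\<^sub>C q) = cmod c * norm q" for q :: "'a calkin"
proof (cases "c = 0")
  case True
  have "0 \<le> norm (c *\<^sub>C q)" by (rule norm_calkin_ge) simp
  with True norm_scaleC_calkin_le[of c q] show ?thesis by simp
next
  case False
  have "norm q \<le> cmod (inverse c) * norm (c *\<^sub>C q)"
    using norm_scaleC_calkin_le[of "inverse c" "c *\<^sub>C q"] False by (simp add: calkin_vector)
  then have "norm q \<le> norm (c *\<^sub>C q) / cmod c"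
    by (simp add: norm_inverse divide_inverse mult.commute)
  with False have "cmod c * norm q \<le> norm (c *\<^sub>C q)" by (simp add: field_simps)
  with norm_scaleC_calkin_le[of c q] show ?thesis by (rule antisym)
qed

instance
proof
  fix a b :: complex and r s :: real and x y z :: "'a calkin"
  show "x + y + z = x + (y + z)" by (transfer, simp add: compact_operator_0 add.assoc)
  show "x + y = y + x" by (transfer, simp add: compact_operator_0 add.commute)
  show "0 + x = x" "- x + x = 0" "x - y = x + - y"
    by (transfer, simp add: compact_operator_0)+
  show "x * y * z = x * (y * z)" "1 * x = x" "x * 1 = x"
    "(x + y) * z = x * z + y * z" "x * (y + z) = x * y + x * z"
    by (transfer, simp add: compact_operator_0 mult.assoc distrib_left distrib_right)+
  show "r *\<^sub>R x = complex_of_real r *\<^sub>C x" by (rule calkin_vector)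
  show "a *\<^sub>C (x + y) = a *\<^sub>C x + a *\<^sub>C y" "(a + b) *\<^sub>C x = a *\<^sub>C x + b *\<^sub>C x"
    "a *\<^sub>C b *\<^sub>C x = (a * b) *\<^sub>C x" "1 *\<^sub>C x = x"
    "r *\<^sub>R (x + y) = r *\<^sub>R x + r *\<^sub>R y" "(r + s) *\<^sub>R x = r *\<^sub>R x + s *\<^sub>R x"
    "r *\<^sub>R s *\<^sub>R x = (r * s) *\<^sub>R x" "1 *\<^sub>R x = x"
    by (transfer; simp add: compact_operator_0 scaleC_add_right scaleC_add_left scaleC_scaleC
        scaleC_one scaleR_add_right scaleR_add_left)+
  show "a *\<^sub>C x * y = a *\<^sub>C (x * y)" "x * a *\<^sub>C y = a *\<^sub>C (x * y)"
    by (transfer; simp add: compact_operator_0 mult_scaleC_left mult_scaleC_right)+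
  show "dist x y = norm (x - y)" by (rule dist_calkin_def)
  show "sgn x = inverse (norm x) *\<^sub>R x" by (rule sgn_calkin_def)
  show "uniformity = (INF e\<in>{0 <..}. principal {(x :: 'a calkin, y). dist x y < e})"
    by (rule uniformity_calkin_def)
  show "open U = (\<forall>x\<in>U. \<forall>\<^sub>F (x', y) in uniformity. x' = x \<longrightarrow> y \<in> U)"
    for U :: "'a calkin set" by (rule open_calkin_def)
  show "norm (a *\<^sub>C x) = cmod a * norm x" by (rule norm_scaleC_calkin)
  show "norm (r *\<^sub>R x) = \<bar>r\<bar> * norm x" by (simp add: calkin_vector norm_scaleC_calkin)
  show "norm (x + y) \<le> norm x + norm y"
  proof (rule field_le_epsilon)
    fix e :: real assume "e > 0"
    then have e: "norm x < norm x + e / 2" "norm y < norm y + e / 2" by simp_all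
    obtain S where S: "abs_calkin S = x" "norm S < norm x + e / 2" by (rule norm_calkin_lift[OF e(1)])
    obtain T where T: "abs_calkin T = y" "norm T < norm y + e / 2" by (rule norm_calkin_lift[OF e(2)])
    have "norm (x + y) \<le> norm (S + T)"
      using norm_calkin_le[of "S + T"] S(1) T(1) by (simp add: abs_calkin_simps[symmetric])
    with norm_triangle_ineq[of S T] S(2) T(2) show "norm (x + y) \<le> norm x + norm y + e" by simp
  qed
  show "(norm x = 0) = (x = 0)"
  proof
    assume "x = 0"
    have "norm (0 :: 'a calkin) \<le> 0" using norm_calkin_le[of 0] by (simp add: zero_calkin_def)
    moreover have "0 \<le> norm (0 :: 'a calkin)" by (rule norm_calkin_ge) simp
    ultimately show "norm x = 0" using \<open>x = 0\<close> by simp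
  next
    assume nx: "norm x = 0"
    obtain T where T: "abs_calkin T = x" using Quotient3_abs_rep[OF Quotient3_calkin] by blast
    have "compact_operator T"
    proof (rule compact_operator_limit)
      fix e :: real assume "e > 0"
      with nx obtain S where S: "abs_calkin S = x" "norm S < e"
        using norm_calkin_lift[of x e] by auto
      from S(1) T have "compact_operator (T - S)" by (simp flip: calkin.abs_eq_iff)
      with S(2) show "\<exists>K. compact_operator K \<and> norm (T - K) < e"
        by (intro exI[of _ "T - S"]) simp
    qed
    then show "x = 0" by (simp add: T[symmetric] zero_calkin_def calkin.abs_eq_iff)
  qed
qed

end


lemma norm_star_cblinop: "norm (star T) = norm T" for T :: "'a::cstar_algebra"
proof -
  have le: "norm T \<le> norm (star T)" for T :: 'a
  proof (cases "T = 0")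
    case False
    have "norm T * norm T \<le> norm (star T) * norm T"
      using norm_mult_le[of "star T" T] by (simp add: norm_star_mult_self power2_eq_square)
    with False show ?thesis by simp
  qed simp
  from le[of T] le[of "star T"] show ?thesis by (simp add: star_star)
qed

lemma star_diff: "star (S - T) = star S - star T" for S T :: "'a::cstar_algebra"
  using star_add[of S "- T"] star_scaleC[of "- 1" T] by simp

lemma rank_one_projection:
  fixes u :: "'a::chilbert_space"
  assumes u: "norm u = 1"
  obtains E where "compact_operator E" "star E = E" "\<And>x. cblinop_apply E x = cinner x u *\<^sub>C u"
proof -
  have "\<exists>E. cblinop_apply E = (\<lambda>x. cinner x u *\<^sub>C u)"
  proof (rule cblinop_construct)
    show "norm (cinner x u *\<^sub>C u) \<le> norm x * 1" for x
      using Cauchy_Schwarz_cinner[of x u] u by (simp add: norm_scaleC)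
  qed (simp_all add: cinner_add_left cinner_scaleC_left scaleC_add_left scaleC_scaleC)
  then obtain E where E: "cblinop_apply E x = cinner x u *\<^sub>C u" for x by metis
  have "compact ((\<lambda>c. c *\<^sub>C u) ` cball 0 1)"
  proof (rule compact_continuous_image)
    have "bounded_linear (\<lambda>c. c *\<^sub>C u)"
      by (rule bounded_linear_intro[of _ "norm u"])
        (simp_all add: scaleC_add_left scaleR_scaleC scaleC_scaleC norm_scaleC scaleR_conv_of_real)
    then show "continuous_on (cball 0 1) (\<lambda>c. c *\<^sub>C u)" by (rule linear_continuous_on)
  qed simp
  moreover have sub: "cblinop_apply E ` cball 0 1 \<subseteq> (\<lambda>c. c *\<^sub>C u) ` cball 0 1"
  proof (rule image_subsetI)
    fix x :: 'a assume "x \<in> cball 0 1"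
    then have "cinner x u \<in> cball 0 1"
      using Cauchy_Schwarz_cinner[of x u] u by simp
    then show "cblinop_apply E x \<in> (\<lambda>c. c *\<^sub>C u) ` cball 0 1" unfolding E by (rule imageI)
  qed
  ultimately have "closure (cblinop_apply E ` cball 0 1) \<subseteq> (\<lambda>c. c *\<^sub>C u) ` cball 0 1"
    "compact ((\<lambda>c. c *\<^sub>C u) ` cball 0 1)"
    by (simp_all add: closure_minimal compact_imp_closed)
  then have "compact (closure (cblinop_apply E ` cball 0 1) \<inter> (\<lambda>c. c *\<^sub>C u) ` cball 0 1)"
    by (intro closed_Int_compact) simp_all
  then have "compact_operator E"
    unfolding compact_operator_def
    using \<open>closure (cblinop_apply E ` cball 0 1) \<subseteq> _\<close> by (simp add: Int_absorb2)
  moreover have "star E = E"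
    unfolding star_cblinop_def
  proof (rule adjoint_eqI)
    show "cinner (cblinop_apply E x) y = cinner x (cblinop_apply E y)" for x y
      using cinner_commute[of u y] by (simp add: E cinner_scaleC_left cinner_scaleC_right)
  qed
  ultimately show thesis using E by (rule that)
qed

lemma finite_rank_projection:
  fixes k :: "'a::chilbert_space set"
  assumes "finite k"
  shows "\<exists>P. compact_operator P \<and> P * P = P \<and> star P = P \<and> (\<forall>x\<in>k. cblinop_apply P x = x)"
  using assms
proof induction
  case empty
  have "star 0 = (0 :: 'a cblinop)" using star_diff[of "0 :: 'a cblinop" 0] by simp
  then show ?case using compact_operator_0 by (intro exI[of _ 0]) simp
next
  case (insert v k)
  then obtain P where P: "compact_operator P" "P * P = P" "star P = P"
    "\<And>x. x \<in> k \<Longrightarrow> cblinop_apply P x = x" by metis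
  have PP: "cblinop_apply P (cblinop_apply P x) = cblinop_apply P x" for x
    using P(2) by (metis cblinop_apply_simps(8))
  show ?case
  proof (cases "cblinop_apply P v = v")
    case True
    with P show ?thesis by (intro exI[of _ P]) simp
  next
    case False
    define w where "w = v - cblinop_apply P v"
    have w: "w \<noteq> 0" "cblinop_apply P w = 0" using False by (simp_all add: w_def PP)
    define u where "u = complex_of_real (inverse (norm w)) *\<^sub>C w"
    have u: "norm u = 1" "cblinop_apply P u = 0"
      using w by (simp_all add: u_def norm_scaleC norm_inverse)
    have wu: "w = complex_of_real (norm w) *\<^sub>C u"
      using w by (simp add: u_def scaleC_scaleC flip: of_real_mult)
    obtain E where E: "compact_operator E" "star E = E" "\<And>x. cblinop_apply E x = cinner x u *\<^sub>C u"
      using rank_one_projection[OF u(1)] by blast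
    have uu: "cinner u u = 1" using u by (simp add: cinner_self)
    have Pu: "cinner (cblinop_apply P x) u = 0" for x
      using cinner_adjoint[of P x u] P(3) u by (simp add: star_cblinop_def)
    have "(P + E) * (P + E) = P + E"
      by (rule cblinop_eqI) (simp add: PP E(3) u Pu uu cinner_add_left cinner_scaleC_left)
    moreover have "cblinop_apply (P + E) x = x" if "x \<in> k" for x
      using Pu[of x] P(4)[OF that] by (simp add: E(3))
    moreover have "cblinop_apply (P + E) v = v"
    proof -
      have "cinner v u = cinner w u" by (simp add: w_def cinner_diff_left Pu)
      also have "\<dots> = complex_of_real (norm w)"
        by (subst wu) (simp add: cinner_scaleC_left uu)
      finally have "cblinop_apply E v = w" using wu by (simp add: E(3))
      then show ?thesis by (simp add: w_def)
    qed
    ultimately show ?thesis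
      using P(1,3) E(1,2) by (intro exI[of _ "P + E"]) (auto simp: compact_operator_add star_add)
  qed
qed

lemma compact_operator_projection:
  fixes K :: "'a::chilbert_space cblinop"
  assumes K: "compact_operator K" and e: "e > 0"
  obtains P where "compact_operator P" "P * P = P" "star P = P" "norm ((1 - P) * K) \<le> e"
    "norm (1 - P) \<le> 1"
proof -
  obtain k where k: "finite k" "\<And>x. norm x \<le> 1 \<Longrightarrow> \<exists>y\<in>k. norm (cblinop_apply K x - y) < e"
    using compact_operator_net[OF K e] by blast
  obtain P where P: "compact_operator P" "P * P = P" "star P = P"
    "\<And>x. x \<in> k \<Longrightarrow> cblinop_apply P x = x"
    using finite_rank_projection[OF k(1)] by metis
  have "star 1 * 1 = (1 :: 'a cblinop)" by (metis star_mult star_star mult_1_left mult_1_right)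
  then have Q: "star (1 - P) * (1 - P) = 1 - P"
    using P by (simp add: star_diff algebra_simps)
  have "norm (1 - P) * norm (1 - P) = 1 * norm (1 - P)"
    using norm_star_mult_self[of "1 - P"] unfolding Q by (simp add: power2_eq_square)
  then have n: "norm (1 - P) \<le> 1" by (simp only: mult_cancel_right) auto
  have unit: "norm (cblinop_apply ((1 - P) * K) x) \<le> e" if x: "norm x \<le> 1" for x
  proof -
    obtain y where y: "y \<in> k" "norm (cblinop_apply K x - y) < e" using k(2)[OF x] by blast
    have "cblinop_apply ((1 - P) * K) x = cblinop_apply (1 - P) (cblinop_apply K x - y)"
      using P(4)[OF y(1)] by simp
    then have "norm (cblinop_apply ((1 - P) * K) x) \<le> norm (1 - P) * norm (cblinop_apply K x - y)"
      using norm_cblinop_apply[of "1 - P" "cblinop_apply K x - y"] by (simp only:)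
    also have "\<dots> \<le> 1 * e" using n y(2) by (intro mult_mono) auto
    finally show ?thesis by simp
  qed
  have "norm ((1 - P) * K) \<le> e"
  proof (rule norm_cblinop_bound)
    fix x :: 'a
    show "norm (cblinop_apply ((1 - P) * K) x) \<le> e * norm x"
    proof (cases "x = 0")
      case False
      have "norm (cblinop_apply ((1 - P) * K) (inverse (norm x) *\<^sub>R x)) \<le> e"
        using False by (intro unit) simp
      then have "inverse (norm x) * norm (cblinop_apply ((1 - P) * K) x) \<le> e"
        by (simp only: cblinop_apply_linear norm_scaleR) simp
      with False show ?thesis by (simp add: field_simps)
    qed simp
  qed (use e in simp)
  with P(1-3) n show thesis using that by blast
qed

instance calkin :: (chilbert_space) banach
proof
  fix X :: "nat \<Rightarrow> 'a calkin"
  assume X: "Cauchy X"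
  have "\<exists>N. \<forall>m\<ge>N. \<forall>n\<ge>N. norm (X m - X n) < (1 / 2) ^ i" for i
    using X by (intro CauchyD) auto
  then obtain N where N: "\<And>i m n. m \<ge> N i \<Longrightarrow> n \<ge> N i \<Longrightarrow> norm (X m - X n) < (1 / 2) ^ i"
    by metis
  define r where "r i = i + (\<Sum>j\<le>i. N j)" for i
  have r: "strict_mono r" unfolding strict_mono_Suc_iff by (simp add: r_def)
  have rN: "r i \<ge> N i" for i
    using member_le_sum[of i "{..i}" N] by (simp add: r_def)
  have "norm (X (r (Suc i)) - X (r i)) < (1 / 2) ^ i" for i
  proof (rule N)
    show "N i \<le> r (Suc i)" using rN[of i] strict_monoD[OF r, of i "Suc i"] by simp
  qed (rule rN)
  then have "\<exists>T. abs_calkin T = X (r (Suc i)) - X (r i) \<and> norm T < (1 / 2) ^ i" for i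
    using norm_calkin_lift by meson
  then obtain T where T: "\<And>i. abs_calkin (T i) = X (r (Suc i)) - X (r i)" "\<And>i. norm (T i) < (1 / 2) ^ i"
    by metis
  obtain T0 where T0: "abs_calkin T0 = X (r 0)"
    using Quotient3_abs_rep[OF Quotient3_calkin] by blast
  have "summable T"
    by (rule summable_comparison_test'[of "\<lambda>i. (1 / 2 :: real) ^ i" 0])
      (use T(2) less_imp_le in auto)
  then have lim: "(\<lambda>n. \<Sum>i<n. T i) \<longlonglongrightarrow> suminf T" by (rule summable_LIMSEQ)
  have part: "abs_calkin (T0 + (\<Sum>i<n. T i)) = X (r n)" for n
  proof (induction n)
    case (Suc n)
    have "abs_calkin (T0 + (\<Sum>i<Suc n. T i)) = abs_calkin (T0 + (\<Sum>i<n. T i)) + abs_calkin (T n)"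
      by (simp add: abs_calkin_simps add.assoc)
    then show ?case by (simp add: Suc T(1))
  qed (simp add: T0)
  have "(\<lambda>n. X (r n)) \<longlonglongrightarrow> abs_calkin (T0 + suminf T)"
  proof (rule LIM_zero_cancel, rule Lim_transform_bound)
    have "norm (X (r n) - abs_calkin (T0 + suminf T)) \<le> norm ((\<Sum>i<n. T i) - suminf T)" for n
      using norm_calkin_le[of "(\<Sum>i<n. T i) - suminf T"]
      by (simp add: part[symmetric] abs_calkin_simps)
    then show "\<forall>\<^sub>F n in sequentially. norm (X (r n) - abs_calkin (T0 + suminf T))
        \<le> norm ((\<Sum>i<n. T i) - suminf T)" by simp
    show "(\<lambda>n. (\<Sum>i<n. T i) - suminf T) \<longlonglongrightarrow> 0" using lim by (rule LIM_zero)
  qed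
  then have "X \<longlonglongrightarrow> abs_calkin (T0 + suminf T)"
    using Cauchy_converges_subseq[OF X r] by (simp add: o_def)
  then show "convergent X" by (auto simp: convergent_def)
qed

instantiation calkin :: (chilbert_space) cstar_algebra
begin

lift_definition star_calkin :: "'a calkin \<Rightarrow> 'a calkin" is star
  using compact_operator_star star_diff by metis

instance
proof
  fix x y :: "'a calkin" and c :: complex
  show "star (star x) = x" "star (x + y) = star x + star y"
    "star (c *\<^sub>C x) = cnj c *\<^sub>C star x" "star (x * y) = star y * star x"
    by (transfer, simp add: compact_operator_0 star_star star_add star_scaleC star_mult)+
  have mult: "norm (x * y) \<le> norm x * norm y" for x y :: "'a calkin"
  proof (rule field_le_epsilon)
    fix e :: real assume e: "e > 0"
    define m where "m = norm x + norm y + 1"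
    have m: "m > 0" by (simp add: m_def add_nonneg_pos)
    define d where "d = min 1 (e / m)"
    have d: "d > 0" "d \<le> 1" "d * m \<le> e" using e m by (simp_all add: d_def min_def field_simps)
    obtain S where S: "abs_calkin S = x" "norm S < norm x + d"
      using norm_calkin_lift[of x "norm x + d"] d by auto
    obtain T where T: "abs_calkin T = y" "norm T < norm y + d"
      using norm_calkin_lift[of y "norm y + d"] d by auto
    have "norm (x * y) \<le> norm (S * T)"
      using norm_calkin_le[of "S * T"] S(1) T(1) by (simp add: abs_calkin_simps[symmetric])
    also have "\<dots> \<le> norm S * norm T" by (rule norm_mult_le)
    also have "\<dots> \<le> (norm x + d) * (norm y + d)" using S T d by (intro mult_mono) auto
    also have "\<dots> = norm x * norm y + d * (norm x + norm y + d)" by (simp add: algebra_simps)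
    also have "d * (norm x + norm y + d) \<le> d * m" using d by (intro mult_left_mono) (auto simp: m_def)
    finally show "norm (x * y) \<le> norm x * norm y + e" using d by simp
  qed
  then show "norm (x * y) \<le> norm x * norm y" .
  have star_le: "norm (star x) \<le> norm x" for x :: "'a calkin"
  proof (rule norm_calkin_ge)
    fix T assume "abs_calkin T = x"
    then show "norm (star x) \<le> norm T"
      using norm_calkin_le[of "star T"] by (simp add: star_calkin.abs_eq[symmetric] norm_star_cblinop)
  qed
  have "norm (star x * x) \<le> (norm x)\<^sup>2"
    using mult[of "star x" x] mult_right_mono[OF star_le[of x], of "norm x"]
    by (simp add: power2_eq_square)
  moreover have "(norm x)\<^sup>2 \<le> norm (star x * x)"
  proof (rule norm_calkin_ge)
    fix R :: "'a cblinop" assume R: "abs_calkin R = star x * x"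
    obtain T where T: "abs_calkin T = x" using Quotient3_abs_rep[OF Quotient3_calkin] by blast
    define K where "K = star T * T - R"
    have K: "compact_operator K"
    proof -
      have "abs_calkin (star T * T) = abs_calkin R"
        by (simp add: R T[symmetric] star_calkin.abs_eq abs_calkin_simps)
      then show ?thesis by (simp add: K_def calkin.abs_eq_iff)
    qed
    show "(norm x)\<^sup>2 \<le> norm R"
    proof (rule field_le_epsilon)
      fix e :: real assume "e > 0"
      then obtain P where P: "compact_operator P" "P * P = P" "star P = P"
        "norm ((1 - P) * K) \<le> e" "norm (1 - P) \<le> 1"
        using compact_operator_projection[OF K] by metis
      have "star 1 = (1 :: 'a cblinop)" by (metis star_mult star_star mult_1_left mult_1_right)
      then have sQ: "star (1 - P) = 1 - P" using P by (simp add: star_diff)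
      have "compact_operator (T - T * (1 - P))"
        using compact_operator_mult_left[OF P(1), of T] by (simp add: algebra_simps)
      then have "x = abs_calkin (T * (1 - P))"
        using T by (simp add: calkin.abs_eq_iff flip: T)
      then have "(norm x)\<^sup>2 \<le> (norm (T * (1 - P)))\<^sup>2" by (simp add: norm_calkin_le power_mono)
      also have "\<dots> = norm (star (T * (1 - P)) * (T * (1 - P)))" by (rule norm_star_mult_self[symmetric])
      also have "star (T * (1 - P)) * (T * (1 - P)) = ((1 - P) * R + (1 - P) * K) * (1 - P)"
        by (simp add: star_mult sQ K_def mult.assoc flip: distrib_left)
      also have "norm \<dots> \<le> norm ((1 - P) * R + (1 - P) * K) * norm (1 - P)" by (rule norm_mult_le)
      also have "\<dots> \<le> norm ((1 - P) * R + (1 - P) * K) * 1" using P(5) by (intro mult_left_mono) auto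
      also have "\<dots> \<le> norm ((1 - P) * R) + norm ((1 - P) * K)" by (simp add: norm_triangle_ineq)
      also have "\<dots> \<le> norm (1 - P) * norm R + e" by (intro add_mono norm_mult_le P(4))
      also have "\<dots> \<le> 1 * norm R + e" using P(5) by (intro add_mono mult_right_mono) auto
      finally show "(norm x)\<^sup>2 \<le> norm R + e" by simp
    qed
  qed
  ultimately show "norm (star x * x) = (norm x)\<^sup>2" by simp
qed

end

end

theory Submission
  imports Defs "HOL-Computational_Algebra.Primes"
begin

text \<open>Index an orthonormal basis of \<open>H\<close> by the nonzero torsion points of prime order \<open>p\<^sub>k\<close> of
  the torus \<open>\<real>\<^sup>2/\<int>\<^sup>2\<close>, one finite block for each \<open>k\<close>, and let \<open>B\<close> be generated by the
  multiplications by the two coordinates, the permutations given by the four elementary shears in \<open>SL\<^sub>2(\<int>)\<close>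
  and the discrete Fourier transform of each block. Suppose that \<open>x\<close> commutes with \<open>B\<close> modulo
  compact operators. The function that sends two points to the matrix entry of \<open>x\<close> at them is almost invariant
  under the shears and concentrated on pairs of nearby points. A paradoxical decomposition of the punctured
  plane (Burger's proof of relative property (T)) shows that it is concentrated on the diagonal. Since the entries
  of the Fourier transform all have the same modulus, the diagonal is almost constant on each block. Hence \<open>x\<close>
  is close to a scalar on the \<open>k\<close>-th block in the normalised Hilbert--Schmidt norm, with error tending to
  \<open>0\<close>. So in a unital subalgebra \<open>A\<close> of the commutant the elements whose normalised Hilbert--Schmidt norms
  on the blocks tend to \<open>0\<close> form a proper closed ideal that contains all commutators; if \<open>A\<close> is
  simple, this ideal is zero and \<open>A\<close> is commutative.\<close>

section \<open>Almost invariant functions under shears\<close>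

lemma L2_set_sq: "(L2_set f A)\<^sup>2 = (\<Sum>x\<in>A. (f x)\<^sup>2)"
  by (simp add: L2_set_def sum_nonneg)

lemma L2_set_le_iff: "0 \<le> c \<Longrightarrow> L2_set f A \<le> c \<longleftrightarrow> (\<Sum>x\<in>A. (f x)\<^sup>2) \<le> c\<^sup>2"
  by (simp add: L2_set_sq[symmetric] power2_le_iff_abs_le)

lemma L2_set_uminus: "L2_set (\<lambda>x. - f x) A = L2_set f A"
  by (simp add: L2_set_def)

lemma L2_set_mono_abs:
  assumes "\<And>i. i \<in> K \<Longrightarrow> \<bar>f i\<bar> \<le> g i"
  shows "L2_set f K \<le> L2_set g K"
proof -
  have "L2_set f K = L2_set (\<lambda>i. \<bar>f i\<bar>) K" by (simp add: L2_set_def)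
  also have "\<dots> \<le> L2_set g K" by (intro L2_set_mono assms) auto
  finally show ?thesis .
qed

lemma L2_set_subset: "finite B \<Longrightarrow> A \<subseteq> B \<Longrightarrow> L2_set f A \<le> L2_set f B"
  unfolding L2_set_def by (intro real_sqrt_le_mono sum_mono2) auto

lemma L2_set_Un_sq:
  assumes "finite A" "finite B" "A \<inter> B = {}"
  shows "(L2_set f (A \<union> B))\<^sup>2 = (L2_set f A)\<^sup>2 + (L2_set f B)\<^sup>2"
  using assms by (simp add: L2_set_sq sum.union_disjoint)

lemma L2_set_Un:
  assumes "finite A" "finite B"
  shows "L2_set f (A \<union> B) \<le> L2_set f A + L2_set f B"
proof (rule power2_le_imp_le)
  have "(L2_set f (A \<union> B))\<^sup>2 = (L2_set f A)\<^sup>2 + (L2_set f (B - A))\<^sup>2"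
    using L2_set_Un_sq[of A "B - A" f] assms by (simp add: Un_Diff_cancel)
  also have "(L2_set f (B - A))\<^sup>2 \<le> (L2_set f B)\<^sup>2"
    using assms by (intro power_mono L2_set_subset) auto
  finally show "(L2_set f (A \<union> B))\<^sup>2 \<le> (L2_set f A + L2_set f B)\<^sup>2"
    by (simp add: power2_sum) (smt (verit) L2_set_nonneg mult_nonneg_nonneg)
qed simp

lemma L2_set_reindex: "inj_on g A \<Longrightarrow> L2_set f (g ` A) = L2_set (\<lambda>x. f (g x)) A"
  by (simp add: L2_set_def sum.reindex)

text \<open>Write \<open>f\<close> as \<open>f \<circ> g\<close> minus the defect
  \<open>f \<circ> g - f\<close>. Reindexing along the injection \<open>g\<close> turns the first
  summand into \<open>f\<close> on the image; the defect is estimated over all of \<open>X\<close>.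
  So moving a set costs at most the defect.\<close>

lemma L2_set_shift:
  assumes "finite X" "A \<subseteq> X" "inj_on g X"
  shows "L2_set f A \<le> L2_set f (g ` A) + L2_set (\<lambda>z. f (g z) - f z) X"
proof -
  have "L2_set f A = L2_set (\<lambda>z. f (g z) + - (f (g z) - f z)) A" by simp
  also have "\<dots> \<le> L2_set (\<lambda>z. f (g z)) A + L2_set (\<lambda>z. - (f (g z) - f z)) A"
    by (rule L2_set_triangle_ineq)
  also have "L2_set (\<lambda>z. f (g z)) A = L2_set f (g ` A)"
    using inj_on_subset[OF assms(3,2)] by (simp add: L2_set_reindex)
  also have "L2_set (\<lambda>z. - (f (g z) - f z)) A \<le> L2_set (\<lambda>z. f (g z) - f z) X"
    unfolding L2_set_uminus using assms by (intro L2_set_subset)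
  finally show ?thesis by simp
qed

text \<open>Up to \<open>Z\<close>, the set \<open>E\<close> contains two disjoint copies of itself.
  If the norm \<open>m\<close> of \<open>f\<close> on \<open>E\<close> exceeded
  \<open>4 * (d + e)\<close>, each copy outside \<open>Z\<close> would carry at least three quarters
  of \<open>m\<close>, and twice 9/16 is more than 1.\<close>

lemma L2_set_paradoxical:
  assumes X: "finite X" "E \<subseteq> X" "Z \<subseteq> X" and inj: "inj_on g X" "inj_on h X"
    and sub: "g ` E \<subseteq> E \<union> Z" "h ` E \<subseteq> E \<union> Z" and disj: "g ` E \<inter> h ` E \<subseteq> Z"
    and g: "L2_set (\<lambda>z. f (g z) - f z) X \<le> d" and h: "L2_set (\<lambda>z. f (h z) - f z) X \<le> d"
    and Z: "L2_set f Z \<le> e"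
  shows "L2_set f E \<le> 4 * (d + e)"
proof (rule ccontr)
  assume "\<not> ?thesis"
  moreover have "0 \<le> d" "0 \<le> e"
    using g Z L2_set_nonneg order_trans by blast+
  ultimately have c: "L2_set f E > 4 * (d + e)" "0 \<le> d + e" by auto
  have fin: "finite E" "finite Z" using X finite_subset by blast+
  \<comment> \<open>Moving \<open>E\<close> by \<open>k\<close> costs \<open>d\<close>, discarding
    \<open>Z\<close> costs \<open>e\<close>.\<close>
  have low: "L2_set f E - (d + e) \<le> L2_set f (k ` E - Z)"
    if "inj_on k X" "L2_set (\<lambda>z. f (k z) - f z) X \<le> d" for k
  proof -
    have "L2_set f E \<le> L2_set f (k ` E) + d"
      using L2_set_shift[OF X(1,2) that(1), of f] that(2) by linarith
    also have "L2_set f (k ` E) \<le> L2_set f ((k ` E - Z) \<union> Z)"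
      using fin by (intro L2_set_subset) auto
    also have "\<dots> \<le> L2_set f (k ` E - Z) + L2_set f Z"
      using fin by (intro L2_set_Un) auto
    finally show ?thesis using Z by simp
  qed
  have "(L2_set f (g ` E - Z))\<^sup>2 + (L2_set f (h ` E - Z))\<^sup>2 = (L2_set f ((g ` E - Z) \<union> (h ` E - Z)))\<^sup>2"
    using fin disj by (intro L2_set_Un_sq[symmetric]) auto
  also have "\<dots> \<le> (L2_set f E)\<^sup>2"
    using fin sub by (intro power_mono L2_set_subset) auto
  finally have "(L2_set f (g ` E - Z))\<^sup>2 + (L2_set f (h ` E - Z))\<^sup>2 \<le> (L2_set f E)\<^sup>2" .
  moreover have "(3 / 4 * L2_set f E)\<^sup>2 \<le> (L2_set f (g ` E - Z))\<^sup>2"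
    using low[OF inj(1) g] c by (intro power_mono) auto
  moreover have "(3 / 4 * L2_set f E)\<^sup>2 \<le> (L2_set f (h ` E - Z))\<^sup>2"
    using low[OF inj(2) h] c by (intro power_mono) auto
  moreover have "(3 / 4 * L2_set f E)\<^sup>2 = 9 / 16 * (L2_set f E)\<^sup>2"
    by (simp add: power_mult_distrib power_divide)
  ultimately have "(L2_set f E)\<^sup>2 \<le> 0" by linarith
  then have "L2_set f E = 0" by simp
  with c show False by simp
qed

text \<open>On the cone \<open>x\<close> and \<open>s * y\<close> have the same sign, so both shears
  add absolute values and stay in the cone. The last two inequalities make the two images disjoint:
  in one the first coordinate strictly dominates, in the other the second coordinate is at least as
  large. Strictness comes from \<open>x \<noteq> 0\<close>.\<close>

lemma cone_shear:
  fixes x y s :: real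
  assumes "s = 1 \<or> s = -1" "x \<noteq> 0" "0 \<le> s * x * y"
  shows "x + s * y \<noteq> 0" "0 \<le> s * (x + s * y) * y" "0 \<le> s * x * (y + s * x)"
    "\<bar>y\<bar> < \<bar>x + s * y\<bar>" "\<bar>x\<bar> \<le> \<bar>y + s * x\<bar>"
proof -
  have "x \<noteq> 0" "s = 1 \<and> (x > 0 \<and> y \<ge> 0 \<or> x < 0 \<and> y \<le> 0) \<or> s = -1 \<and> (x > 0 \<and> y \<le> 0 \<or> x < 0 \<and> y \<ge> 0)"
    using assms by (auto simp: zero_le_mult_iff mult_le_0_iff)
  then show "x + s * y \<noteq> 0" "0 \<le> s * (x + s * y) * y" "0 \<le> s * x * (y + s * x)"
    "\<bar>y\<bar> < \<bar>x + s * y\<bar>" "\<bar>x\<bar> \<le> \<bar>y + s * x\<bar>"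
    by (elim conjE disjE; simp add: zero_le_mult_iff mult_le_0_iff)+
qed

text \<open>Relative property (T) of \<open>(SL\<^sub>2(\<int>) \<ltimes> \<int>\<^sup>2, \<int>\<^sup>2)\<close> after Burger: each cone
  \<open>{x \<noteq> 0, s x y \<ge> 0}\<close> of the plane contains two disjoint images of itself under shears, so that an
  almost invariant function is small on it. The set \<open>Z\<close> collects the points where the
  shears of the torus do not lift to those of the plane.\<close>

lemma L2_set_shear_gap:
  fixes f u v :: "'x \<Rightarrow> real" and g h :: "int \<Rightarrow> 'x \<Rightarrow> 'x"
  assumes X: "finite X"
    and g: "\<And>s. s = 1 \<or> s = -1 \<Longrightarrow> bij_betw (g s) X X"
    and h: "\<And>s. s = 1 \<or> s = -1 \<Longrightarrow> bij_betw (h s) X X"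
    and ug: "\<And>s z. z \<in> X \<Longrightarrow> u (g s z) - (u z + s * v z) \<in> \<int>"
    and vg: "\<And>s z. z \<in> X \<Longrightarrow> v (g s z) = v z"
    and uh: "\<And>s z. z \<in> X \<Longrightarrow> u (h s z) = u z"
    and vh: "\<And>s z. z \<in> X \<Longrightarrow> v (h s z) - (v z + s * u z) \<in> \<int>"
    and fg: "\<And>s. s = 1 \<or> s = -1 \<Longrightarrow> L2_set (\<lambda>z. f (g s z) - f z) X \<le> d"
    and fh: "\<And>s. s = 1 \<or> s = -1 \<Longrightarrow> L2_set (\<lambda>z. f (h s z) - f z) X \<le> d"
    and fu: "L2_set (\<lambda>z. u z * f z) X \<le> d" and fv: "L2_set (\<lambda>z. v z * f z) X \<le> d"
  shows "L2_set f {z \<in> X. u z \<noteq> 0 \<or> v z \<noteq> 0} \<le> 161 * d"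
proof -
  \<comment> \<open>From this square a shear leads to coordinates below 1/2. If the image is in the
    square too, the integer by which the torus shear and the plane shear differ is below 1 in
    absolute value, hence 0.\<close>
  define Q where "Q = {z \<in> X. \<bar>u z\<bar> < 1 / 4 \<and> \<bar>v z\<bar> < 1 / 4}"
  define Z where "Z = X - Q"
  define E where "E s = {z \<in> Q. u z \<noteq> 0 \<and> 0 \<le> real_of_int s * u z * v z}" for s
  \<comment> \<open>The punctured vertical axis, the part of the square that neither cone
    covers.\<close>
  define D where "D = {z \<in> Q. u z = 0 \<and> v z \<noteq> 0}"
  have fin: "finite Q" "finite Z" "finite (E s)" "finite D" for s
    using X by (auto simp: Q_def Z_def E_def D_def)
  have d: "0 \<le> d" using fu L2_set_nonneg order_trans by blast
  \<comment> \<open>Where the coordinate \<open>w\<close> is at least 1/4 in absolute value,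
    \<open>f\<close> is at most four times \<open>w * f\<close>.\<close>
  have far: "L2_set f {z \<in> X. 1 / 4 \<le> \<bar>w z\<bar>} \<le> 4 * d"
    if "L2_set (\<lambda>z. w z * f z) X \<le> d" for w :: "'x \<Rightarrow> real"
  proof -
    have "L2_set f {z \<in> X. 1 / 4 \<le> \<bar>w z\<bar>} = L2_set (\<lambda>z. \<bar>f z\<bar>) {z \<in> X. 1 / 4 \<le> \<bar>w z\<bar>}"
      by (simp add: L2_set_def)
    also have "\<dots> \<le> L2_set (\<lambda>z. 4 * \<bar>w z * f z\<bar>) {z \<in> X. 1 / 4 \<le> \<bar>w z\<bar>}"
    proof (rule L2_set_mono)
      fix z assume "z \<in> {z \<in> X. 1 / 4 \<le> \<bar>w z\<bar>}"
      then have "1 / 4 * \<bar>f z\<bar> \<le> \<bar>w z\<bar> * \<bar>f z\<bar>" by (intro mult_right_mono) auto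
      then show "\<bar>f z\<bar> \<le> 4 * \<bar>w z * f z\<bar>" by (simp add: abs_mult)
    qed simp
    also have "\<dots> \<le> L2_set (\<lambda>z. 4 * \<bar>w z * f z\<bar>) X"
      using X by (intro L2_set_subset) auto
    also have "\<dots> = 4 * L2_set (\<lambda>z. w z * f z) X"
      by (subst L2_set_right_distrib[symmetric]) (simp_all add: L2_set_def)
    finally show ?thesis using that by simp
  qed
  have "L2_set f Z \<le> L2_set f ({z \<in> X. 1 / 4 \<le> \<bar>u z\<bar>} \<union> {z \<in> X. 1 / 4 \<le> \<bar>v z\<bar>})"
    using X by (intro L2_set_subset) (auto simp: Z_def Q_def)
  also have "\<dots> \<le> 4 * d + 4 * d"
    using X by (intro order_trans[OF L2_set_Un] add_mono far fu fv) auto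
  finally have Z: "L2_set f Z \<le> 8 * d" by simp
  have near: "r = q" if "r - q \<in> \<int>" "\<bar>r\<bar> < 1 / 4" "\<bar>q\<bar> < 1 / 2" for r q :: real
  proof -
    have "\<bar>r - q\<bar> < 1" using that by linarith
    with that(1) show ?thesis using Ints_nonzero_abs_less1[of "r - q"] by simp
  qed
  have step: "g s z \<in> Z \<or> g s z \<in> Q \<and> u (g s z) = u z + s * v z \<and> v (g s z) = v z"
    "h s z \<in> Z \<or> h s z \<in> Q \<and> v (h s z) = v z + s * u z \<and> u (h s z) = u z"
    if "z \<in> Q" "s = 1 \<or> s = -1" for s :: int and z
  proof -
    have z: "z \<in> X" using that by (simp add: Q_def)
    have "g s z \<in> X" "h s z \<in> X" using z g h that(2) bij_betwE by blast+
    moreover have "\<bar>u z + s * v z\<bar> < 1 / 2" "\<bar>v z + s * u z\<bar> < 1 / 2"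
      using that abs_triangle_ineq[of "u z" "s * v z"] abs_triangle_ineq[of "v z" "s * u z"]
      by (auto simp: Q_def abs_mult)
    ultimately show "g s z \<in> Z \<or> g s z \<in> Q \<and> u (g s z) = u z + s * v z \<and> v (g s z) = v z"
      "h s z \<in> Z \<or> h s z \<in> Q \<and> v (h s z) = v z + s * u z \<and> u (h s z) = u z"
      using ug[OF z, of s] vg[OF z, of s] uh[OF z, of s] vh[OF z, of s] near
      by (auto simp: Z_def Q_def)
  qed
  have E: "L2_set f (E s) \<le> 36 * d" if s: "s = 1 \<or> s = -1" for s
  proof -
    have s': "real_of_int s = 1 \<or> real_of_int s = -1" using s by auto
    have gE: "g s z \<in> Z \<or> g s z \<in> E s \<and> \<bar>v (g s z)\<bar> < \<bar>u (g s z)\<bar>" if "z \<in> E s" for z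
      using step(1)[of z s] that s cone_shear[OF s', of "u z" "v z"] by (auto simp: E_def)
    have hE: "h s z \<in> Z \<or> h s z \<in> E s \<and> \<bar>u (h s z)\<bar> \<le> \<bar>v (h s z)\<bar>" if "z \<in> E s" for z
      using step(2)[of z s] that s cone_shear[OF s', of "u z" "v z"] by (auto simp: E_def)
    have "L2_set f (E s) \<le> 4 * (d + 8 * d)"
    proof (rule L2_set_paradoxical[OF X])
      show "g s ` E s \<inter> h s ` E s \<subseteq> Z" using gE hE by fastforce
    qed (use gE hE g[OF s] h[OF s] fg[OF s] fh[OF s] Z in
        \<open>auto simp: E_def Q_def Z_def bij_betw_def\<close>)
    then show ?thesis by simp
  qed
  \<comment> \<open>The shear \<open>g 1\<close> pushes the axis off itself: the first coordinate
    becomes the nonzero second one, so the image lies in the cones or in \<open>Z\<close>.\<close>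
  have "L2_set f D \<le> L2_set f (g 1 ` D) + L2_set (\<lambda>z. f (g 1 z) - f z) X"
    using g[of 1] X by (intro L2_set_shift) (auto simp: D_def Q_def bij_betw_def)
  also have "L2_set f (g 1 ` D) \<le> L2_set f (E 1 \<union> E (-1) \<union> Z)"
  proof (intro L2_set_subset image_subsetI)
    show "g 1 z \<in> E 1 \<union> E (-1) \<union> Z" if "z \<in> D" for z
      using step(1)[of z 1] that by (auto simp: D_def E_def)
  qed (use fin in auto)
  also have "\<dots> \<le> 36 * d + 36 * d + 8 * d"
    using L2_set_Un[of "E 1 \<union> E (-1)" Z f] L2_set_Un[of "E 1" "E (-1)" f] E[of 1] E[of "-1"] Z fin
    by auto
  finally have D: "L2_set f D \<le> 81 * d" using fg[of 1] by simp
  have "L2_set f {z \<in> X. u z \<noteq> 0 \<or> v z \<noteq> 0} \<le> L2_set f (E 1 \<union> E (-1) \<union> D \<union> Z)"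
  proof (rule L2_set_subset)
    show "{z \<in> X. u z \<noteq> 0 \<or> v z \<noteq> 0} \<subseteq> E 1 \<union> E (-1) \<union> D \<union> Z"
      by (auto simp: E_def D_def Z_def mult_le_0_iff zero_le_mult_iff)
  qed (use fin in auto)
  also have "\<dots> \<le> 36 * d + 36 * d + 81 * d + 8 * d"
    using L2_set_Un[of "E 1 \<union> E (-1) \<union> D" Z f] L2_set_Un[of "E 1 \<union> E (-1)" D f]
      L2_set_Un[of "E 1" "E (-1)" f] E[of 1] E[of "-1"] D Z fin
    by auto
  finally show ?thesis by simp
qed

section \<open>Finite Fourier transforms\<close>

lemma root_of_unity_sum:
  fixes N :: nat and k :: int
  assumes "N > 0" "\<not> int N dvd k"
  shows "(\<Sum>j<N. cis (2 * pi * (k * int j) / N)) = 0"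
proof -
  define z where "z = cis (2 * pi * k / N)"
  have pow: "cis (2 * pi * (k * int j) / N) = z ^ j" for j
    unfolding z_def Complex.DeMoivre by (simp add: mult_ac)
  have "z ^ N = cis (2 * pi * of_int k)"
    using assms unfolding z_def Complex.DeMoivre by (simp add: mult_ac)
  then have "z ^ N = 1" by (simp add: cis_multiple_2pi)
  \<comment> \<open>If \<open>z\<close> were 1, then \<open>k / N\<close> would be an integer.
    Otherwise the geometric sum has the numerator \<open>1 - z ^ N = 0\<close>.\<close>
  moreover have "z \<noteq> 1"
  proof
    assume "z = 1"
    then have "cos (2 * pi * k / N) = 1" by (simp add: z_def complex_eq_iff)
    then obtain m :: int where "2 * pi * k / N = 2 * pi * m"
      using cos_one_2pi_int by (auto simp: mult_ac)
    then have "real_of_int k = m * N" using assms by (simp add: field_simps)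
    then have "k = m * int N" by linarith
    with assms show False by simp
  qed
  ultimately show ?thesis unfolding pow by (simp add: sum_gp_strict)
qed


lemma flat_unitary_matrix:
  assumes J: "finite J"
  obtains F :: "'i \<Rightarrow> 'i \<Rightarrow> complex" where "\<And>a b. F a b = F b a"
    "\<And>a b. cmod (F a b) = 1 / sqrt (card J)"
    "\<And>c. (\<Sum>a\<in>J. (cmod (\<Sum>b\<in>J. F a b * c b))\<^sup>2) = (\<Sum>b\<in>J. (cmod (c b))\<^sup>2)"
proof -
  define N where "N = card J"
  obtain \<iota> where \<iota>: "bij_betw \<iota> J {..<N}"
    using ex_bij_betw_finite_nat[OF J] by (auto simp: N_def atLeast0LessThan)
  \<comment> \<open>The Fourier matrix of the cyclic group of order \<open>N\<close>, transported to
    \<open>J\<close> by the enumeration \<open>\<iota>\<close>. Its columns are orthonormal by the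
    vanishing sums of roots of unity, which gives the isometry property.\<close>
  define F where "F a b = cis (2 * pi * (int (\<iota> a) * int (\<iota> b)) / N) / sqrt N" for a b
  have orth: "(\<Sum>a\<in>J. F a b * cnj (F a b')) = (if b = b' then 1 else 0)" if "b \<in> J" "b' \<in> J" for b b'
  proof -
    have N: "N > 0" using that J by (auto simp: N_def card_gt_0_iff)
    have "F a b * cnj (F a b') = cis (2 * pi * ((int (\<iota> b) - int (\<iota> b')) * int (\<iota> a)) / N) / N" for a
      using N by (simp add: F_def cis_cnj cis_mult algebra_simps diff_divide_distrib flip: of_real_mult)
    then have "(\<Sum>a\<in>J. F a b * cnj (F a b')) =
        (\<Sum>a\<in>J. cis (2 * pi * ((int (\<iota> b) - int (\<iota> b')) * int (\<iota> a)) / N)) / N"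
      by (simp only: sum_divide_distrib)
    also have "(\<Sum>a\<in>J. cis (2 * pi * ((int (\<iota> b) - int (\<iota> b')) * int (\<iota> a)) / N)) =
        (\<Sum>j<N. cis (2 * pi * ((int (\<iota> b) - int (\<iota> b')) * int j) / N))"
      using \<iota> by (rule sum.reindex_bij_betw)
    also have "\<dots> / N = (if b = b' then 1 else 0)"
    proof (cases "b = b'")
      case False
      have "\<iota> b < N" "\<iota> b' < N" "\<iota> b \<noteq> \<iota> b'"
        using \<iota> that False by (auto simp: bij_betw_def inj_on_def)
      then have "\<not> int N dvd int (\<iota> b) - int (\<iota> b')"
        using zdvd_imp_le[of "int N" "\<bar>int (\<iota> b) - int (\<iota> b')\<bar>"] by auto
      with False N show ?thesis using root_of_unity_sum[of N "int (\<iota> b) - int (\<iota> b')"] by simp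
    qed (use N in simp)
    finally show ?thesis .
  qed
  show thesis
  proof
    show "F a b = F b a" for a b by (simp add: F_def mult.commute)
    show "cmod (F a b) = 1 / sqrt (card J)" for a b by (simp add: F_def norm_divide N_def)
    show "(\<Sum>a\<in>J. (cmod (\<Sum>b\<in>J. F a b * c b))\<^sup>2) = (\<Sum>b\<in>J. (cmod (c b))\<^sup>2)" for c
    proof -
      have "complex_of_real (\<Sum>a\<in>J. (cmod (\<Sum>b\<in>J. F a b * c b))\<^sup>2) =
          (\<Sum>a\<in>J. \<Sum>b\<in>J. \<Sum>b'\<in>J. F a b * c b * cnj (F a b' * c b'))"
        by (simp only: of_real_sum complex_norm_square cnj_sum sum_product)
      also have "\<dots> = (\<Sum>b\<in>J. \<Sum>a\<in>J. \<Sum>b'\<in>J. F a b * c b * cnj (F a b' * c b'))"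
        by (rule sum.swap)
      also have "\<dots> = (\<Sum>b\<in>J. \<Sum>b'\<in>J. \<Sum>a\<in>J. F a b * c b * cnj (F a b' * c b'))"
        by (intro sum.cong refl sum.swap)
      also have "\<dots> = (\<Sum>b\<in>J. \<Sum>b'\<in>J. (\<Sum>a\<in>J. F a b * cnj (F a b')) * (c b * cnj (c b')))"
        by (simp add: sum_distrib_left mult_ac)
      also have "\<dots> = (\<Sum>b\<in>J. \<Sum>b'\<in>J. if b = b' then c b * cnj (c b') else 0)"
        by (intro sum.cong refl) (simp add: orth)
      also have "\<dots> = complex_of_real (\<Sum>b\<in>J. (cmod (c b))\<^sup>2)"
        using J by (simp add: complex_norm_square del: of_real_power)
      finally show ?thesis unfolding of_real_eq_iff .
    qed
  qed
qed

section \<open>Orthonormal bases\<close>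

lemma cinner_sum_left: "cinner (\<Sum>i\<in>A. f i) y = (\<Sum>i\<in>A. cinner (f i) y)"
  by (induction A rule: infinite_finite_induct) (simp_all add: cinner_add_left)

lemma cinner_sum_right: "cinner y (\<Sum>i\<in>A. f i) = (\<Sum>i\<in>A. cinner y (f i))"
  by (induction A rule: infinite_finite_induct) (simp_all add: cinner_add_right)

locale orthonormal_basis =
  fixes I :: "'i set" and e :: "'i \<Rightarrow> 'h::chilbert_space"
  assumes orthonormal: "a \<in> I \<Longrightarrow> b \<in> I \<Longrightarrow> cinner (e a) (e b) = (if a = b then 1 else 0)"
    and complete: "(\<And>a. a \<in> I \<Longrightarrow> cinner y (e a) = 0) \<Longrightarrow> y = 0"
begin

lemma norm_basis: "a \<in> I \<Longrightarrow> norm (e a) = 1"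
  using orthonormal[of a a] Re_cinner_self[of "e a"] by (simp add: abs_square_eq_1)

lemma basis_ext: "x = y" if "\<And>a. a \<in> I \<Longrightarrow> cinner x (e a) = cinner y (e a)"
  using complete[of "x - y"] that by (simp add: cinner_diff_left)

lemma bessel:
  assumes "finite G" "G \<subseteq> I"
  shows "(\<Sum>a\<in>G. (cmod (cinner y (e a)))\<^sup>2) \<le> (norm y)\<^sup>2"
proof -
  define z where "z = (\<Sum>a\<in>G. cinner y (e a) *\<^sub>C e a)"
  have ze: "cinner z (e a) = cinner y (e a)" if "a \<in> G" for a
  proof -
    have "cinner z (e a) = (\<Sum>b\<in>G. if b = a then cinner y (e b) else 0)"
      unfolding z_def cinner_sum_left
      using assms that by (intro sum.cong refl) (auto simp: cinner_scaleC_left orthonormal subset_eq)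
    also have "\<dots> = cinner y (e a)" using assms that by simp
    finally show ?thesis .
  qed
  have "cinner x z = (\<Sum>a\<in>G. cnj (cinner y (e a)) * cinner x (e a))" for x
    by (simp add: z_def cinner_sum_right cinner_scaleC_right)
  then have yz: "cinner y z = (\<Sum>a\<in>G. (cmod (cinner y (e a)))\<^sup>2)"
    and zz: "cinner z z = (\<Sum>a\<in>G. (cmod (cinner y (e a)))\<^sup>2)"
    by (simp_all add: ze complex_norm_square mult.commute del: of_real_power cong: sum.cong)
  have "0 \<le> (norm (y - z))\<^sup>2" by simp
  also have "\<dots> = (norm y)\<^sup>2 + (norm z)\<^sup>2 - 2 * Re (cinner y z)" by (rule norm_diff_square)
  also have "(norm z)\<^sup>2 = Re (cinner z z)" by (simp add: Re_cinner_self)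
  finally show ?thesis unfolding yz zz Re_complex_of_real by simp
qed

text \<open>The vector comes from Riesz representation and not from a limit of partial sums: pairing
  coefficients with \<open>c\<close> is a functional bounded by \<open>C\<close>, by Cauchy-Schwarz
  and Bessel. Evaluating it at the representing vector \<open>y\<close> gives the bound on
  \<open>norm y\<close>.\<close>

lemma riesz_fischer:
  assumes bound: "\<And>G. finite G \<Longrightarrow> G \<subseteq> I \<Longrightarrow> (\<Sum>a\<in>G. (cmod (c a))\<^sup>2) \<le> C\<^sup>2" and C: "0 \<le> C"
  obtains y where "\<And>a. a \<in> I \<Longrightarrow> cinner y (e a) = c a" "norm y \<le> C"
proof -
  define \<phi> where "\<phi> x = (\<Sum>\<^sub>\<infinity>a\<in>I. cinner x (e a) * cnj (c a))" for x
  have fin: "(\<Sum>a\<in>G. norm (cinner x (e a) * cnj (c a))) \<le> norm x * C" if "finite G" "G \<subseteq> I" for x G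
  proof -
    have "(\<Sum>a\<in>G. norm (cinner x (e a) * cnj (c a))) = (\<Sum>a\<in>G. \<bar>cmod (cinner x (e a))\<bar> * \<bar>cmod (c a)\<bar>)"
      by (simp add: norm_mult)
    also have "\<dots> \<le> L2_set (\<lambda>a. cmod (cinner x (e a))) G * L2_set (\<lambda>a. cmod (c a)) G"
      by (rule L2_set_mult_ineq)
    also have "\<dots> \<le> norm x * C"
      unfolding L2_set_def using bessel[OF that, of x] bound[OF that] C
      by (intro mult_mono real_le_lsqrt) (auto intro: sum_nonneg)
    finally show ?thesis .
  qed
  have abs: "(\<lambda>a. norm (cinner x (e a) * cnj (c a))) summable_on I" for x
    using fin by (intro nonneg_bounded_partial_sums_imp_summable_on[where C = "norm x * C"])
      (auto simp: eventually_finite_subsets_at_top)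
  note sum = abs_summable_summable[OF abs]
  have "\<exists>z. \<forall>x. \<phi> x = cinner x z"
  proof (rule riesz_representation)
    show "\<phi> (x + y) = \<phi> x + \<phi> y" for x y
      using infsum_add[OF sum sum] by (simp add: \<phi>_def cinner_add_left distrib_right)
    show "\<phi> (k *\<^sub>C x) = k * \<phi> x" for k x
      by (simp add: \<phi>_def cinner_scaleC_left mult.assoc infsum_cmult_right')
    show "cmod (\<phi> x) \<le> norm x * C" for x
      unfolding \<phi>_def using fin
      by (intro order_trans[OF norm_infsum_bound[OF abs]] infsum_le_finite_sums abs)
  qed
  then obtain y where y: "\<And>x. \<phi> x = cinner x y" by blast
  have ye: "cinner y (e a) = c a" if "a \<in> I" for a
  proof -
    have "cinner (e a) y = (\<Sum>\<^sub>\<infinity>b\<in>{a}. cinner (e a) (e b) * cnj (c b))"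
      unfolding y[symmetric] \<phi>_def using that
      by (intro infsum_cong_neutral) (auto simp: orthonormal)
    then show ?thesis using that cinner_commute[of y "e a"] by (simp add: orthonormal)
  qed
  have "(norm y)\<^sup>2 \<le> norm y * C"
  proof -
    have "(norm y)\<^sup>2 = cmod (\<phi> y)" by (simp add: y cinner_self norm_power)
    also have "\<dots> \<le> norm y * C"
      unfolding \<phi>_def using fin
      by (intro order_trans[OF norm_infsum_bound[OF abs]] infsum_le_finite_sums abs)
    finally show ?thesis .
  qed
  then have "norm y \<le> C" using C by (cases "y = 0") (auto simp: power2_eq_square)
  with ye show thesis by (rule that)
qed

text \<open>Riesz-Fischer gives a vector of norm at most \<open>C\<close> with the coefficients of
  \<open>y\<close>; by completeness of the basis it is \<open>y\<close>.\<close>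

lemma parseval_le:
  assumes "\<And>G. finite G \<Longrightarrow> G \<subseteq> I \<Longrightarrow> (\<Sum>a\<in>G. (cmod (cinner y (e a)))\<^sup>2) \<le> C\<^sup>2" "0 \<le> C"
  shows "norm y \<le> C"
proof -
  obtain z where z: "\<And>a. a \<in> I \<Longrightarrow> cinner z (e a) = cinner y (e a)" "norm z \<le> C"
    using riesz_fischer[OF assms] by blast
  then have "z = y" by (intro basis_ext)
  with z show ?thesis by simp
qed

text \<open>Matrix entries are only ever summed over finite sets of rows. This lemma passes from
  such sums to the norms of whole columns: finitely many columns are approximated at once by the
  union of the row sets that approximate each of them.\<close>

lemma parseval_L2_set:
  assumes J: "finite J"
    and G: "\<And>G. finite G \<Longrightarrow> G \<subseteq> I \<Longrightarrow>
      L2_set (\<lambda>(b, a). cmod (cinner (y a) (e b))) (G \<times> J) \<le> C"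
  shows "L2_set (\<lambda>a. norm (y a)) J \<le> C"
proof -
  have C: "0 \<le> C" using G[of "{}"] by simp
  have "(\<Sum>a\<in>J. (norm (y a))\<^sup>2) \<le> C\<^sup>2 + d" if d: "d > 0" for d
  proof -
    \<comment> \<open>The errors of all columns then add up to at most \<open>d\<close>; the added 1
      covers empty \<open>J\<close>.\<close>
    define \<delta> where "\<delta> = d / (card J + 1)"
    have \<delta>: "\<delta> > 0" "card J * \<delta> \<le> d" using d by (simp_all add: \<delta>_def field_simps)
    have "\<exists>G. finite G \<and> G \<subseteq> I \<and> (norm (y a))\<^sup>2 - \<delta> \<le> (\<Sum>b\<in>G. (cmod (cinner (y a) (e b)))\<^sup>2)" for a
    proof (rule ccontr)
      assume "\<not> ?thesis"
      then have *: "(\<Sum>b\<in>G. (cmod (cinner (y a) (e b)))\<^sup>2) \<le> (norm (y a))\<^sup>2 - \<delta>"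
        if "finite G" "G \<subseteq> I" for G
        using that by (meson linear)
      then have nonneg: "0 \<le> (norm (y a))\<^sup>2 - \<delta>" using *[of "{}"] by simp
      then have "norm (y a) \<le> sqrt ((norm (y a))\<^sup>2 - \<delta>)"
        using * by (intro parseval_le) auto
      then have "(norm (y a))\<^sup>2 \<le> (norm (y a))\<^sup>2 - \<delta>"
        using power_mono[of _ _ 2] real_sqrt_pow2[OF nonneg] norm_ge_zero by metis
      with \<delta> show False by simp
    qed
    then obtain G where G': "\<And>a. finite (G a)" "\<And>a. G a \<subseteq> I"
      "\<And>a. (norm (y a))\<^sup>2 - \<delta> \<le> (\<Sum>b\<in>G a. (cmod (cinner (y a) (e b)))\<^sup>2)" by metis
    define U where "U = (\<Union>a\<in>J. G a)"
    have U: "finite U" "U \<subseteq> I" using G' J by (auto simp: U_def)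
    have "(\<Sum>a\<in>J. (norm (y a))\<^sup>2) - card J * \<delta> = (\<Sum>a\<in>J. (norm (y a))\<^sup>2 - \<delta>)"
      by (simp add: sum_subtractf)
    also have "\<dots> \<le> (\<Sum>a\<in>J. \<Sum>b\<in>U. (cmod (cinner (y a) (e b)))\<^sup>2)"
    proof (rule sum_mono)
      fix a assume "a \<in> J"
      then have "(\<Sum>b\<in>G a. (cmod (cinner (y a) (e b)))\<^sup>2) \<le> (\<Sum>b\<in>U. (cmod (cinner (y a) (e b)))\<^sup>2)"
        using U by (intro sum_mono2) (auto simp: U_def)
      with G'(3)[of a] show "(norm (y a))\<^sup>2 - \<delta> \<le> (\<Sum>b\<in>U. (cmod (cinner (y a) (e b)))\<^sup>2)"
        by linarith
    qed
    also have "\<dots> = (L2_set (\<lambda>(b, a). cmod (cinner (y a) (e b))) (U \<times> J))\<^sup>2"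
      by (subst sum.swap) (simp add: L2_set_def sum_nonneg sum.cartesian_product case_prod_beta)
    also have "\<dots> \<le> C\<^sup>2" using G[OF U] by (intro power_mono) auto
    finally show ?thesis using \<delta> by simp
  qed
  then have "(\<Sum>a\<in>J. (norm (y a))\<^sup>2) \<le> C\<^sup>2" by (rule field_le_epsilon)
  then show ?thesis unfolding L2_set_def using C by (intro real_le_lsqrt) (auto intro: sum_nonneg)
qed

lemma bessel_L2_set:
  assumes "finite G" "G \<subseteq> I"
  shows "L2_set (\<lambda>(b, a). cmod (cinner (y a) (e b))) (G \<times> J) \<le> L2_set (\<lambda>a. norm (y a)) J"
proof -
  have "(\<Sum>(b, a)\<in>G \<times> J. (cmod (cinner (y a) (e b)))\<^sup>2) = (\<Sum>a\<in>J. \<Sum>b\<in>G. (cmod (cinner (y a) (e b)))\<^sup>2)"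
    by (subst sum.swap) (simp add: sum.cartesian_product)
  also have "\<dots> \<le> (\<Sum>a\<in>J. (norm (y a))\<^sup>2)" by (intro sum_mono bessel assms)
  finally show ?thesis by (simp add: L2_set_def case_prod_beta)
qed

section \<open>Decay of coefficients and compact operators\<close>

lemma finite_large_coefficients:
  assumes d: "d > 0"
  shows "finite {a \<in> I. d \<le> cmod (cinner y (e a))}"
proof (rule ccontr)
  assume inf: "infinite {a \<in> I. d \<le> cmod (cinner y (e a))}"
  obtain n :: nat where n: "(norm y)\<^sup>2 / d\<^sup>2 < n" using reals_Archimedean2 by blast
  obtain G where G: "finite G" "card G = n" "G \<subseteq> {a \<in> I. d \<le> cmod (cinner y (e a))}"
    using infinite_arbitrarily_large[OF inf] by blast
  have "n * d\<^sup>2 = (\<Sum>a\<in>G. d\<^sup>2)" using G by simp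
  also have "\<dots> \<le> (\<Sum>a\<in>G. (cmod (cinner y (e a)))\<^sup>2)"
    using G d by (intro sum_mono power_mono) auto
  also have "\<dots> \<le> (norm y)\<^sup>2" using G by (intro bessel) auto
  finally show False using n d by (simp add: field_simps)
qed

text \<open>A vector \<open>v = K (e a)\<close> of norm at least \<open>d\<close> has a point
  \<open>y\<close> of a finite \<open>d / 2\<close>-net near it, and then the inner product of
  \<open>y\<close> and \<open>v\<close> is at least \<open>d\<^sup>2 / 2\<close> in modulus. This is
  a coefficient of \<open>star K\<close> at \<open>y\<close>, and for each of the finitely many
  \<open>y\<close> only finitely many coefficients are that large.\<close>

lemma finite_large_compact:
  assumes K: "compact_operator K" and d: "d > 0"
  shows "finite {a \<in> I. d \<le> norm (cblinop_apply K (e a))}"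
proof -
  obtain k where k: "finite k" "\<And>x. norm x \<le> 1 \<Longrightarrow> \<exists>y\<in>k. norm (cblinop_apply K x - y) < d / 2"
    using compact_operator_net[OF K, of "d / 2"] d by auto
  have "{a \<in> I. d \<le> norm (cblinop_apply K (e a))}
      \<subseteq> (\<Union>y\<in>k. {a \<in> I. d\<^sup>2 / 2 \<le> cmod (cinner (cblinop_apply (star K) y) (e a))})"
  proof
    fix a assume a: "a \<in> {a \<in> I. d \<le> norm (cblinop_apply K (e a))}"
    define v where "v = cblinop_apply K (e a)"
    obtain y where y: "y \<in> k" "norm (v - y) < d / 2"
      using k(2)[of "e a"] a norm_basis[of a] by (auto simp: v_def)
    have v: "d \<le> norm v" using a by (simp add: v_def)
    have "(norm v)\<^sup>2 = cmod (cinner y v + cinner (v - y) v)"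
      by (simp add: cinner_diff_left cinner_self norm_power)
    also have "\<dots> \<le> cmod (cinner y v) + d / 2 * norm v"
      using y(2) by (intro order_trans[OF norm_triangle_ineq] add_left_mono
          order_trans[OF Cauchy_Schwarz_cinner] mult_right_mono) auto
    finally have "norm v * (norm v - d / 2) \<le> cmod (cinner y v)"
      by (simp add: power2_eq_square algebra_simps)
    moreover have "d * (d / 2) \<le> norm v * (norm v - d / 2)"
      using v d by (intro mult_mono) auto
    ultimately have "d\<^sup>2 / 2 \<le> cmod (cinner y v)" by (simp add: power2_eq_square)
    also have "cinner y v = cinner (cblinop_apply (star K) y) (e a)"
      by (simp add: v_def star_cblinop_def cinner_adjoint')
    finally show "a \<in> (\<Union>y\<in>k. {a \<in> I. d\<^sup>2 / 2 \<le> cmod (cinner (cblinop_apply (star K) y) (e a))})"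
      using y a by auto
  qed
  moreover have "finite (\<Union>y\<in>k. {a \<in> I. d\<^sup>2 / 2 \<le> cmod (cinner (cblinop_apply (star K) y) (e a))})"
    using k(1) d by (intro finite_UN_I finite_large_coefficients) auto
  ultimately show ?thesis by (rule finite_subset)
qed

text \<open>All operators of the construction are contractive on finite blocks. The image of
  \<open>y\<close> is defined by its coefficients through Riesz-Fischer; linearity then follows
  because coefficients determine a vector.\<close>

lemma block_operator:
  fixes J :: "'m \<Rightarrow> 'i set" and k :: "'i \<Rightarrow> 'i \<Rightarrow> complex"
  assumes J: "\<And>m. finite (J m)" "disjoint_family J" "(\<Union>m. J m) = I"
    and k: "\<And>m c. (\<Sum>b\<in>J m. (cmod (\<Sum>a\<in>J m. k b a * c a))\<^sup>2) \<le> (\<Sum>a\<in>J m. (cmod (c a))\<^sup>2)"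
  obtains T where "\<And>m b y. b \<in> J m \<Longrightarrow>
    cinner (cblinop_apply T y) (e b) = (\<Sum>a\<in>J m. k b a * cinner y (e a))"
proof -
  have "\<forall>b\<in>I. \<exists>m. b \<in> J m" using J(3) by blast
  then obtain \<mu> where \<mu>: "\<And>b. b \<in> I \<Longrightarrow> b \<in> J (\<mu> b)" by metis
  have \<mu>_eq: "\<mu> b = m" if "b \<in> J m" for b m
  proof (rule ccontr)
    assume "\<mu> b \<noteq> m"
    then have "J (\<mu> b) \<inter> J m = {}" using J(2) by (auto simp: disjoint_family_on_def)
    moreover have "b \<in> I" using that J(3) by blast
    ultimately show False using that \<mu> by blast
  qed
  define c where "c y b = (\<Sum>a\<in>J (\<mu> b). k b a * cinner y (e a))" for y b
  have bound: "(\<Sum>b\<in>G. (cmod (c y b))\<^sup>2) \<le> (norm y)\<^sup>2" if G: "finite G" "G \<subseteq> I" for G y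
  proof -
    \<comment> \<open>The finite set \<open>G\<close> is enlarged to the union of the blocks it
      meets, so that contractivity can be applied block by block, followed by Bessel.\<close>
    have sub: "G \<subseteq> (\<Union>m\<in>\<mu> ` G. J m)" using \<mu> G by blast
    have disj: "\<forall>m\<in>\<mu> ` G. \<forall>n\<in>\<mu> ` G. m \<noteq> n \<longrightarrow> J m \<inter> J n = {}"
      using J(2) by (auto simp: disjoint_family_on_def)
    have "(\<Sum>b\<in>G. (cmod (c y b))\<^sup>2) \<le> (\<Sum>b\<in>(\<Union>m\<in>\<mu> ` G. J m). (cmod (c y b))\<^sup>2)"
      using sub G J by (intro sum_mono2) auto
    also have "\<dots> = (\<Sum>m\<in>\<mu> ` G. \<Sum>b\<in>J m. (cmod (c y b))\<^sup>2)"
      using G J disj by (intro sum.UNION_disjoint) auto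
    also have "\<dots> = (\<Sum>m\<in>\<mu> ` G. \<Sum>b\<in>J m. (cmod (\<Sum>a\<in>J m. k b a * cinner y (e a)))\<^sup>2)"
      by (intro sum.cong refl) (simp add: c_def \<mu>_eq)
    also have "\<dots> \<le> (\<Sum>m\<in>\<mu> ` G. \<Sum>a\<in>J m. (cmod (cinner y (e a)))\<^sup>2)"
      by (intro sum_mono k)
    also have "\<dots> = (\<Sum>a\<in>(\<Union>m\<in>\<mu> ` G. J m). (cmod (cinner y (e a)))\<^sup>2)"
      using G J disj by (intro sum.UNION_disjoint[symmetric]) auto
    also have "\<dots> \<le> (norm y)\<^sup>2" using G J by (intro bessel) auto
    finally show ?thesis .
  qed
  have "\<exists>z. (\<forall>b\<in>I. cinner z (e b) = c y b) \<and> norm z \<le> norm y" for y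
    using riesz_fischer[OF bound norm_ge_zero] by metis
  then obtain t where t: "\<And>y b. b \<in> I \<Longrightarrow> cinner (t y) (e b) = c y b" "\<And>y. norm (t y) \<le> norm y"
    by metis
  have "\<exists>T. cblinop_apply T = t"
  proof (rule cblinop_construct)
    show "t (x + y) = t x + t y" for x y
      by (rule basis_ext)
        (simp add: t cinner_add_left c_def distrib_left sum.distrib)
    show "t (r *\<^sub>C x) = r *\<^sub>C t x" for r x
      by (rule basis_ext)
        (simp add: t cinner_scaleC_left c_def sum_distrib_left mult.left_commute)
    show "norm (t x) \<le> norm x * 1" for x using t(2) by simp
  qed
  then obtain T where T: "cblinop_apply T = t" by blast
  show thesis
  proof
    show "cinner (cblinop_apply T y) (e b) = (\<Sum>a\<in>J m. k b a * cinner y (e a))" if "b \<in> J m" for m b y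
    proof -
      have "b \<in> I" using that J(3) by blast
      then show ?thesis using \<mu>_eq[OF that] by (simp add: T t c_def)
    qed
  qed
qed

end

text \<open>A maximal orthonormal set is complete. Separability makes it countable and infinite
  dimension makes it infinite, so it can be relabelled by any countably infinite set
  \<open>I\<close>, in particular by the torsion points.\<close>

lemma orthonormal_basis_exists:
  assumes separable: "separable_space (euclidean :: 'h::chilbert_space topology)"
    and infinite_dimensional: "\<not> (\<exists>S :: 'h::chilbert_space set. finite S \<and> cspan S = UNIV)"
    and I: "countable I" "infinite I"
  obtains e :: "'i \<Rightarrow> 'h::chilbert_space" where "orthonormal_basis I e"
proof -
  define \<O> where "\<O> = {B :: 'h set. \<forall>u\<in>B. \<forall>v\<in>B. cinner u v = (if u = v then 1 else 0)}"
  have "\<exists>M\<in>\<O>. \<forall>X\<in>\<O>. M \<subseteq> X \<longrightarrow> X = M"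
  proof (rule subset_Zorn')
    fix C assume C: "subset.chain \<O> C"
    show "\<Union>C \<in> \<O>"
      unfolding \<O>_def mem_Collect_eq
    proof (intro ballI)
      fix u v assume "u \<in> \<Union>C" "v \<in> \<Union>C"
      then obtain X Y where XY: "u \<in> X" "X \<in> C" "v \<in> Y" "Y \<in> C" by blast
      then have "X \<subseteq> Y \<or> Y \<subseteq> X" "X \<in> \<O>" "Y \<in> \<O>"
        using C by (auto simp: subset_chain_def)
      with XY show "cinner u v = (if u = v then 1 else 0)" by (auto simp: \<O>_def)
    qed
  qed
  then obtain M where M: "M \<in> \<O>" and max: "\<And>X. X \<in> \<O> \<Longrightarrow> M \<subseteq> X \<Longrightarrow> X = M" by blast
  have on: "cinner u v = (if u = v then 1 else 0)" if "u \<in> M" "v \<in> M" for u v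
    using M that by (auto simp: \<O>_def)
  have compl: "y = 0" if y: "\<And>u. u \<in> M \<Longrightarrow> cinner y u = 0" for y
  proof (rule ccontr)
    assume "y \<noteq> 0"
    define w where "w = complex_of_real (inverse (norm y)) *\<^sub>C y"
    have "norm w = 1" using \<open>y \<noteq> 0\<close> by (simp add: w_def norm_scaleC norm_inverse)
    then have ww: "cinner w w = 1" by (simp add: cinner_self)
    have wu: "cinner w u = 0" "cinner u w = 0" if "u \<in> M" for u
      using y[OF that] cinner_commute[of u w] by (simp_all add: w_def cinner_scaleC_left)
    have "w \<notin> M" using wu(1)[of w] ww by auto
    have "cinner u v = (if u = v then 1 else 0)" if "u \<in> insert w M" "v \<in> insert w M" for u v
      using that on[of u v] wu(1)[of v] wu(2)[of u] ww \<open>w \<notin> M\<close> by (cases "u = w"; cases "v = w") auto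
    then have "insert w M \<in> \<O>" by (simp only: \<O>_def mem_Collect_eq) blast
    then have "insert w M = M" by (intro max) auto
    with \<open>w \<notin> M\<close> show False by blast
  qed
  obtain D :: "'h set" where D: "countable D" "closure D = UNIV"
    using separable by (auto simp: separable_space_def)
  have "\<exists>d\<in>D. dist d u < 1 / 2" for u
    using D(2) closure_approachableD[of u D "1 / 2"] by (simp add: dist_commute)
  \<comment> \<open>Distinct orthonormal vectors are at distance \<open>sqrt 2\<close>, so points of
    the dense set within 1/2 of them are distinct.\<close>
  then obtain r where r: "\<And>u. r u \<in> D" "\<And>u. dist (r u) u < 1 / 2" by metis
  have "inj_on r M"
  proof (rule inj_onI, rule ccontr)
    fix u v assume uv: "u \<in> M" "v \<in> M" "r u = r v" "u \<noteq> v"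
    have "(norm (u - v))\<^sup>2 = 2"
      using on[OF uv(1,1)] on[OF uv(2,2)] on[OF uv(1,2)] uv(4)
        Re_cinner_self[of u] Re_cinner_self[of v]
      by (simp add: norm_diff_square)
    moreover have "dist u v < 1"
      using dist_triangle2[of u v "r u"] r(2)[of u] r(2)[of v] uv(3) by (simp add: dist_commute)
    then have "(norm (u - v))\<^sup>2 < 1" by (simp add: dist_norm abs_square_less_1)
    ultimately show False by simp
  qed
  moreover have "countable (r ` M)" by (rule countable_subset[OF _ D(1)]) (use r(1) in auto)
  ultimately have cM: "countable M" by (rule countable_image_inj_on[rotated])
  have iM: "infinite M"
  proof
    assume fin: "finite M"
    \<comment> \<open>The difference of \<open>y\<close> and its projection \<open>z\<close> is
      orthogonal to \<open>M\<close>, hence zero: a finite \<open>M\<close> would span the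
      space.\<close>
    have "y \<in> cspan M" for y
    proof -
      define z where "z = (\<Sum>u\<in>M. cinner y u *\<^sub>C u)"
      have "cinner z v = cinner y v" if "v \<in> M" for v
      proof -
        have "cinner z v = (\<Sum>u\<in>M. if u = v then cinner y u else 0)"
          unfolding z_def cinner_sum_left
          using that by (intro sum.cong refl) (auto simp: cinner_scaleC_left on)
        then show ?thesis using fin that by simp
      qed
      then have "y - z = 0" by (intro compl) (simp add: cinner_diff_left)
      moreover have "z \<in> cspan M" unfolding z_def
        by (intro complex_vector.span_sum complex_vector.span_scale complex_vector.span_base)
      ultimately show ?thesis by simp
    qed
    then show False using infinite_dimensional fin by blast
  qed
  define f where "f = from_nat_into M \<circ> to_nat_on I"
  have f: "bij_betw f I M"
    unfolding f_def using I cM iM by (intro bij_betw_trans[OF to_nat_on_infinite bij_betw_from_nat_into])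
  have "orthonormal_basis I f"
  proof
    show "cinner (f a) (f b) = (if a = b then 1 else 0)" if "a \<in> I" "b \<in> I" for a b
      using that f on[of "f a" "f b"] by (auto simp: bij_betw_def inj_on_def)
    show "y = 0" if "\<And>a. a \<in> I \<Longrightarrow> cinner y (f a) = 0" for y
      using that f by (intro compl) (auto simp: bij_betw_def)
  qed
  then show thesis by (rule that)
qed

section \<open>Permutation and diagonal operators, and commutators with a flat unitary\<close>

lemma cblinop_apply_sum: "cblinop_apply T (\<Sum>i\<in>A. f i) = (\<Sum>i\<in>A. cblinop_apply T (f i))"
  by (induction A rule: infinite_finite_induct) simp_all

context orthonormal_basis
begin

text \<open>The block kernel is the permutation matrix. Both its action on coefficients and its
  action on basis vectors are recorded, because the two products in a commutator need one
  each.\<close>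

lemma permutation_operator:
  fixes J :: "'m \<Rightarrow> 'i set"
  assumes J: "\<And>m. finite (J m)" "disjoint_family J" "(\<Union>m. J m) = I"
    and \<sigma>: "\<And>m. bij_betw \<sigma> (J m) (J m)"
  obtains U where "\<And>y b. b \<in> I \<Longrightarrow> cinner (cblinop_apply U y) (e (\<sigma> b)) = cinner y (e b)"
    "\<And>a. a \<in> I \<Longrightarrow> cblinop_apply U (e a) = e (\<sigma> a)"
proof -
  have inj: "\<sigma> a = \<sigma> b \<longleftrightarrow> a = b" if "a \<in> J m" "b \<in> J m" for a b m
    using \<sigma>[of m] that by (auto simp: bij_betw_def inj_on_def)
  have row: "(\<Sum>a\<in>J m. of_bool (\<sigma> b = \<sigma> a) * c a) = c b"
    if "b \<in> J m" for b m and c :: "'i \<Rightarrow> complex"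
  proof -
    have "(\<Sum>a\<in>J m. of_bool (\<sigma> b = \<sigma> a) * c a) = (\<Sum>a\<in>J m. if b = a then c a else 0)"
      using inj that by (intro sum.cong) auto
    then show ?thesis using J(1) that by simp
  qed
  have "(\<Sum>b\<in>J m. (cmod (\<Sum>a\<in>J m. of_bool (b = \<sigma> a) * c a))\<^sup>2) \<le> (\<Sum>a\<in>J m. (cmod (c a))\<^sup>2)"
    for m and c :: "'i \<Rightarrow> complex"
    using sum.reindex_bij_betw[OF \<sigma>, of "\<lambda>b. (cmod (\<Sum>a\<in>J m. of_bool (b = \<sigma> a) * c a))\<^sup>2" m]
    by (simp add: row cong: sum.cong)
  then obtain U where U: "\<And>m b y. b \<in> J m \<Longrightarrow>
      cinner (cblinop_apply U y) (e b) = (\<Sum>a\<in>J m. of_bool (b = \<sigma> a) * cinner y (e a))"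
    using block_operator[OF J, of "\<lambda>b a. of_bool (b = \<sigma> a)"] by blast
  show thesis
  proof
    show *: "cinner (cblinop_apply U y) (e (\<sigma> b)) = cinner y (e b)" if b: "b \<in> I" for y b
    proof -
      obtain m where m: "b \<in> J m" using J(3) b by blast
      then have "\<sigma> b \<in> J m" using \<sigma>[of m] by (auto simp: bij_betw_def)
      then show ?thesis by (simp only: U row[OF m])
    qed
    show "cblinop_apply U (e a) = e (\<sigma> a)" if a: "a \<in> I" for a
    proof (rule basis_ext)
      fix b' assume b': "b' \<in> I"
      then obtain m where "b' \<in> J m" using J(3) by blast
      then obtain b where b: "b' = \<sigma> b" "b \<in> J m" using \<sigma>[of m] by (auto simp: bij_betw_def)
      obtain n where n: "a \<in> J n" using J(3) a by blast
      have "\<sigma> a \<in> J n" using \<sigma>[of n] n by (auto simp: bij_betw_def)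
      then have sa: "\<sigma> a \<in> I" using J(3) by blast
      have bI: "b \<in> I" using b J(3) by blast
      have "a = b \<longleftrightarrow> \<sigma> a = \<sigma> b"
      proof
        assume "\<sigma> a = \<sigma> b"
        then have "m = n"
          using b \<open>b' \<in> J m\<close> \<open>\<sigma> a \<in> J n\<close> J(2) by (auto simp: disjoint_family_on_def)
        with inj n b \<open>\<sigma> a = \<sigma> b\<close> show "a = b" by blast
      qed simp
      then show "cinner (cblinop_apply U (e a)) (e b') = cinner (e (\<sigma> a)) (e b')"
        using *[OF bI] b' a bI sa by (simp add: b(1) orthonormal)
    qed
  qed
qed

lemma diagonal_operator:
  assumes "\<And>a. a \<in> I \<Longrightarrow> \<bar>d a\<bar> \<le> 1"
  obtains D where "\<And>y b. b \<in> I \<Longrightarrow> cinner (cblinop_apply D y) (e b) = of_real (d b) * cinner y (e b)"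
    "\<And>a. a \<in> I \<Longrightarrow> cblinop_apply D (e a) = of_real (d a) *\<^sub>C e a"
proof -
  \<comment> \<open>Blocks with at most one element: \<open>{b}\<close> for \<open>b\<close> in
    \<open>I\<close>, empty otherwise.\<close>
  define J where "J b = {b} \<inter> I" for b
  have J: "\<And>m. finite (J m)" "disjoint_family J" "(\<Union>m. J m) = I"
    by (auto simp: J_def disjoint_family_on_def)
  have "(\<Sum>b\<in>J m. (cmod (\<Sum>a\<in>J m. of_real (d b) * c a))\<^sup>2) \<le> (\<Sum>a\<in>J m. (cmod (c a))\<^sup>2)" for m c
    using assms[of m] by (cases "m \<in> I")
      (auto simp: J_def norm_mult power_mult_distrib mult_left_le_one_le abs_square_le_1)
  then obtain D where D: "\<And>m b y. b \<in> J m \<Longrightarrow>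
      cinner (cblinop_apply D y) (e b) = (\<Sum>a\<in>J m. of_real (d b) * cinner y (e a))"
    using block_operator[OF J, of "\<lambda>b a. of_real (d b)"] by blast
  show thesis
  proof
    show *: "cinner (cblinop_apply D y) (e b) = of_real (d b) * cinner y (e b)" if "b \<in> I" for y b
      using D[of b b y] that by (simp add: J_def)
    show "cblinop_apply D (e a) = of_real (d a) *\<^sub>C e a" if "a \<in> I" for a
      by (rule basis_ext) (use that in \<open>auto simp: * cinner_scaleC_left orthonormal\<close>)
  qed
qed

text \<open>\<open>T\<close> acts on the block \<open>J\<close> as a unitary with entries of equal modulus. If \<open>x\<close> is nearly
  diagonal with entries \<open>d\<close> and nearly commutes with \<open>T\<close>, then the matrix \<open>(d c - d a) F c a\<close> is
  small.\<close>

lemma nearly_scalar: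
  fixes J :: "'i set" and F :: "'i \<Rightarrow> 'i \<Rightarrow> complex"
  defines "d \<equiv> \<lambda>x a. cinner (cblinop_apply x (e a)) (e a)"
  assumes J: "finite J" "J \<noteq> {}" "J \<subseteq> I"
    and F: "\<And>a b. F a b = F b a" "\<And>a b. cmod (F a b) = 1 / sqrt (card J)"
      "\<And>c. (\<Sum>a\<in>J. (cmod (\<Sum>b\<in>J. F a b * c b))\<^sup>2) = (\<Sum>b\<in>J. (cmod (c b))\<^sup>2)"
    and T: "\<And>y b. b \<in> J \<Longrightarrow> cinner (cblinop_apply T y) (e b) = (\<Sum>a\<in>J. F b a * cinner y (e a))"
    and Te: "\<And>a. a \<in> J \<Longrightarrow> cblinop_apply T (e a) = (\<Sum>b\<in>J. F b a *\<^sub>C e b)"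
    and r: "L2_set (\<lambda>a. norm (cblinop_apply x (e a) - d x a *\<^sub>C e a)) J \<le> r"
    and \<epsilon>: "L2_set (\<lambda>a. norm (cblinop_apply (x * T - T * x) (e a))) J \<le> \<epsilon>"
  obtains c where "c \<in> J" "L2_set (\<lambda>a. norm (cblinop_apply x (e a) - d x c *\<^sub>C e a)) J \<le> 3 * r + \<epsilon>"
proof -
  \<comment> \<open>\<open>off\<close> is the off-diagonal part of \<open>x\<close> and
    \<open>K\<close> is the commutator with \<open>T\<close>; the first index is the row.\<close>
  define off where "off b a = cinner (cblinop_apply x (e a) - d x a *\<^sub>C e a) (e b)" for b a
  define K where "K b a = cinner (cblinop_apply (x * T - T * x) (e a)) (e b)" for b a
  have N: "real (card J) > 0" using J by (simp add: card_gt_0_iff)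
  have r0: "0 \<le> r" and \<epsilon>0: "0 \<le> \<epsilon>" using r \<epsilon> L2_set_nonneg order_trans by blast+
  have fx: "cinner (cblinop_apply x (e a)) (e b) = (if a = b then d x a else 0) + off b a"
    if "a \<in> J" "b \<in> J" for a b
    using that J(3) by (auto simp: off_def cinner_diff_left cinner_scaleC_left orthonormal subset_eq)
  \<comment> \<open>Entry of the commutator, with \<open>x\<close> split into its diagonal and
    \<open>off\<close>. The diagonal part contributes \<open>(d x b - d x a) * F b a\<close>, the
    rest the two products of \<open>off\<close> with \<open>F\<close>.\<close>
  have comm: "(d x b - d x a) * F b a = K b a - (\<Sum>c\<in>J. F a c * off b c) + (\<Sum>c\<in>J. F b c * off c a)"
    if a: "a \<in> J" and b: "b \<in> J" for a b
  proof -
    have "cinner (cblinop_apply (x * T) (e a)) (e b) =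
        (\<Sum>c\<in>J. F c a * cinner (cblinop_apply x (e c)) (e b))"
      using a by (simp add: Te cinner_sum_left cinner_scaleC_left
          cblinop_apply_sum)
    also have "\<dots> = (\<Sum>c\<in>J. (if c = b then F c a * d x c else 0) + F a c * off b c)"
      using b by (intro sum.cong refl) (simp add: fx distrib_left F(1)[of _ a])
    also have "\<dots> = F b a * d x b + (\<Sum>c\<in>J. F a c * off b c)"
      using J b by (simp add: sum.distrib)
    finally have 1: "cinner (cblinop_apply (x * T) (e a)) (e b) = F b a * d x b + (\<Sum>c\<in>J. F a c * off b c)" .
    have "cinner (cblinop_apply (T * x) (e a)) (e b) =
        (\<Sum>c\<in>J. F b c * cinner (cblinop_apply x (e a)) (e c))"
      using b by (simp add: T)
    also have "\<dots> = (\<Sum>c\<in>J. (if a = c then F b c * d x a else 0) + F b c * off c a)"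
      using a by (intro sum.cong refl) (simp add: fx distrib_left)
    also have "\<dots> = F b a * d x a + (\<Sum>c\<in>J. F b c * off c a)"
      using J a by (simp add: sum.distrib)
    finally have 2: "cinner (cblinop_apply (T * x) (e a)) (e b) = F b a * d x a + (\<Sum>c\<in>J. F b c * off c a)" .
    have "K b a = cinner (cblinop_apply (x * T) (e a)) (e b) - cinner (cblinop_apply (T * x) (e a)) (e b)"
      by (simp add: K_def cinner_diff_left)
    then show ?thesis unfolding 1 2 by (simp add: algebra_simps)
  qed
  have off: "L2_set (\<lambda>(b, a). cmod (off b a)) (J \<times> J) \<le> r"
    using order_trans[OF bessel_L2_set[OF J(1,3)] r] by (simp add: off_def)
  have K: "L2_set (\<lambda>(b, a). cmod (K b a)) (J \<times> J) \<le> \<epsilon>"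
    using order_trans[OF bessel_L2_set[OF J(1,3)] \<epsilon>] by (simp add: K_def)
  \<comment> \<open>Multiplication by the isometry \<open>F\<close> on either side preserves the
    Hilbert-Schmidt norm. Symmetry of \<open>F\<close> has put the right multiplication into the
    form of a left one acting on the rows of \<open>off\<close>.\<close>
  have "(L2_set (\<lambda>(b, a). cmod (\<Sum>c\<in>J. F a c * off b c)) (J \<times> J))\<^sup>2 =
      (L2_set (\<lambda>(b, a). cmod (off b a)) (J \<times> J))\<^sup>2"
    by (simp add: L2_set_sq case_prod_beta F(3) sum.cartesian_product')
  then have off1: "L2_set (\<lambda>(b, a). cmod (\<Sum>c\<in>J. F a c * off b c)) (J \<times> J) \<le> r"
    using off by (simp add: power2_eq_iff_nonneg)
  have "(L2_set (\<lambda>(b, a). cmod (\<Sum>c\<in>J. F b c * off c a)) (J \<times> J))\<^sup>2 =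
      (\<Sum>a\<in>J. \<Sum>b\<in>J. (cmod (\<Sum>c\<in>J. F b c * off c a))\<^sup>2)"
    by (subst sum.swap) (simp add: L2_set_sq case_prod_beta sum.cartesian_product')
  also have "\<dots> = (\<Sum>a\<in>J. \<Sum>b\<in>J. (cmod (off b a))\<^sup>2)" by (simp add: F(3))
  also have "\<dots> = (L2_set (\<lambda>(b, a). cmod (off b a)) (J \<times> J))\<^sup>2"
    by (subst sum.swap) (simp add: L2_set_sq case_prod_beta sum.cartesian_product')
  finally have off2: "L2_set (\<lambda>(b, a). cmod (\<Sum>c\<in>J. F b c * off c a)) (J \<times> J) \<le> r"
    using off by (simp add: power2_eq_iff_nonneg)
  have "L2_set (\<lambda>(b, a). cmod (d x b - d x a) / sqrt (card J)) (J \<times> J) \<le>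
      L2_set (\<lambda>z. (case z of (b, a) \<Rightarrow> cmod (K b a)) + ((case z of (b, a) \<Rightarrow> cmod (\<Sum>c\<in>J. F a c * off b c))
        + (case z of (b, a) \<Rightarrow> cmod (\<Sum>c\<in>J. F b c * off c a)))) (J \<times> J)"
  proof (intro L2_set_mono_abs)
    fix z assume "z \<in> J \<times> J"
    then obtain b a where z: "z = (b, a)" "a \<in> J" "b \<in> J" by blast
    \<comment> \<open>Flatness enters here: every entry of \<open>F\<close> gives the same weight to
      the difference of two diagonal values.\<close>
    have "cmod (d x b - d x a) / sqrt (card J) = cmod ((d x b - d x a) * F b a)"
      by (simp add: norm_mult F(2))
    also have "\<dots> \<le> cmod (K b a) + (cmod (\<Sum>c\<in>J. F a c * off b c) + cmod (\<Sum>c\<in>J. F b c * off c a))"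
      unfolding comm[OF z(2,3)]
      by (smt (verit) norm_triangle_ineq norm_triangle_ineq4)
    finally show "\<bar>case z of (b, a) \<Rightarrow> cmod (d x b - d x a) / sqrt (card J)\<bar> \<le>
        (case z of (b, a) \<Rightarrow> cmod (K b a)) + ((case z of (b, a) \<Rightarrow> cmod (\<Sum>c\<in>J. F a c * off b c))
        + (case z of (b, a) \<Rightarrow> cmod (\<Sum>c\<in>J. F b c * off c a)))"
      by (simp add: z(1))
  qed
  also have "\<dots> \<le> \<epsilon> + (r + r)"
    by (intro order_trans[OF L2_set_triangle_ineq] add_mono K off1 off2)
  finally have "(L2_set (\<lambda>(b, a). cmod (d x b - d x a) / sqrt (card J)) (J \<times> J))\<^sup>2 \<le> (\<epsilon> + (r + r))\<^sup>2"
    by (intro power_mono) auto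
  also have "(L2_set (\<lambda>(b, a). cmod (d x b - d x a) / sqrt (card J)) (J \<times> J))\<^sup>2 =
      (\<Sum>b\<in>J. \<Sum>a\<in>J. (cmod (d x b - d x a))\<^sup>2) / card J"
    using N by (simp add: L2_set_sq case_prod_beta power_divide sum_divide_distrib
 sum.cartesian_product')
  finally have avg: "(\<Sum>b\<in>J. \<Sum>a\<in>J. (cmod (d x b - d x a))\<^sup>2) \<le> (\<Sum>b\<in>J. (\<epsilon> + (r + r))\<^sup>2)"
    using N by (simp add: field_simps)
  \<comment> \<open>Averaging over the rows: some diagonal value \<open>d x c\<close> is as close to
    all the others as the mean allows.\<close>
  obtain c where c: "c \<in> J" "(\<Sum>a\<in>J. (cmod (d x c - d x a))\<^sup>2) \<le> (\<epsilon> + (r + r))\<^sup>2"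
    using avg sum_strict_mono[OF J(1,2), of "\<lambda>_. (\<epsilon> + (r + r))\<^sup>2" "\<lambda>b. \<Sum>a\<in>J. (cmod (d x b - d x a))\<^sup>2"]
    by (meson not_le)
  have c': "L2_set (\<lambda>a. cmod (d x c - d x a)) J \<le> \<epsilon> + (r + r)"
    using c(2) r0 \<epsilon>0 by (simp add: L2_set_le_iff)
  have "L2_set (\<lambda>a. norm (cblinop_apply x (e a) - d x c *\<^sub>C e a)) J \<le>
      L2_set (\<lambda>a. norm (cblinop_apply x (e a) - d x a *\<^sub>C e a) + cmod (d x c - d x a)) J"
  proof (rule L2_set_mono_abs)
    fix a assume a: "a \<in> J"
    have "cblinop_apply x (e a) - d x c *\<^sub>C e a =
        (cblinop_apply x (e a) - d x a *\<^sub>C e a) - (d x c - d x a) *\<^sub>C e a"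
      by (simp add: complex_vector.scale_left_diff_distrib)
    then have "norm (cblinop_apply x (e a) - d x c *\<^sub>C e a) \<le>
        norm (cblinop_apply x (e a) - d x a *\<^sub>C e a) + norm ((d x c - d x a) *\<^sub>C e a)"
      by (simp only: norm_triangle_ineq4)
    then show "\<bar>norm (cblinop_apply x (e a) - d x c *\<^sub>C e a)\<bar> \<le>
        norm (cblinop_apply x (e a) - d x a *\<^sub>C e a) + cmod (d x c - d x a)"
      using a J(3) norm_basis[of a] by (auto simp: norm_scaleC)
  qed
  also have "\<dots> \<le> r + (\<epsilon> + (r + r))"
    by (intro order_trans[OF L2_set_triangle_ineq] add_mono r c')
  finally show thesis using c(1) that by simp
qed

end

section \<open>The spectral gap on torsion points\<close>

text \<open>The triple \<open>(k, i, j)\<close> stands for the torsion point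
  \<open>(i / p k, j / p k)\<close>. The origin is left out because it has the same coordinates for
  every \<open>k\<close>.\<close>

definition torsion_block :: "(nat \<Rightarrow> int) \<Rightarrow> nat \<Rightarrow> (nat \<times> int \<times> int) set" where
  "torsion_block p k = {k} \<times> ({0..<p k} \<times> {0..<p k} - {(0, 0)})"

definition coord1 :: "(nat \<Rightarrow> int) \<Rightarrow> nat \<times> int \<times> int \<Rightarrow> real" where
  "coord1 p = (\<lambda>(k, i, j). i / p k)"

definition coord2 :: "(nat \<Rightarrow> int) \<Rightarrow> nat \<times> int \<times> int \<Rightarrow> real" where
  "coord2 p = (\<lambda>(k, i, j). j / p k)"

definition shear1 :: "(nat \<Rightarrow> int) \<Rightarrow> int \<Rightarrow> nat \<times> int \<times> int \<Rightarrow> nat \<times> int \<times> int" where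
  "shear1 p s = (\<lambda>(k, i, j). (k, (i + s * j) mod p k, j))"

definition shear2 :: "(nat \<Rightarrow> int) \<Rightarrow> int \<Rightarrow> nat \<times> int \<times> int \<Rightarrow> nat \<times> int \<times> int" where
  "shear2 p s = (\<lambda>(k, i, j). (k, i, (j + s * i) mod p k))"

lemma finite_torsion_block: "finite (torsion_block p k)"
  by (simp add: torsion_block_def)

lemma disjoint_torsion_block: "disjoint_family (torsion_block p)"
  by (auto simp: torsion_block_def disjoint_family_on_def)

lemma dvd_range_eq_0: "m dvd i \<Longrightarrow> 0 \<le> i \<Longrightarrow> i < m \<Longrightarrow> i = 0" for i m :: int
  using zdvd_not_zless[of i m] by (cases "i = 0") auto

text \<open>The shear by \<open>- s\<close> is the inverse. A nonzero point stays nonzero, as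
  \<open>j = 0\<close> and \<open>p k\<close> dividing \<open>i\<close> force \<open>i = 0\<close>.
  For \<open>p k\<close> not positive the block is empty.\<close>

lemma bij_betw_shear1: "bij_betw (shear1 p s) (torsion_block p k) (torsion_block p k)"
proof (cases "p k > 0")
  case True
  have "shear1 p s ` torsion_block p k \<subseteq> torsion_block p k" for s
    using True by (auto simp: shear1_def torsion_block_def dest: dvd_range_eq_0)
  moreover have "\<forall>a\<in>torsion_block p k. shear1 p (- s) (shear1 p s a) = a" for s
    by (auto simp: shear1_def torsion_block_def mod_simps)
  ultimately show ?thesis
    by (metis (no_types) bij_betw_byWitness[where f' = "shear1 p (- s)"] add.inverse_inverse)
qed (simp add: torsion_block_def bij_betw_def)

lemma bij_betw_shear2: "bij_betw (shear2 p s) (torsion_block p k) (torsion_block p k)"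
proof (cases "p k > 0")
  case True
  have "shear2 p s ` torsion_block p k \<subseteq> torsion_block p k" for s
    using True by (auto simp: shear2_def torsion_block_def dest: dvd_range_eq_0)
  moreover have "\<forall>a\<in>torsion_block p k. shear2 p (- s) (shear2 p s a) = a" for s
    by (auto simp: shear2_def torsion_block_def mod_simps)
  ultimately show ?thesis
    by (metis (no_types) bij_betw_byWitness[where f' = "shear2 p (- s)"] add.inverse_inverse)
qed (simp add: torsion_block_def bij_betw_def)

lemma mod_divide_diff_Ints:
  fixes m n :: int
  shows "n \<noteq> 0 \<Longrightarrow> real_of_int (m mod n) / n - m / n \<in> \<int>"
proof -
  assume "n \<noteq> 0"
  moreover have "real_of_int (m mod n) = m - n * (m div n)"
    by (simp flip: minus_mult_div_eq_mod)
  ultimately have "real_of_int (m mod n) / n - m / n = - of_int (m div n)"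
    by (simp add: field_simps)
  then show ?thesis by simp
qed

locale torus_basis = orthonormal_basis "\<Union>k. torsion_block p k" e
  for p :: "nat \<Rightarrow> int" and e :: "nat \<times> int \<times> int \<Rightarrow> 'h::chilbert_space" +
  assumes prime: "prime (p k)" and inj: "inj p"
begin

abbreviation "blk \<equiv> torsion_block p"

lemma p_gt_1: "p k > 1"
  using prime prime_gt_1_int by blast

lemma block_nonempty: "blk k \<noteq> {}"
proof -
  have "(k, 1, 0) \<in> blk k" using p_gt_1[of k] by (simp add: torsion_block_def)
  then show ?thesis by blast
qed

lemma orthonormal_block:
  "a \<in> blk k \<Longrightarrow> b \<in> blk l \<Longrightarrow> cinner (e a) (e b) = (if a = b then 1 else 0)"
  by (rule orthonormal) auto

lemma coord_shear:
  "coord1 p (shear1 p s a) - (coord1 p a + s * coord2 p a) \<in> \<int>"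
  "coord2 p (shear1 p s a) = coord2 p a"
  "coord1 p (shear2 p s a) = coord1 p a"
  "coord2 p (shear2 p s a) - (coord2 p a + s * coord1 p a) \<in> \<int>"
proof -
  obtain k i j where a: "a = (k, i, j)" by (cases a)
  have "p k \<noteq> 0" using p_gt_1[of k] by simp
  then show "coord1 p (shear1 p s a) - (coord1 p a + s * coord2 p a) \<in> \<int>"
    "coord2 p (shear1 p s a) = coord2 p a"
    "coord1 p (shear2 p s a) = coord1 p a"
    "coord2 p (shear2 p s a) - (coord2 p a + s * coord1 p a) \<in> \<int>"
    using mod_divide_diff_Ints[of "p k" "i + s * j"] mod_divide_diff_Ints[of "p k" "j + s * i"]
    by (simp_all add: a coord1_def coord2_def shear1_def shear2_def add_divide_distrib)
qed

lemma abs_coord_le: "a \<in> blk k \<Longrightarrow> \<bar>coord1 p a\<bar> \<le> 1" "a \<in> blk k \<Longrightarrow> \<bar>coord2 p a\<bar> \<le> 1"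
  by (auto simp: torsion_block_def coord1_def coord2_def)

text \<open>Here the distinct primes are needed. Equal coordinates in different blocks give
  \<open>i * p l = i' * p k\<close>, so the prime \<open>p k\<close> divides \<open>i\<close>, and
  likewise \<open>j\<close>; both are then 0, and the origin is excluded.\<close>

lemma coord_inj:
  assumes "a \<in> blk k" "b \<in> blk l" "coord1 p a = coord1 p b" "coord2 p a = coord2 p b"
  shows "a = b"
proof -
  obtain i j where a: "a = (k, i, j)"
    using assms(1) by (auto simp: torsion_block_def)
  have ij: "0 \<le> i" "i < p k" "0 \<le> j" "j < p k" "i \<noteq> 0 \<or> j \<noteq> 0"
    using assms(1) by (auto simp: torsion_block_def a)
  obtain i' j' where b: "b = (l, i', j')"
    using assms(2) by (auto simp: torsion_block_def)
  have p: "p k > 0" "p l > 0" using p_gt_1[of k] p_gt_1[of l] by auto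
  have "real_of_int (i * p l) = real_of_int (i' * p k)" "real_of_int (j * p l) = real_of_int (j' * p k)"
    using assms(3,4) p by (simp_all add: a b coord1_def coord2_def field_simps)
  then have eq: "i * p l = i' * p k" "j * p l = j' * p k" by (simp_all only: of_int_eq_iff)
  show ?thesis
  proof (cases "k = l")
    case True
    with eq p show ?thesis by (simp add: a b)
  next
    case False
    then have "\<not> p k dvd p l"
      using primes_dvd_imp_eq[OF prime prime] inj by (auto simp: inj_def)
    moreover have "p k dvd i * p l" "p k dvd j * p l" using eq by simp_all
    ultimately have "p k dvd i" "p k dvd j" by (simp_all add: prime_dvd_mult_iff[OF prime])
    then have "i = 0" "j = 0" using ij by (auto dest: dvd_range_eq_0)
    with ij show ?thesis by simp
  qed
qed

text \<open>The Hilbert-Schmidt norm of \<open>x\<close> restricted to the span of the block. The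
  images are not cut down to the block, so smallness also bounds the part of \<open>x\<close> that
  leaves it.\<close>

definition hs_norm :: "nat \<Rightarrow> 'h cblinop \<Rightarrow> real" where
  "hs_norm k x = L2_set (\<lambda>a. norm (cblinop_apply x (e a))) (blk k)"

text \<open>The shear gap is applied to the moduli of the matrix entries of \<open>x\<close>, with
  the differences of the coordinates of row and column as \<open>u\<close> and \<open>v\<close>. By
  \<open>coord_inj\<close> both differences vanish on the diagonal only.\<close>

lemma off_diagonal_small:
  assumes U1: "\<And>s y b. b \<in> (\<Union>k. blk k) \<Longrightarrow>
      cinner (cblinop_apply (U1 s) y) (e (shear1 p s b)) = cinner y (e b)"
      "\<And>s a. a \<in> (\<Union>k. blk k) \<Longrightarrow> cblinop_apply (U1 s) (e a) = e (shear1 p s a)"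
    and U2: "\<And>s y b. b \<in> (\<Union>k. blk k) \<Longrightarrow>
      cinner (cblinop_apply (U2 s) y) (e (shear2 p s b)) = cinner y (e b)"
      "\<And>s a. a \<in> (\<Union>k. blk k) \<Longrightarrow> cblinop_apply (U2 s) (e a) = e (shear2 p s a)"
    and D1: "\<And>y b. b \<in> (\<Union>k. blk k) \<Longrightarrow>
      cinner (cblinop_apply D1 y) (e b) = of_real (coord1 p b) * cinner y (e b)"
      "\<And>a. a \<in> (\<Union>k. blk k) \<Longrightarrow> cblinop_apply D1 (e a) = of_real (coord1 p a) *\<^sub>C e a"
    and D2: "\<And>y b. b \<in> (\<Union>k. blk k) \<Longrightarrow>
      cinner (cblinop_apply D2 y) (e b) = of_real (coord2 p b) * cinner y (e b)"
      "\<And>a. a \<in> (\<Union>k. blk k) \<Longrightarrow> cblinop_apply D2 (e a) = of_real (coord2 p a) *\<^sub>C e a"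
    and d: "\<And>s. s = 1 \<or> s = -1 \<Longrightarrow> hs_norm k (x * U1 s - U1 s * x) \<le> d"
      "\<And>s. s = 1 \<or> s = -1 \<Longrightarrow> hs_norm k (x * U2 s - U2 s * x) \<le> d"
      "hs_norm k (x * D1 - D1 * x) \<le> d" "hs_norm k (x * D2 - D2 * x) \<le> d"
  shows "L2_set (\<lambda>a. norm (cblinop_apply x (e a) - cinner (cblinop_apply x (e a)) (e a) *\<^sub>C e a)) (blk k)
    \<le> 161 * d"
proof (rule parseval_L2_set[OF finite_torsion_block])
  fix G assume G: "finite G" "G \<subseteq> (\<Union>k. blk k)"
  \<comment> \<open>Saturating the rows to whole blocks gives a finite set on which the shears
    act.\<close>
  define G' where "G' = (\<Union>m\<in>fst ` G. blk m)"
  define X where "X = G' \<times> blk k"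
  define f where "f z = cmod (cinner (cblinop_apply x (e (snd z))) (e (fst z)))" for z
  define y where "y a = cblinop_apply x (e a) - cinner (cblinop_apply x (e a)) (e a) *\<^sub>C e a" for a
  have G': "finite G'" "G' \<subseteq> (\<Union>k. blk k)" "G \<subseteq> G'"
    using G finite_torsion_block by (auto simp: G'_def torsion_block_def)
  have X: "finite X" using G' finite_torsion_block by (simp add: X_def)
  have kI: "blk k \<subseteq> (\<Union>k. blk k)" by blast
  have XI: "\<exists>b a. z = (b, a) \<and> b \<in> (\<Union>k. blk k) \<and> a \<in> (\<Union>k. blk k)" if "z \<in> X" for z
    using that G'(2) kI unfolding X_def by blast
  have bijG: "bij_betw \<sigma> G' G'" if "\<And>m. bij_betw \<sigma> (blk m) (blk m)" for \<sigma>
    unfolding G'_def by (rule bij_betw_UNION_disjoint)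
      (use that disjoint_torsion_block in \<open>auto simp: disjoint_family_on_def\<close>)
  have bijX: "bij_betw (map_prod \<sigma> \<sigma>) X X" if "\<And>m. bij_betw \<sigma> (blk m) (blk m)" for \<sigma>
    unfolding X_def using bijG[OF that] that by (intro bij_betw_map_prod)
  \<comment> \<open>The commutator with the permutation has at \<open>(\<sigma> b, a)\<close> the
    entry of \<open>x\<close> at \<open>(\<sigma> b, \<sigma> a)\<close> minus the one at
    \<open>(b, a)\<close>. Permuting the rows by \<open>\<sigma>\<close> leaves the total norm
    unchanged.\<close>
  have shear: "L2_set (\<lambda>z. f (map_prod \<sigma> \<sigma> z) - f z) X \<le> d"
    if \<sigma>: "\<And>m. bij_betw \<sigma> (blk m) (blk m)"
      and U: "\<And>y b. b \<in> (\<Union>k. blk k) \<Longrightarrow> cinner (cblinop_apply U y) (e (\<sigma> b)) = cinner y (e b)"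
        "\<And>a. a \<in> (\<Union>k. blk k) \<Longrightarrow> cblinop_apply U (e a) = e (\<sigma> a)"
      and d: "hs_norm k (x * U - U * x) \<le> d" for \<sigma> U
  proof -
    define K where "K b a = cmod (cinner (cblinop_apply (x * U - U * x) (e a)) (e b))" for b a
    have "L2_set (\<lambda>z. f (map_prod \<sigma> \<sigma> z) - f z) X \<le> L2_set (\<lambda>(b, a). K (\<sigma> b) a) X"
    proof (rule L2_set_mono_abs)
      fix z assume "z \<in> X"
      then obtain b a where z: "z = (b, a)" "b \<in> (\<Union>k. blk k)" "a \<in> (\<Union>k. blk k)"
        using XI by blast
      have "cinner (cblinop_apply (x * U - U * x) (e a)) (e (\<sigma> b)) =
          cinner (cblinop_apply x (e (\<sigma> a))) (e (\<sigma> b)) - cinner (cblinop_apply x (e a)) (e b)"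
        using z(2,3) by (simp add: cinner_diff_left U)
      then show "\<bar>f (map_prod \<sigma> \<sigma> z) - f z\<bar> \<le> (case z of (b, a) \<Rightarrow> K (\<sigma> b) a)"
        by (simp add: z(1) f_def K_def norm_triangle_ineq3)
    qed
    also have "\<dots> = L2_set (\<lambda>(b, a). K b a) X"
    proof -
      have inj: "inj_on (map_prod \<sigma> id) X" and im: "map_prod \<sigma> id ` X = X"
        using bij_betw_map_prod[OF bijG[OF \<sigma>] bij_betw_id[of "blk k"]]
        by (simp_all add: bij_betw_def X_def)
      show ?thesis
        using L2_set_reindex[OF inj, of "\<lambda>(b, a). K b a"] unfolding im
        by (simp add: case_prod_unfold)
    qed
    also have "\<dots> \<le> d"
      using order_trans[OF bessel_L2_set[OF G'(1,2)] d[unfolded hs_norm_def]] by (simp add: X_def K_def)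
    finally show ?thesis .
  qed
  have diag: "L2_set (\<lambda>z. (c (fst z) - c (snd z)) * f z) X \<le> d"
    if D: "\<And>y b. b \<in> (\<Union>k. blk k) \<Longrightarrow> cinner (cblinop_apply D y) (e b) = of_real (c b) * cinner y (e b)"
        "\<And>a. a \<in> (\<Union>k. blk k) \<Longrightarrow> cblinop_apply D (e a) = of_real (c a) *\<^sub>C e a"
      and d: "hs_norm k (x * D - D * x) \<le> d" for c D
  proof -
    have "L2_set (\<lambda>z. (c (fst z) - c (snd z)) * f z) X
        \<le> L2_set (\<lambda>(b, a). cmod (cinner (cblinop_apply (x * D - D * x) (e a)) (e b))) X"
    proof (rule L2_set_mono_abs)
      fix z assume "z \<in> X"
      then obtain b a where z: "z = (b, a)" "b \<in> (\<Union>k. blk k)" "a \<in> (\<Union>k. blk k)"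
        using XI by blast
      have "cinner (cblinop_apply (x * D - D * x) (e a)) (e b) =
          of_real (c a - c b) * cinner (cblinop_apply x (e a)) (e b)"
        using z(2,3) by (simp add: cinner_diff_left cinner_scaleC_left D left_diff_distrib)
      then have "cmod (cinner (cblinop_apply (x * D - D * x) (e a)) (e b)) = \<bar>c a - c b\<bar> * f z"
        by (simp only: norm_mult norm_of_real f_def z(1) fst_conv snd_conv)
      then show "\<bar>(c (fst z) - c (snd z)) * f z\<bar> \<le>
          (case z of (b, a) \<Rightarrow> cmod (cinner (cblinop_apply (x * D - D * x) (e a)) (e b)))"
        by (simp add: z(1) abs_mult abs_minus_commute f_def)
    qed
    also have "\<dots> \<le> d"
      using order_trans[OF bessel_L2_set[OF G'(1,2)] d[unfolded hs_norm_def]] by (simp add: X_def)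
    finally show ?thesis .
  qed
  \<comment> \<open>A shear acts on row and column simultaneously, so the differences undergo the
    same shear modulo integers, even across blocks.\<close>
  define u where "u z = coord1 p (fst z) - coord1 p (snd z)" for z
  define v where "v z = coord2 p (fst z) - coord2 p (snd z)" for z
  define W where "W = {z \<in> X. u z \<noteq> 0 \<or> v z \<noteq> 0}"
  have Ints: "a - a' - (b - b' + s * (c - c')) \<in> \<int>"
    if "a - (b + s * c) \<in> \<int>" "a' - (b' + s * c') \<in> \<int>" for a a' b b' c c' s :: real
    using Ints_diff[OF that] by (simp add: algebra_simps)
  have W: "L2_set f W \<le> 161 * d"
    unfolding W_def
  proof (rule L2_set_shear_gap[OF X, where g = "\<lambda>s. map_prod (shear1 p s) (shear1 p s)"
        and h = "\<lambda>s. map_prod (shear2 p s) (shear2 p s)"])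
    show "L2_set (\<lambda>z. u z * f z) X \<le> d" unfolding u_def by (rule diag[OF D1 d(3)])
    show "L2_set (\<lambda>z. v z * f z) X \<le> d" unfolding v_def by (rule diag[OF D2 d(4)])
  qed (use shear[OF bij_betw_shear1 U1 d(1)] shear[OF bij_betw_shear2 U2 d(2)] in
      \<open>auto intro!: bijX bij_betw_shear1 bij_betw_shear2 Ints coord_shear simp: u_def v_def coord_shear\<close>)
  define h where "h z = cmod (cinner (y (snd z)) (e (fst z)))" for z
  have hf: "h z = (if z \<in> W then f z else 0)" if zX: "z \<in> X" for z
  proof -
    obtain b a where z: "z = (b, a)" "b \<in> (\<Union>k. blk k)" "a \<in> blk k"
      using G'(2) zX unfolding X_def by blast
    then have "a = b \<or> z \<in> W"
      using zX coord_inj[of a k b] by (auto simp: W_def u_def v_def)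
    moreover have "z \<notin> W" if "a = b" using that by (simp add: W_def u_def v_def z(1))
    moreover have "cinner (e a) (e b) = (if a = b then 1 else 0)"
      using z(2,3) orthonormal_block by blast
    ultimately show ?thesis
      by (auto simp: h_def f_def y_def z(1) cinner_diff_left cinner_scaleC_left)
  qed
  have "L2_set h (G \<times> blk k) \<le> L2_set h X"
    using X G'(3) by (intro L2_set_subset) (auto simp: X_def)
  also have "L2_set h X = L2_set f W"
    unfolding L2_set_def using X
    by (intro arg_cong[where f = sqrt] sum.mono_neutral_cong_right) (auto simp: hf W_def)
  finally show "L2_set (\<lambda>(b, a). cmod (cinner (cblinop_apply x (e a) -
      cinner (cblinop_apply x (e a)) (e a) *\<^sub>C e a) (e b))) (G \<times> blk k) \<le> 161 * d"
    using W by (simp add: h_def[abs_def] y_def case_prod_unfold)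
qed

text \<open>One finite set of generators and one constant serve all blocks. The shears and
  coordinates make \<open>x\<close> nearly diagonal, and the Fourier transform makes the diagonal
  nearly constant.\<close>

lemma spectral_gap:
  obtains \<G> :: "'h cblinop set" where "finite \<G>"
    "\<And>x k d. (\<And>g. g \<in> \<G> \<Longrightarrow> hs_norm k (x * g - g * x) \<le> d) \<Longrightarrow>
      \<exists>c. cmod c \<le> norm x \<and> hs_norm k (x - c *\<^sub>C 1) \<le> 484 * d"
proof -
  note blocks = finite_torsion_block disjoint_torsion_block refl
  have "\<forall>s. \<exists>U. (\<forall>y. \<forall>b\<in>\<Union>k. blk k. cinner (cblinop_apply U y) (e (shear1 p s b)) = cinner y (e b)) \<and>
      (\<forall>a\<in>\<Union>k. blk k. cblinop_apply U (e a) = e (shear1 p s a))"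
    using permutation_operator[OF blocks bij_betw_shear1] by metis
  then obtain U1 where U1: "\<And>s y b. b \<in> (\<Union>k. blk k) \<Longrightarrow>
      cinner (cblinop_apply (U1 s) y) (e (shear1 p s b)) = cinner y (e b)"
      "\<And>s a. a \<in> (\<Union>k. blk k) \<Longrightarrow> cblinop_apply (U1 s) (e a) = e (shear1 p s a)"
    by metis
  have "\<forall>s. \<exists>U. (\<forall>y. \<forall>b\<in>\<Union>k. blk k. cinner (cblinop_apply U y) (e (shear2 p s b)) = cinner y (e b)) \<and>
      (\<forall>a\<in>\<Union>k. blk k. cblinop_apply U (e a) = e (shear2 p s a))"
    using permutation_operator[OF blocks bij_betw_shear2] by metis
  then obtain U2 where U2: "\<And>s y b. b \<in> (\<Union>k. blk k) \<Longrightarrow>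
      cinner (cblinop_apply (U2 s) y) (e (shear2 p s b)) = cinner y (e b)"
      "\<And>s a. a \<in> (\<Union>k. blk k) \<Longrightarrow> cblinop_apply (U2 s) (e a) = e (shear2 p s a)"
    by metis
  obtain D1 where D1: "\<And>y b. b \<in> (\<Union>k. blk k) \<Longrightarrow>
      cinner (cblinop_apply D1 y) (e b) = of_real (coord1 p b) * cinner y (e b)"
      "\<And>a. a \<in> (\<Union>k. blk k) \<Longrightarrow> cblinop_apply D1 (e a) = of_real (coord1 p a) *\<^sub>C e a"
    using diagonal_operator[of "coord1 p"] abs_coord_le(1) by blast
  obtain D2 where D2: "\<And>y b. b \<in> (\<Union>k. blk k) \<Longrightarrow>
      cinner (cblinop_apply D2 y) (e b) = of_real (coord2 p b) * cinner y (e b)"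
      "\<And>a. a \<in> (\<Union>k. blk k) \<Longrightarrow> cblinop_apply D2 (e a) = of_real (coord2 p a) *\<^sub>C e a"
    using diagonal_operator[of "coord2 p"] abs_coord_le(2) by blast
  define flat where "flat k F \<longleftrightarrow> (\<forall>a b. F a b = F b a) \<and> (\<forall>a b. cmod (F a b) = 1 / sqrt (card (blk k))) \<and>
      (\<forall>c. (\<Sum>a\<in>blk k. (cmod (\<Sum>b\<in>blk k. F a b * c b))\<^sup>2) = (\<Sum>b\<in>blk k. (cmod (c b))\<^sup>2))" for k F
  have "\<exists>F. flat k F" for k
  proof (rule flat_unitary_matrix[OF finite_torsion_block[of p k]])
    fix F
    assume "\<And>a b. F a b = F b a" "\<And>a b. cmod (F a b) = 1 / sqrt (card (blk k))"
      "\<And>c. (\<Sum>a\<in>blk k. (cmod (\<Sum>b\<in>blk k. F a b * c b))\<^sup>2) = (\<Sum>b\<in>blk k. (cmod (c b))\<^sup>2)"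
    then have "flat k F" unfolding flat_def by (intro conjI allI)
    then show ?thesis by (intro exI)
  qed
  then obtain F where "\<And>k. flat k (F k)" by metis
  then have F: "\<And>k a b. F k a b = F k b a" "\<And>k a b. cmod (F k a b) = 1 / sqrt (card (blk k))"
    "\<And>k c. (\<Sum>a\<in>blk k. (cmod (\<Sum>b\<in>blk k. F k a b * c b))\<^sup>2) = (\<Sum>b\<in>blk k. (cmod (c b))\<^sup>2)"
    unfolding flat_def by blast+
  have fst: "fst a = k" if "a \<in> blk k" for a k using that by (auto simp: torsion_block_def)
  have "(\<Sum>b\<in>blk m. (cmod (\<Sum>a\<in>blk m. F (fst b) b a * c a))\<^sup>2) \<le> (\<Sum>a\<in>blk m. (cmod (c a))\<^sup>2)" for m c
    using F(3)[of m c] by (simp add: fst cong: sum.cong)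
  \<comment> \<open>The index \<open>fst b\<close> selects the Fourier matrix of the block
    containing \<open>b\<close>, so one operator carries all the transforms.\<close>
  then obtain T where T': "\<And>m b y. b \<in> blk m \<Longrightarrow>
      cinner (cblinop_apply T y) (e b) = (\<Sum>a\<in>blk m. F (fst b) b a * cinner y (e a))"
    using block_operator[OF blocks, of "\<lambda>b a. F (fst b) b a"] by blast
  have T: "cinner (cblinop_apply T y) (e b) = (\<Sum>a\<in>blk m. F m b a * cinner y (e a))"
    if "b \<in> blk m" for m b y
    using T'[OF that] fst[OF that] by simp
  have Te: "cblinop_apply T (e a) = (\<Sum>b\<in>blk k. F k b a *\<^sub>C e b)" if a: "a \<in> blk k" for a k
  proof (rule basis_ext)
    fix c assume c: "c \<in> (\<Union>k. blk k)"
    then obtain m where m: "c \<in> blk m" by blast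
    have "cinner (cblinop_apply T (e a)) (e c) = (\<Sum>b\<in>blk m. if a = b then F m c b else 0)"
      unfolding T[OF m] by (intro sum.cong refl) (simp add: orthonormal_block[OF a])
    also have "\<dots> = (if a \<in> blk m then F m c a else 0)"
      using finite_torsion_block[of p m] by simp
    also have "\<dots> = (if c \<in> blk k then F k c a else 0)"
      using a m fst by metis
    also have "\<dots> = (\<Sum>b\<in>blk k. if b = c then F k b a else 0)"
      using finite_torsion_block[of p k] by simp
    also have "\<dots> = cinner (\<Sum>b\<in>blk k. F k b a *\<^sub>C e b) (e c)"
      unfolding cinner_sum_left
      by (intro sum.cong refl) (simp add: cinner_scaleC_left orthonormal_block[OF _ m])
    finally show "cinner (cblinop_apply T (e a)) (e c) = cinner (\<Sum>b\<in>blk k. F k b a *\<^sub>C e b) (e c)" .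
  qed
  define \<G> where "\<G> = {U1 1, U1 (-1), U2 1, U2 (-1), D1, D2, T}"
  show thesis
  proof (rule that[of \<G>])
    show "finite \<G>" by (simp add: \<G>_def)
    fix x k d assume d: "\<And>g. g \<in> \<G> \<Longrightarrow> hs_norm k (x * g - g * x) \<le> d"
    have "L2_set (\<lambda>a. norm (cblinop_apply x (e a) - cinner (cblinop_apply x (e a)) (e a) *\<^sub>C e a)) (blk k)
        \<le> 161 * d"
      by (rule off_diagonal_small[OF U1 U2 D1 D2]) (use d in \<open>auto simp: \<G>_def\<close>)
    moreover have "L2_set (\<lambda>a. norm (cblinop_apply (x * T - T * x) (e a))) (blk k) \<le> d"
      using d[of T] by (simp add: \<G>_def hs_norm_def)
    ultimately obtain c where c: "c \<in> blk k" "L2_set (\<lambda>a. norm (cblinop_apply x (e a) -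
        cinner (cblinop_apply x (e c)) (e c) *\<^sub>C e a)) (blk k) \<le> 3 * (161 * d) + d"
      using nearly_scalar[OF finite_torsion_block block_nonempty _ F T Te] by blast
    have cI: "c \<in> (\<Union>k. blk k)" using c(1) by blast
    \<comment> \<open>The scalar is a diagonal entry of \<open>x\<close>, which bounds it
      independently of \<open>k\<close>.\<close>
    have "cmod (cinner (cblinop_apply x (e c)) (e c)) \<le> norm x"
      using Cauchy_Schwarz_cinner[of "cblinop_apply x (e c)" "e c"] norm_cblinop_apply[of x "e c"]
      by (simp add: norm_basis[OF cI])
    with c(2) show "\<exists>c. cmod c \<le> norm x \<and> hs_norm k (x - c *\<^sub>C 1) \<le> 484 * d"
      by (auto simp: hs_norm_def)
  qed
qed

end

section \<open>Separable subalgebras\<close>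

text \<open>Syntax for noncommutative star-polynomials with scalars in the Gaussian rationals. Terms
  over a countable alphabet are countable, hence so are their values.\<close>

datatype 'a star_term = Gen 'a | Sum "'a star_term" "'a star_term" | Prod "'a star_term" "'a star_term"
  | Adj "'a star_term" | Scal rat rat "'a star_term"

instance star_term :: (countable) countable by countable_datatype

primrec star_eval :: "('i \<Rightarrow> 'a::cstar_algebra) \<Rightarrow> 'i star_term \<Rightarrow> 'a" where
  "star_eval g (Gen i) = g i"
| "star_eval g (Sum s t) = star_eval g s + star_eval g t"
| "star_eval g (Prod s t) = star_eval g s * star_eval g t"
| "star_eval g (Adj t) = star (star_eval g t)"
| "star_eval g (Scal p q t) = Complex (of_rat p) (of_rat q) *\<^sub>C star_eval g t"

lemma bounded_linear_star: "bounded_linear (star :: 'a::cstar_algebra \<Rightarrow> 'a)"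
  by (rule bounded_linear_intro[of _ 1])
    (simp_all add: star_add star_scaleC scaleR_scaleC norm_star_cblinop)

lemma rational_complex_dense: "z \<in> closure (range (\<lambda>(p, q). Complex (of_rat p) (of_rat q)))"
proof (unfold closure_approachable, intro allI impI)
  fix d :: real assume "d > 0"
  then have d: "d / 2 > 0" by simp
  obtain p where p: "Re z - d / 2 < of_rat p" "of_rat p < Re z"
    using of_rat_dense[of "Re z - d / 2" "Re z"] d by auto
  obtain q where q: "Im z - d / 2 < of_rat q" "of_rat q < Im z"
    using of_rat_dense[of "Im z - d / 2" "Im z"] d by auto
  have "dist (Complex (of_rat p) (of_rat q)) z \<le> \<bar>of_rat p - Re z\<bar> + \<bar>of_rat q - Im z\<bar>"
    using cmod_le[of "Complex (of_rat p) (of_rat q) - z"] by (simp add: dist_norm)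
  also have "\<dots> < d" using p q by linarith
  finally show "\<exists>y\<in>range (\<lambda>(p, q). Complex (of_rat p) (of_rat q)). dist y z < d" by force
qed

text \<open>The values of all terms form a countable set \<open>D\<close>; its closure inherits the
  operations by continuity.\<close>

lemma separable_cstar_subalgebra:
  fixes S :: "'a::cstar_algebra set"
  assumes "countable S" "S \<noteq> {}"
  obtains B where "cstar_subalgebra B" "separable_space (top_of_set B)" "S \<subseteq> B"
proof -
  define g where "g = from_nat_into S"
  define D where "D = range (star_eval g)"
  have gS: "range g = S" using assms by (simp add: g_def range_from_nat_into)
  have gen: "g i \<in> D" for i
    unfolding D_def by (rule range_eqI[of _ _ "Gen i"]) simp
  have D: "x \<in> D \<Longrightarrow> y \<in> D \<Longrightarrow> x + y \<in> D" "x \<in> D \<Longrightarrow> y \<in> D \<Longrightarrow> x * y \<in> D"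
    "x \<in> D \<Longrightarrow> star x \<in> D" "x \<in> D \<Longrightarrow> Complex (of_rat p) (of_rat q) *\<^sub>C x \<in> D" for x y p q
    unfolding D_def by (auto simp flip: star_eval.simps(2-5))
  have plus: "x + y \<in> closure D" if "x \<in> closure D" "y \<in> closure D" for x y
  proof -
    have "(\<lambda>(x, y). x + y) ` (closure (D \<times> D)) \<subseteq> closure D"
      by (rule image_closure_subset) (use D in \<open>auto intro!: continuous_intros subsetD[OF closure_subset] simp: case_prod_beta\<close>)
    then show ?thesis using that by (auto simp: closure_Times)
  qed
  have times: "x * y \<in> closure D" if "x \<in> closure D" "y \<in> closure D" for x y
  proof -
    have "(\<lambda>(x, y). x * y) ` (closure (D \<times> D)) \<subseteq> closure D"
      by (rule image_closure_subset) (use D in \<open>auto intro!: continuous_intros subsetD[OF closure_subset] simp: case_prod_beta\<close>)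
    then show ?thesis using that by (auto simp: closure_Times)
  qed
  have star: "star x \<in> closure D" if "x \<in> closure D" for x
  proof -
    have "star ` closure D \<subseteq> closure D"
      by (rule image_closure_subset)
        (use D in \<open>auto intro!: linear_continuous_on bounded_linear_star subsetD[OF closure_subset]\<close>)
    then show ?thesis using that by blast
  qed
  \<comment> \<open>Two passages to the limit: a Gaussian rational scalar preserves the closure by
    continuity in the vector, an arbitrary one by continuity in the scalar.\<close>
  have scale: "c *\<^sub>C x \<in> closure D" if "x \<in> closure D" for c x
  proof -
    define Q where "Q = range (\<lambda>(p, q). Complex (of_rat p) (of_rat q))"
    have "(\<lambda>x. q *\<^sub>C x) ` closure D \<subseteq> closure D" if "q \<in> Q" for q
      by (rule image_closure_subset)
        (use D that in \<open>auto intro!: linear_continuous_on bounded_linear_scaleC subsetD[OF closure_subset] simp: Q_def\<close>)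
    then have q: "q *\<^sub>C x \<in> closure D" if "q \<in> Q" for q using that \<open>x \<in> closure D\<close> by blast
    have "bounded_linear (\<lambda>c. c *\<^sub>C x)"
      by (rule bounded_linear_intro[of _ "norm x"])
        (simp_all add: scaleC_add_left scaleR_scaleC scaleC_scaleC norm_scaleC scaleR_conv_of_real)
    then have "(\<lambda>c. c *\<^sub>C x) ` closure Q \<subseteq> closure D"
      by (intro image_closure_subset) (use q in \<open>auto intro!: linear_continuous_on\<close>)
    then show ?thesis using rational_complex_dense[of c] unfolding Q_def by blast
  qed
  have "0 \<in> closure D"
    using scale[of "g 0" 0] gen closure_subset by auto
  then have "cstar_subalgebra (closure D)"
    unfolding cstar_subalgebra_def complex_vector.subspace_def
    using plus times star scale by auto
  moreover have "separable_space (top_of_set (closure D))"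
    unfolding separable_space_def
  proof (intro exI conjI)
    show "countable D" by (simp add: D_def)
    show "D \<subseteq> topspace (top_of_set (closure D))" using closure_subset by simp
    show "top_of_set (closure D) closure_of D = topspace (top_of_set (closure D))"
      using closure_subset[of D] by (simp add: closure_of_subtopology Int_absorb1)
  qed
  moreover have "S \<subseteq> closure D" using gen gS closure_subset by blast
  ultimately show thesis by (rule that)
qed

section \<open>The ideal of asymptotically small elements\<close>

context torus_basis
begin

text \<open>Normalised so that the identity has value 1 on each block, which later makes the ideal
  proper.\<close>

definition mean_hs :: "nat \<Rightarrow> 'h cblinop \<Rightarrow> real" where
  "mean_hs k x = hs_norm k x / sqrt (card (blk k))"

lemma card_block_pos: "sqrt (card (blk k)) > 0"
  using finite_torsion_block block_nonempty by (simp add: card_gt_0_iff)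

lemma mean_hs_nonneg: "0 \<le> mean_hs k x"
  by (simp add: mean_hs_def hs_norm_def)

lemma mean_hs_le: "(\<And>a. a \<in> blk k \<Longrightarrow> norm (cblinop_apply x (e a)) \<le> c) \<Longrightarrow> 0 \<le> c \<Longrightarrow> mean_hs k x \<le> c"
proof -
  assume *: "\<And>a. a \<in> blk k \<Longrightarrow> norm (cblinop_apply x (e a)) \<le> c" "0 \<le> c"
  have "hs_norm k x \<le> L2_set (\<lambda>_. c) (blk k)" unfolding hs_norm_def by (intro L2_set_mono *) auto
  then show ?thesis
    using card_block_pos[of k] * by (simp add: mean_hs_def L2_set_constant field_simps)
qed

lemma norm_basis_block: "a \<in> blk k \<Longrightarrow> norm (e a) = 1"
  by (rule norm_basis) auto

lemma norm_apply_basis: "a \<in> blk k \<Longrightarrow> norm (cblinop_apply x (e a)) \<le> norm x"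
  using norm_cblinop_apply[of x "e a"] norm_basis_block[of a k] by simp

lemma mean_hs_le_norm: "mean_hs k x \<le> norm x"
  by (intro mean_hs_le norm_apply_basis) auto

lemma mean_hs_1: "mean_hs k 1 = 1"
proof -
  have "hs_norm k 1 = L2_set (\<lambda>_. 1) (blk k)"
    unfolding hs_norm_def by (rule L2_set_cong) (simp_all add: norm_basis_block)
  then show ?thesis using card_block_pos[of k] by (simp add: mean_hs_def L2_set_constant)
qed

lemma mean_hs_add: "mean_hs k (x + y) \<le> mean_hs k x + mean_hs k y"
proof -
  have "hs_norm k (x + y) \<le> L2_set (\<lambda>a. norm (cblinop_apply x (e a)) + norm (cblinop_apply y (e a))) (blk k)"
    unfolding hs_norm_def by (intro L2_set_mono) (auto simp: norm_triangle_ineq)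
  also have "\<dots> \<le> hs_norm k x + hs_norm k y" unfolding hs_norm_def by (rule L2_set_triangle_ineq)
  finally show ?thesis
    using card_block_pos[of k] by (simp add: mean_hs_def divide_right_mono flip: add_divide_distrib)
qed

text \<open>A left factor acts on each vector \<open>y (e a)\<close> separately. A right factor may
  carry vectors out of the block, so right multiplication is treated only for nearly scalar
  operators.\<close>

lemma mean_hs_mult: "mean_hs k (x * y) \<le> norm x * mean_hs k y"
proof -
  have "hs_norm k (x * y) \<le> L2_set (\<lambda>a. norm x * norm (cblinop_apply y (e a))) (blk k)"
    unfolding hs_norm_def by (intro L2_set_mono) (auto simp: norm_cblinop_apply)
  also have "\<dots> = norm x * hs_norm k y" unfolding hs_norm_def by (rule L2_set_right_distrib[symmetric]) simp
  finally have "hs_norm k (x * y) / sqrt (card (blk k)) \<le> norm x * hs_norm k y / sqrt (card (blk k))"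
    by (rule divide_right_mono) simp
  then show ?thesis by (simp add: mean_hs_def)
qed

lemma mean_hs_scaleC: "mean_hs k (c *\<^sub>C x) = cmod c * mean_hs k x"
  by (simp add: mean_hs_def hs_norm_def norm_scaleC L2_set_right_distrib)

lemma mean_hs_diff: "mean_hs k (x - y) \<le> mean_hs k x + mean_hs k y"
  using mean_hs_add[of k x "- y"] mean_hs_scaleC[of k "-1" y] by simp

definition negligible :: "'h cblinop \<Rightarrow> bool" where
  "negligible x \<longleftrightarrow> (\<lambda>k. mean_hs k x) \<longlonglongrightarrow> 0"

lemma mean_hs_limit_0:
  assumes "g \<longlonglongrightarrow> 0" "\<And>k. mean_hs k (x k) \<le> g k"
  shows "(\<lambda>k. mean_hs k (x k)) \<longlonglongrightarrow> 0"
  by (rule tendsto_sandwich[OF _ _ tendsto_const assms(1)]) (use assms(2) mean_hs_nonneg in auto)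

text \<open>Only finitely many basis vectors have large images, and they meet finitely many
  blocks.\<close>

lemma negligible_compact:
  assumes "compact_operator x"
  shows "negligible x"
  unfolding negligible_def
proof (rule LIMSEQ_I)
  fix d :: real assume d: "d > 0"
  then have d2: "d / 2 > 0" by simp
  define L where "L = {a \<in> \<Union>k. blk k. d / 2 \<le> norm (cblinop_apply x (e a))}"
  have "finite L" unfolding L_def by (rule finite_large_compact[OF assms d2])
  then have "finite (fst ` L)" by simp
  then obtain n where n: "\<And>k. k \<in> fst ` L \<Longrightarrow> k < n" using finite_nat_set_iff_bounded[of "fst ` L"] by auto
  have "mean_hs k x \<le> d / 2" if "n \<le> k" for k
  proof (rule mean_hs_le)
    fix a assume a: "a \<in> blk k"
    have "k \<notin> fst ` L" using n that by force
    then have "a \<notin> L" using a by (force simp: torsion_block_def)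
    then show "norm (cblinop_apply x (e a)) \<le> d / 2" using a by (auto simp: L_def)
  qed (use d in simp)
  then show "\<exists>n. \<forall>k\<ge>n. norm (mean_hs k x - 0) < d"
    using d by (intro exI[of _ n]) (auto simp: mean_hs_nonneg intro: le_less_trans[of _ "d / 2"])
qed

lemma negligible_add: "negligible x \<Longrightarrow> negligible y \<Longrightarrow> negligible (x + y)"
  unfolding negligible_def
  by (rule mean_hs_limit_0[OF _ mean_hs_add]) (use tendsto_add[of _ 0 sequentially _ 0] in auto)

lemma negligible_mult: "negligible y \<Longrightarrow> negligible (x * y)"
  unfolding negligible_def
  by (rule mean_hs_limit_0[OF _ mean_hs_mult]) (rule tendsto_mult_right_zero)

lemma negligible_scaleC: "negligible x \<Longrightarrow> negligible (c *\<^sub>C x)"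
  using negligible_mult[of x "c *\<^sub>C 1"] by (simp add: mult_scaleC_left)

lemma negligible_cong:
  assumes "abs_calkin x = abs_calkin y" "negligible x"
  shows "negligible y"
proof -
  have "compact_operator (y - x)" using assms(1) by (simp flip: calkin.abs_eq_iff)
  then show ?thesis using negligible_add[OF assms(2) negligible_compact] by fastforce
qed

text \<open>The scalars may vary with the block and need not converge. Their uniform bound keeps a
  null sequence null after multiplication by them.\<close>

definition nearly_scalar_op :: "'h cblinop \<Rightarrow> bool" where
  "nearly_scalar_op x \<longleftrightarrow>
    (\<exists>c. (\<forall>k. cmod (c k) \<le> norm x) \<and> (\<lambda>k. mean_hs k (x - c k *\<^sub>C 1)) \<longlonglongrightarrow> 0)"

text \<open>Replacing \<open>y\<close> by a scalar on each block leaves the error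
  \<open>x * (y - c k *\<^sub>C 1)\<close>, in which the small factor stands on the right, where it
  can be estimated.\<close>

lemma negligible_mult_right:
  assumes "negligible x" "nearly_scalar_op y"
  shows "negligible (x * y)"
proof -
  obtain c where c: "\<And>k. cmod (c k) \<le> norm y" "(\<lambda>k. mean_hs k (y - c k *\<^sub>C 1)) \<longlonglongrightarrow> 0"
    using assms(2) by (auto simp: nearly_scalar_op_def)
  show ?thesis
    unfolding negligible_def
  proof (rule mean_hs_limit_0)
    show "(\<lambda>k. norm x * mean_hs k (y - c k *\<^sub>C 1) + norm y * mean_hs k x) \<longlonglongrightarrow> 0"
      using assms(1) c(2) unfolding negligible_def
      by (intro tendsto_add_zero tendsto_mult_right_zero)
    fix k
    have "x * y = x * (y - c k *\<^sub>C 1) + c k *\<^sub>C x"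
      by (simp add: right_diff_distrib mult_scaleC_right)
    then have "mean_hs k (x * y) \<le> mean_hs k (x * (y - c k *\<^sub>C 1)) + mean_hs k (c k *\<^sub>C x)"
      by (metis mean_hs_add)
    also have "\<dots> \<le> norm x * mean_hs k (y - c k *\<^sub>C 1) + norm y * mean_hs k x"
      unfolding mean_hs_scaleC using c(1) by (intro add_mono mean_hs_mult mult_right_mono mean_hs_nonneg)
    finally show "mean_hs k (x * y) \<le> norm x * mean_hs k (y - c k *\<^sub>C 1) + norm y * mean_hs k x" .
  qed
qed

text \<open>Scalars commute, so the commutator can be rewritten as a sum of terms each ending on the
  right in one of the small differences \<open>x'\<close> and \<open>y'\<close>. Hence only the
  estimate for left factors is used.\<close>

lemma negligible_commutator:
  assumes "nearly_scalar_op x" "nearly_scalar_op y"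
  shows "negligible (x * y - y * x)"
proof -
  obtain b where b: "\<And>k. cmod (b k) \<le> norm x" "(\<lambda>k. mean_hs k (x - b k *\<^sub>C 1)) \<longlonglongrightarrow> 0"
    using assms(1) by (auto simp: nearly_scalar_op_def)
  obtain c where c: "\<And>k. cmod (c k) \<le> norm y" "(\<lambda>k. mean_hs k (y - c k *\<^sub>C 1)) \<longlonglongrightarrow> 0"
    using assms(2) by (auto simp: nearly_scalar_op_def)
  show ?thesis
    unfolding negligible_def
  proof (rule mean_hs_limit_0)
    show "(\<lambda>k. 2 * norm x * mean_hs k (y - c k *\<^sub>C 1) + 2 * norm y * mean_hs k (x - b k *\<^sub>C 1)) \<longlonglongrightarrow> 0"
      using b(2) c(2) by (intro tendsto_add_zero tendsto_mult_right_zero)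
    fix k
    define x' where "x' = x - b k *\<^sub>C 1"
    define y' where "y' = y - c k *\<^sub>C 1"
    have "x * y - y * x = (x * y' - b k *\<^sub>C y') - (y * x' - c k *\<^sub>C x')"
      by (simp add: x'_def y'_def right_diff_distrib mult_scaleC_right
          complex_vector.scale_right_diff_distrib scaleC_scaleC mult.commute)
    then have "mean_hs k (x * y - y * x) = mean_hs k ((x * y' - b k *\<^sub>C y') - (y * x' - c k *\<^sub>C x'))"
      by (rule arg_cong)
    also have "\<dots> \<le>
        (mean_hs k (x * y') + mean_hs k (b k *\<^sub>C y')) + (mean_hs k (y * x') + mean_hs k (c k *\<^sub>C x'))"
      by (rule order_trans[OF mean_hs_diff add_mono[OF mean_hs_diff mean_hs_diff]])
    also have "\<dots> \<le> (norm x * mean_hs k y' + norm x * mean_hs k y') + (norm y * mean_hs k x' + norm y * mean_hs k x')"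
      unfolding mean_hs_scaleC using b(1) c(1)
      by (intro add_mono mean_hs_mult mult_right_mono mean_hs_nonneg)
    finally show "mean_hs k (x * y - y * x) \<le>
        2 * norm x * mean_hs k (y - c k *\<^sub>C 1) + 2 * norm y * mean_hs k (x - b k *\<^sub>C 1)"
      by (simp add: x'_def y'_def)
  qed
qed

text \<open>Compact commutators are negligible. The sum of their norms over the finite set of
  generators serves as the common bound on each block.\<close>

lemma commutant_nearly_scalar:
  obtains \<G> :: "'h cblinop set" where "finite \<G>"
    "\<And>x. (\<And>g. g \<in> \<G> \<Longrightarrow> compact_operator (x * g - g * x)) \<Longrightarrow> nearly_scalar_op x"
proof -
  obtain \<G> where \<G>: "finite \<G>" "\<And>x k d. (\<And>g. g \<in> \<G> \<Longrightarrow> hs_norm k (x * g - g * x) \<le> d) \<Longrightarrow>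
      \<exists>c. cmod c \<le> norm x \<and> hs_norm k (x - c *\<^sub>C 1) \<le> 484 * d"
    using spectral_gap by metis
  show thesis
  proof (rule that[OF \<G>(1)])
    fix x assume x: "\<And>g. g \<in> \<G> \<Longrightarrow> compact_operator (x * g - g * x)"
    define s where "s k = (\<Sum>g\<in>\<G>. hs_norm k (x * g - g * x))" for k
    have "hs_norm k (x * g - g * x) \<le> s k" if "g \<in> \<G>" for g k
      unfolding s_def using that \<G>(1) by (intro member_le_sum) (auto simp: hs_norm_def)
    then have "\<forall>k. \<exists>c. cmod c \<le> norm x \<and> hs_norm k (x - c *\<^sub>C 1) \<le> 484 * s k"
      using \<G>(2) by blast
    then obtain c where c: "\<And>k. cmod (c k) \<le> norm x" "\<And>k. hs_norm k (x - c k *\<^sub>C 1) \<le> 484 * s k"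
      by metis
    have "(\<lambda>k. mean_hs k (x - c k *\<^sub>C 1)) \<longlonglongrightarrow> 0"
    proof (rule mean_hs_limit_0)
      have "(\<lambda>k. \<Sum>g\<in>\<G>. mean_hs k (x * g - g * x)) \<longlonglongrightarrow> 0"
        using negligible_compact[OF x] unfolding negligible_def by (intro tendsto_null_sum)
      then show "(\<lambda>k. 484 * (\<Sum>g\<in>\<G>. mean_hs k (x * g - g * x))) \<longlonglongrightarrow> 0"
        by (rule tendsto_mult_right_zero)
      have "mean_hs k (x - c k *\<^sub>C 1) \<le> 484 * s k / sqrt (card (blk k))" for k
        unfolding mean_hs_def using c(2) by (intro divide_right_mono) auto
      then show "mean_hs k (x - c k *\<^sub>C 1) \<le> 484 * (\<Sum>g\<in>\<G>. mean_hs k (x * g - g * x))" for k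
        by (simp add: s_def mean_hs_def flip: sum_divide_distrib)
    qed
    with c(1) show "nearly_scalar_op x" unfolding nearly_scalar_op_def by blast
  qed
qed

section \<open>The closed ideal in the Calkin algebra\<close>

definition negligible_class :: "'h calkin \<Rightarrow> bool" where
  "negligible_class q \<longleftrightarrow> (\<exists>x. abs_calkin x = q \<and> negligible x)"

lemma negligible_class_abs: "negligible_class (abs_calkin x) \<longleftrightarrow> negligible x"
  using negligible_cong by (auto simp: negligible_class_def)

text \<open>The normalised norm is at most the operator norm. If \<open>r\<close> is a nearby
  negligible class, \<open>q - r\<close> has a lift \<open>z\<close> of small norm, and
  \<open>x - z\<close> lifts \<open>r\<close>, hence is negligible.\<close>

lemma closed_negligible_class: "closed (Collect negligible_class)"
  unfolding closure_subset_eq[symmetric]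
proof (rule subsetI)
  fix q :: "'h calkin"
  assume "q \<in> closure (Collect negligible_class)"
  then have q: "\<forall>d>0. \<exists>r\<in>Collect negligible_class. dist r q < d"
    by (simp only: closure_approachable)
  obtain x where x: "abs_calkin x = q" using Quotient3_abs_rep[OF Quotient3_calkin] by blast
  have "negligible x"
    unfolding negligible_def
  proof (rule LIMSEQ_I)
    fix d :: real assume d: "d > 0"
    then obtain r where r: "negligible_class r" "norm (q - r) < d / 2"
      using q[rule_format, of "d / 2"] by (auto simp: dist_norm norm_minus_commute)
    obtain z where z: "abs_calkin z = q - r" "norm z < d / 2" using norm_calkin_lift[OF r(2)] by blast
    have "abs_calkin (x - z) = r" using x z by (simp flip: abs_calkin_simps)
    then have "negligible (x - z)" using r negligible_class_abs by metis
    then obtain n where n: "\<And>k. n \<le> k \<Longrightarrow> mean_hs k (x - z) < d / 2"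
      unfolding negligible_def using LIMSEQ_D[of _ 0 "d / 2"] d mean_hs_nonneg
      by (metis abs_of_nonneg diff_zero half_gt_zero real_norm_def)
    have "mean_hs k x < d" if "n \<le> k" for k
      using mean_hs_add[of k "x - z" z] mean_hs_le_norm[of k z] z(2) n[OF that] by simp
    then show "\<exists>n. \<forall>k\<ge>n. norm (mean_hs k x - 0) < d" by (auto simp: mean_hs_nonneg)
  qed
  then show "q \<in> Collect negligible_class" using x negligible_class_abs by auto
qed

lemma separable_subalgebra_exists:
  "\<exists>B :: 'h calkin set.
    cstar_subalgebra B \<and> separable_space (top_of_set B) \<and>
    \<not> (\<exists>A. cstar_subalgebra A \<and> A \<subseteq> relative_commutant B \<and> 1 \<in> A \<and>
           simple_algebra A \<and> \<not> commutative_algebra A)"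
proof -
  obtain \<G> where \<G>: "finite \<G>"
    "\<And>x :: 'h cblinop. (\<And>g. g \<in> \<G> \<Longrightarrow> compact_operator (x * g - g * x)) \<Longrightarrow> nearly_scalar_op x"
    using commutant_nearly_scalar by metis
  \<comment> \<open>The unit makes the generating set visibly nonempty.\<close>
  have "countable (insert 1 (abs_calkin ` \<G>))" using \<G>(1) by (simp add: countable_finite)
  then obtain B where B: "cstar_subalgebra B" "separable_space (top_of_set B)" "insert 1 (abs_calkin ` \<G>) \<subseteq> B"
    by (rule separable_cstar_subalgebra) auto
  have ns: "nearly_scalar_op x" if "abs_calkin x \<in> relative_commutant B" for x
  proof (rule \<G>(2))
    fix g assume "g \<in> \<G>"
    then have "abs_calkin x * abs_calkin g = abs_calkin g * abs_calkin x"
      using that B(3) by (auto simp: relative_commutant_def)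
    then show "compact_operator (x * g - g * x)"
      by (simp add: abs_calkin_simps calkin.abs_eq_iff)
  qed
  have "commutative_algebra A"
    if A: "cstar_subalgebra A" "A \<subseteq> relative_commutant B" "1 \<in> A" "simple_algebra A" for A
  proof -
    have surj: "\<exists>x. q = abs_calkin x \<and> nearly_scalar_op x" if "q \<in> A" for q
      using Quotient3_abs_rep[OF Quotient3_calkin, of q] ns that A(2) by (metis subsetD)
    have A_add: "q + r \<in> A" and A_mult: "q * r \<in> A" and A_scale: "c *\<^sub>C q \<in> A"
      and A_diff: "q - r \<in> A" if "q \<in> A" "r \<in> A" for q r c
      using A(1) that complex_vector.subspace_diff
      by (auto simp: cstar_subalgebra_def complex_vector.subspace_add complex_vector.subspace_scale)
    have A_zero: "0 \<in> A" and A_closed: "closed A"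
      using A(1) by (auto simp: cstar_subalgebra_def complex_vector.subspace_0)
    \<comment> \<open>The elements of \<open>A\<close> that vanish asymptotically on the blocks.
      Closedness under right multiplication uses that elements of the commutant have nearly scalar
      lifts.\<close>
    define J where "J = {q \<in> A. negligible_class q}"
    have J_iff: "abs_calkin x \<in> J \<longleftrightarrow> abs_calkin x \<in> A \<and> negligible x" for x
      by (simp add: J_def negligible_class_abs)
    have abs: "\<exists>x. q = abs_calkin x \<and> negligible x \<and> q \<in> A" if "q \<in> J" for q
      using that by (auto simp: J_def negligible_class_def)
    have "closed_ideal_of J A"
      unfolding closed_ideal_of_def complex_vector.subspace_def
    proof (intro conjI ballI allI)
      show "J \<subseteq> A" by (auto simp: J_def)
      have "J = A \<inter> Collect negligible_class" by (auto simp: J_def)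
      then show "closed J" using A_closed closed_negligible_class by (simp add: closed_Int)
      show "0 \<in> J"
        using A_zero negligible_compact[OF compact_operator_0]
        by (simp add: zero_calkin_def J_iff)
    next
      fix q r assume q: "q \<in> J" and r: "r \<in> J"
      obtain x where x: "q = abs_calkin x" "negligible x" "q \<in> A" using abs[OF q] by blast
      obtain y where y: "r = abs_calkin y" "negligible y" "r \<in> A" using abs[OF r] by blast
      show "q + r \<in> J"
        using A_add[OF x(3) y(3)] negligible_add[OF x(2) y(2)]
        by (simp add: x(1) y(1) abs_calkin_simps J_iff)
    next
      fix c q assume q: "q \<in> J"
      obtain x where x: "q = abs_calkin x" "negligible x" "q \<in> A" using abs[OF q] by blast
      show "c *\<^sub>C q \<in> J"
        using A_scale[OF x(3,3), of c] negligible_scaleC[OF x(2), of c]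
        by (simp add: x(1) abs_calkin_simps J_iff)
    next
      fix a q assume a: "a \<in> A" and q: "q \<in> J"
      obtain x where x: "q = abs_calkin x" "negligible x" "q \<in> A" using abs[OF q] by blast
      obtain y where y: "a = abs_calkin y" "nearly_scalar_op y" using surj[OF a] by blast
      show "a * q \<in> J"
        using A_mult[OF a x(3)] negligible_mult[OF x(2), of y]
        by (simp add: x(1) y(1) abs_calkin_simps J_iff)
      show "q * a \<in> J"
        using A_mult[OF x(3) a] negligible_mult_right[OF x(2) y(2)]
        by (simp add: x(1) y(1) abs_calkin_simps J_iff)
    qed
    moreover have "J \<noteq> A"
    proof
      assume "J = A"
      then have "negligible_class (abs_calkin 1)" using A(3) by (auto simp: J_def one_calkin_def)
      then have "(\<lambda>k. 1 :: real) \<longlonglongrightarrow> 0"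
        by (simp add: negligible_class_abs negligible_def mean_hs_1)
      then show False by (simp add: LIMSEQ_const_iff)
    qed
    \<comment> \<open>The ideal misses the unit, so simplicity makes it zero. It contains all
      commutators, which therefore vanish.\<close>
    ultimately have J0: "J = {0}" using A(4) by (auto simp: simple_algebra_def)
    have "q * r = r * q" if qr: "q \<in> A" "r \<in> A" for q r
    proof -
      obtain x y where xy: "q = abs_calkin x" "nearly_scalar_op x" "r = abs_calkin y" "nearly_scalar_op y"
        using surj qr by metis
      have "q * r - r * q \<in> J"
        using negligible_commutator[OF xy(2,4)] A_diff[OF A_mult[OF qr] A_mult[OF qr(2,1)]]
        by (simp add: xy(1,3) abs_calkin_simps J_iff)
      then show ?thesis using J0 by simp
    qed
    then show ?thesis by (simp add: commutative_algebra_def)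
  qed
  with B show ?thesis by blast
qed

end

section \<open>Choice of the primes and of the basis\<close>

theorem theorem2:
  assumes separable: "separable_space (euclidean :: 'h::chilbert_space topology)"
    and infinite_dimensional: "\<not> (\<exists>S :: 'h set. finite S \<and> cspan S = UNIV)"
  shows "\<exists>B :: 'h calkin set.
    cstar_subalgebra B \<and> separable_space (top_of_set B) \<and>
    \<not> (\<exists>A. cstar_subalgebra A \<and> A \<subseteq> relative_commutant B \<and> 1 \<in> A \<and>
           simple_algebra A \<and> \<not> commutative_algebra A)"
proof -
  \<comment> \<open>All primes in increasing order, so that the blocks belong to distinct
    primes.\<close>
  define p :: "nat \<Rightarrow> int" where "p k = int (enumerate {n. prime n} k)" for k
  have p: "prime (p k)" for k
    using enumerate_in_set[OF primes_infinite, of k] by (simp add: p_def)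
  have inj: "inj p"
  proof (rule injI)
    show "k = l" if "p k = p l" for k l
      using that strict_mono_eq[OF strict_mono_enumerate[OF primes_infinite], of k l] by (simp add: p_def)
  qed
  have "infinite (\<Union>k. torsion_block p k)"
  proof
    assume "finite (\<Union>k. torsion_block p k)"
    then have "finite (fst ` (\<Union>k. torsion_block p k))" by (rule finite_imageI)
    moreover have "fst ` (\<Union>k. torsion_block p k) = UNIV"
    proof (intro UNIV_eq_I[symmetric])
      fix k
      have "(k, 1, 0) \<in> torsion_block p k" using p[of k] prime_gt_1_int[of "p k"] by (simp add: torsion_block_def)
      then show "k \<in> fst ` (\<Union>k. torsion_block p k)" by (intro image_eqI[of _ _ "(k, 1, 0)"]) auto
    qed
    ultimately show False by simp
  qed
  then obtain e :: "nat \<times> int \<times> int \<Rightarrow> 'h" where "orthonormal_basis (\<Union>k. torsion_block p k) e"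
    using orthonormal_basis_exists[OF assms countableI_type] by blast
  then interpret torus_basis p e
    by (simp add: torus_basis_def torus_basis_axioms_def p inj)
  show ?thesis by (rule separable_subalgebra_exists)
qed

end
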